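(* Let $N\geq 1$ be an integer. Let $\Psi\in C^1([1,\infty))$ with $\Psi>0$ and $\Psi'>0$ in $[1,\infty)$, and suppose that $\Psi$ is convex in $[R_0,\infty)$ for some $R_0>1$. The following conditions are equivalent: (i) $\Psi$ satisfies property (P) in $\mathbb{R}^N$. (ii) $\Psi$ satisfies property (P') in $\mathbb{R}^N$. (iii') $\displaystyle\int_1^\infty\frac{1}{\Psi'}=\infty$.
   Context: $B_R=\{x\in\mathbb{R}^N: |x|<R\}$. Property (P) in $\mathbb{R}^N$: a function $0<\Psi\in C([1,\infty))$ satisfies (P) if whenever $\varphi\in L^\infty_{loc}(\mathbb{R}^N)$ is a positive function and $\sigma\in H^1_{loc}(\mathbb{R}^N)$ satisfies $\sigma\,\mathrm{div}(\varphi^2\nabla\sigma)\geq 0$ in $\mathbb{R}^N$ in the distributional sense, and $\int_{B_R}(\varphi\sigma)^2\,dx\leq \Psi(R)$ for every $R\geq 1$, then $\sigma$ is necessarily constant. Property (P') in $\mathbb{R}^N$: the same as (P), with the inequality replaced by the equation $\mathrm{div}(\varphi^2\nabla\sigma)=0$ in $\mathbb{R}^N$ in the distributional sense. That is, $0<\Psi\in C([1,\infty))$ satisfies (P') if whenever $\varphi\in L^\infty_{loc}(\mathbb{R}^N)$ is a positive function, $\sigma\in H^1_{loc}(\mathbb{R}^N)$ satisfies $\mathrm{div}(\varphi^2\nabla\sigma)=0$ in the distributional sense, and $\int_{B_R}(\varphi\sigma)^2\,dx\leq\Psi(R)$ for every $R\geq 1$, then $\sigma$ is constant. Here $\sigma\,\mathrm{div}(\varphi^2\nabla\sigma)\geq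 0$ in the distributional sense means $\int_{\mathbb{R}^N}\left(\eta\,\varphi^2|\nabla\sigma|^2+\varphi^2\sigma\,\nabla\sigma\cdot\nabla\eta\right)dx\leq 0$ for every $0\leq\eta\in C_c^\infty(\mathbb{R}^N)$, and $\mathrm{div}(\varphi^2\nabla\sigma)=0$ in the distributional sense means $\int_{\mathbb{R}^N}\varphi^2\nabla\sigma\cdot\nabla\eta\,dx=0$ for every $\eta\in C_c^\infty(\mathbb{R}^N)$. As usual for such function classes, positivity of $\varphi$ and constancy of $\sigma$ are understood almost everywhere. *)

theory Defs
  imports "HOL-Analysis.Analysis"
begin

definition grad :: "('a::euclidean_space \<Rightarrow> real) \<Rightarrow> 'a \<Rightarrow> 'a" where
  "grad f x = (\<Sum>b\<in>Basis. frechet_derivative f (at x) b *\<^sub>R b)"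

(* Ck k f: f is k times continuously differentiable.  For the successor step no continuity of
   the Frechet derivative is demanded separately: it follows from that of the partials. *)
primrec Ck :: "nat \<Rightarrow> ('a::euclidean_space \<Rightarrow> real) \<Rightarrow> bool" where
  "Ck 0 f \<longleftrightarrow> continuous_on UNIV f"
| "Ck (Suc k) f \<longleftrightarrow> (\<forall>x. f differentiable (at x)) \<and>
     (\<forall>b\<in>Basis. Ck k (\<lambda>x. frechet_derivative f (at x) b))"

definition test_function :: "('a::euclidean_space \<Rightarrow> real) \<Rightarrow> bool" where
  "test_function \<eta> \<longleftrightarrow> (\<forall>k. Ck k \<eta>) \<and> compact (closure (support_on UNIV \<eta>))"

definition Linf_loc :: "('a::euclidean_space \<Rightarrow> real) \<Rightarrow> bool" where
  "Linf_loc f \<longleftrightarrow> f \<in> borel_measurable lebesgue \<and>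
     (\<forall>K. compact K \<longrightarrow> (\<exists>C. AE x in lebesgue. x \<in> K \<longrightarrow> \<bar>f x\<bar> \<le> C))"

definition L2_loc :: "('a::euclidean_space \<Rightarrow> 'b::euclidean_space) \<Rightarrow> bool" where
  "L2_loc f \<longleftrightarrow> f \<in> borel_measurable lebesgue \<and>
     (\<forall>K. compact K \<longrightarrow> set_integrable lebesgue K (\<lambda>x. (norm (f x))\<^sup>2))"

(* G is a version of the weak gradient of \<sigma>, and it is locally square integrable.
   Such a G is unique only up to null sets, hence a relation rather than a function. *)
definition has_L2_weak_gradient ::
    "('a::euclidean_space \<Rightarrow> real) \<Rightarrow> ('a \<Rightarrow> 'a) \<Rightarrow> bool" where
  "has_L2_weak_gradient \<sigma> G \<longleftrightarrow> L2_loc G \<and>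
     (\<forall>\<eta>. test_function \<eta> \<longrightarrow>
        (LINT x|lebesgue. \<sigma> x *\<^sub>R grad \<eta> x) = - (LINT x|lebesgue. \<eta> x *\<^sub>R G x))"

definition H1_loc :: "('a::euclidean_space \<Rightarrow> real) \<Rightarrow> bool" where
  "H1_loc \<sigma> \<longleftrightarrow> L2_loc \<sigma> \<and> (\<exists>G. has_L2_weak_gradient \<sigma> G)"

(* \<sigma> div(\<phi>^2 \<nabla>\<sigma>) \<ge> 0 in the distributional sense, where G = \<nabla>\<sigma> *)
definition sigma_div_nonneg ::
    "('a::euclidean_space \<Rightarrow> real) \<Rightarrow> ('a \<Rightarrow> real) \<Rightarrow> ('a \<Rightarrow> 'a) \<Rightarrow> bool" where
  "sigma_div_nonneg \<phi> \<sigma> G \<longleftrightarrow>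
     (\<forall>\<eta>. test_function \<eta> \<and> (\<forall>x. 0 \<le> \<eta> x) \<longrightarrow>
        (LINT x|lebesgue. \<eta> x * (\<phi> x)\<^sup>2 * (norm (G x))\<^sup>2
                          + (\<phi> x)\<^sup>2 * \<sigma> x * (G x \<bullet> grad \<eta> x)) \<le> 0)"

(* div(\<phi>^2 \<nabla>\<sigma>) = 0 in the distributional sense, where G = \<nabla>\<sigma> *)
definition div_zero :: "('a::euclidean_space \<Rightarrow> real) \<Rightarrow> ('a \<Rightarrow> 'a) \<Rightarrow> bool" where
  "div_zero \<phi> G \<longleftrightarrow>
     (\<forall>\<eta>. test_function \<eta> \<longrightarrow> (LINT x|lebesgue. (\<phi> x)\<^sup>2 * (G x \<bullet> grad \<eta> x)) = 0)"

definition growth_bound ::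
    "(real \<Rightarrow> real) \<Rightarrow> ('a::euclidean_space \<Rightarrow> real) \<Rightarrow> ('a \<Rightarrow> real) \<Rightarrow> bool" where
  "growth_bound \<Psi> \<phi> \<sigma> \<longleftrightarrow>
     (\<forall>R\<ge>1. (LINT x:ball 0 R|lebesgue. (\<phi> x * \<sigma> x)\<^sup>2) \<le> \<Psi> R)"

definition ae_constant :: "('a::euclidean_space \<Rightarrow> real) \<Rightarrow> bool" where
  "ae_constant \<sigma> \<longleftrightarrow> (\<exists>c. AE x in lebesgue. \<sigma> x = c)"

(* Both properties depend on the ambient space, which \<Psi> does not mention; it is passed as
   a type argument.  Only the values of \<Psi> on {1..} matter. *)
definition property_P :: "'a::euclidean_space itself \<Rightarrow> (real \<Rightarrow> real) \<Rightarrow> bool" where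
  "property_P _ \<Psi> \<longleftrightarrow>
     continuous_on {1..} \<Psi> \<and> (\<forall>R\<ge>1. 0 < \<Psi> R) \<and>
     (\<forall>(\<phi>::'a \<Rightarrow> real) \<sigma> G.
        Linf_loc \<phi> \<and> (AE x in lebesgue. 0 < \<phi> x) \<and>
        H1_loc \<sigma> \<and> has_L2_weak_gradient \<sigma> G \<and>
        sigma_div_nonneg \<phi> \<sigma> G \<and> growth_bound \<Psi> \<phi> \<sigma>
        \<longrightarrow> ae_constant \<sigma>)"

definition property_P' :: "'a::euclidean_space itself \<Rightarrow> (real \<Rightarrow> real) \<Rightarrow> bool" where
  "property_P' _ \<Psi> \<longleftrightarrow>
     continuous_on {1..} \<Psi> \<and> (\<forall>R\<ge>1. 0 < \<Psi> R) \<and>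
     (\<forall>(\<phi>::'a \<Rightarrow> real) \<sigma> G.
        Linf_loc \<phi> \<and> (AE x in lebesgue. 0 < \<phi> x) \<and>
        H1_loc \<sigma> \<and> has_L2_weak_gradient \<sigma> G \<and>
        div_zero \<phi> G \<and> growth_bound \<Psi> \<phi> \<sigma>
        \<longrightarrow> ae_constant \<sigma>)"

end

theory Submission
  imports Defs
begin

text \<open>
  The three conditions are linked in a cycle.

  \<^emph>\<open>(P) implies (P')\<close>, because a solution is a subsolution: formally one inserts \<open>\<eta> \<sigma>\<close> as a test
  function into the equation. Since \<open>\<sigma>\<close> is only in \<open>H\<^sup>1\<close>, the functions actually inserted are
  mollifications of \<open>\<eta> \<sigma>\<close>, whose gradients converge in mean square
  (\<open>div_zero_imp_sigma_div_nonneg\<close>).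

  \<^emph>\<open>Divergence of the integral implies (P).\<close> The test function \<open>\<eta>\<^sup>2\<close> and Young's inequality give
  \<open>\<integral> \<eta>\<^sup>2 |\<phi> \<nabla>\<sigma>|\<^sup>2 \<le> 4 \<integral> (\<phi> \<sigma>)\<^sup>2 |\<nabla>\<eta>|\<^sup>2\<close> (\<open>Caccioppoli\<close>). Let \<open>\<eta>\<close> be radial, equal to 1 on the
  ball of radius \<open>a\<close> and to 0 outside the ball of radius \<open>b\<close>, with slope of order \<open>1 / (T \<Psi>')\<close> in
  between, where \<open>T\<close> is the integral of \<open>1 / \<Psi>'\<close> over \<open>[a, b]\<close>. Convexity makes \<open>1 / \<Psi>'\<^sup>2\<close> decreasing
  beyond \<open>R\<^sub>0\<close>, so for \<open>a > R\<^sub>0\<close> the weight on the right is a superposition of indicator functions of balls, and on each of these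
  the growth hypothesis allows \<open>(\<phi> \<sigma>)\<^sup>2\<close> to be compared with the radial density \<open>\<Psi>'\<close>
  (\<open>ball_weight_bound\<close>). The right-hand side is therefore at most a constant times \<open>(C + T) / T\<^sup>2\<close>,
  which tends to 0 as \<open>b\<close> grows (\<open>energy_estimate\<close>). Hence \<open>\<phi> \<nabla>\<sigma>\<close> vanishes, and \<open>\<sigma>\<close> is constant
  (\<open>weak_gradient_zero_imp_ae_constant\<close>).

  \<^emph>\<open>(P') implies divergence of the integral.\<close> If the integral converges, let \<open>\<sigma>\<close> depend on a single
  coordinate, with derivative \<open>1 / d\<close>, where \<open>d\<close> is the even function that equals \<open>\<Psi>'\<close> on \<open>[1, \<infinity>)\<close> and
  is constant on \<open>[-1, 1]\<close>. Then \<open>\<sigma>\<close> is bounded and not constant. With \<open>\<phi>\<^sup>2\<close> equal to \<open>d\<close> of that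
  coordinate times an integrable function of the others, \<open>\<phi>\<^sup>2 \<nabla>\<sigma>\<close> is divergence free and the mass of
  \<open>(\<phi> \<sigma>)\<^sup>2\<close> in a ball is controlled by the integral of \<open>d\<close>, that is, by \<open>\<Psi>\<close> (\<open>property_P'_fails\<close>).
\<close>

section \<open>Calculus of smooth functions\<close>

lemma Ck_SucI:
  assumes "\<And>x. (f has_derivative D x) (at x)"
    and "\<And>b. b \<in> Basis \<Longrightarrow> Ck k (\<lambda>x. D x b)"
  shows "Ck (Suc k) f"
proof -
  have "frechet_derivative f (at x) = D x" for x
    by (rule frechet_derivative_at[OF assms(1), symmetric])
  then show ?thesis
    using assms by (auto simp: differentiable_def)
qed

lemma Ck_Suc_imp_Ck: "Ck (Suc k) f \<Longrightarrow> Ck k f"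
proof (induction k arbitrary: f)
  case 0
  then show ?case
    by (auto intro!: continuous_at_imp_continuous_on differentiable_imp_continuous_within)
next
  case (Suc k)
  from Suc.prems have "\<forall>x. f differentiable (at x)"
    and "\<forall>b\<in>Basis. Ck (Suc k) (\<lambda>x. frechet_derivative f (at x) b)"
    unfolding Ck.simps(2)[of "Suc k" f] by blast+
  with Suc.IH show ?case unfolding Ck.simps(2)[of k f] by blast
qed

lemma Ck_le: "Ck k f \<Longrightarrow> j \<le> k \<Longrightarrow> Ck j f"
proof (induction k)
  case (Suc k)
  then show ?case using Ck_Suc_imp_Ck[of k f] by (cases "j = Suc k") auto
qed simp

lemma Ck_imp_continuous: "Ck k f \<Longrightarrow> continuous_on UNIV f"
  using Ck_le[of k f 0] by simp

lemma has_derivative_grad: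
  assumes "f differentiable (at x)"
  shows "(f has_derivative (\<lambda>h. grad f x \<bullet> h)) (at x)"
proof -
  have f: "(f has_derivative frechet_derivative f (at x)) (at x)"
    using assms frechet_derivative_works by blast
  interpret bounded_linear "frechet_derivative f (at x)"
    using f by (rule has_derivative_bounded_linear)
  have "frechet_derivative f (at x) h = grad f x \<bullet> h" for h
  proof -
    have "frechet_derivative f (at x) h = frechet_derivative f (at x) (\<Sum>b\<in>Basis. (h \<bullet> b) *\<^sub>R b)"
      by (simp add: euclidean_representation)
    also have "\<dots> = grad f x \<bullet> h"
      unfolding sum scaleR grad_def inner_sum_left inner_scaleR_left real_scaleR_def
      by (intro sum.cong refl) (metis inner_commute mult.commute)
    finally show ?thesis .
  qed
  then have "frechet_derivative f (at x) = (\<lambda>h. grad f x \<bullet> h)" by (rule ext)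
  with f show ?thesis by simp
qed

lemma grad_eqI:
  assumes "(f has_derivative (\<lambda>h. D \<bullet> h)) (at x)"
  shows "grad f x = D"
  using frechet_derivative_at[OF assms, symmetric]
  by (simp add: grad_def euclidean_representation)

lemma C1_has_derivative: "Ck (Suc k) f \<Longrightarrow> (f has_derivative (\<lambda>h. grad f x \<bullet> h)) (at x)"
  by (simp add: has_derivative_grad)

lemma grad_inner_Basis: "b \<in> Basis \<Longrightarrow> grad f x \<bullet> b = frechet_derivative f (at x) b"
  by (simp add: grad_def inner_sum_left inner_Basis if_distrib[of "\<lambda>u. _ * u"] cong: if_cong)

lemma Ck_partial: "Ck (Suc k) f \<Longrightarrow> b \<in> Basis \<Longrightarrow> Ck k (\<lambda>x. grad f x \<bullet> b)"
  by (simp add: grad_inner_Basis)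

lemma continuous_on_componentwise_inner:
  fixes D :: "'b::topological_space \<Rightarrow> 'a::euclidean_space"
  assumes "\<And>b. b \<in> Basis \<Longrightarrow> continuous_on S (\<lambda>x. D x \<bullet> b)"
  shows "continuous_on S D"
proof -
  have "continuous_on S (\<lambda>x. \<Sum>b\<in>Basis. (D x \<bullet> b) *\<^sub>R b)"
    by (intro continuous_intros assms)
  then show ?thesis by (simp add: euclidean_representation)
qed

lemma continuous_on_grad: "Ck (Suc k) f \<Longrightarrow> continuous_on UNIV (grad f)"
  by (rule continuous_on_componentwise_inner, rule Ck_imp_continuous[OF Ck_partial])

lemma C1I:
  assumes "\<And>x. (f has_derivative (\<lambda>h. D x \<bullet> h)) (at x)" "continuous_on UNIV D"
  shows "Ck 1 f" "grad f = D"
proof -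
  have "Ck (Suc 0) f"
    by (rule Ck_SucI[OF assms(1)]) (auto intro!: continuous_intros assms(2))
  then show "Ck 1 f" by simp
  show "grad f = D" using assms(1) grad_eqI by blast
qed

lemma Ck_const: "Ck k (\<lambda>x. c)"
proof (induction k arbitrary: c)
  case (Suc k)
  show ?case by (rule Ck_SucI[where D="\<lambda>_ _. 0"]) (auto intro: Suc)
qed simp

lemma Ck_add: "Ck k f \<Longrightarrow> Ck k g \<Longrightarrow> Ck k (\<lambda>x. f x + g x)"
proof (induction k arbitrary: f g)
  case 0
  then show ?case by (auto intro: continuous_intros)
next
  case (Suc k)
  show ?case
  proof (rule Ck_SucI)
    show "((\<lambda>x. f x + g x) has_derivative (\<lambda>h. grad f x \<bullet> h + grad g x \<bullet> h)) (at x)" for x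
      using Suc.prems[THEN C1_has_derivative] by (rule has_derivative_add)
  qed (intro Suc.IH Suc.prems[THEN Ck_partial])
qed

lemma Ck_mult: "Ck k f \<Longrightarrow> Ck k g \<Longrightarrow> Ck k (\<lambda>x. f x * g x)"
proof (induction k arbitrary: f g)
  case 0
  then show ?case by (auto intro: continuous_intros)
next
  case (Suc k)
  show ?case
  proof (rule Ck_SucI)
    show "((\<lambda>x. f x * g x) has_derivative (\<lambda>h. f x * (grad g x \<bullet> h) + grad f x \<bullet> h * g x)) (at x)" for x
      using Suc.prems[THEN C1_has_derivative] by (rule has_derivative_mult)
  qed (intro Ck_add Suc.IH Suc.prems[THEN Ck_partial] Suc.prems[THEN Ck_Suc_imp_Ck]; assumption)
qed

lemma Ck_inner: "Ck k (\<lambda>x. x \<bullet> v)"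
proof (cases k)
  case (Suc j)
  show ?thesis unfolding Suc
    by (rule Ck_SucI[where D="\<lambda>_ h. h \<bullet> v"]) (auto intro!: derivative_eq_intros Ck_const)
qed (auto intro!: continuous_intros)

lemma has_derivative_reflect:
  assumes "(f has_derivative D) (at (a - x))"
  shows "((\<lambda>x. f (a - x)) has_derivative (\<lambda>h. - D h)) (at x)"
proof -
  have "((f \<circ> (\<lambda>x. a - x)) has_derivative (D \<circ> (\<lambda>h. - h))) (at x)"
    by (rule diff_chain_at) (use assms in \<open>auto intro!: derivative_eq_intros\<close>)
  moreover have "D (- h) = - D h" for h
    using assms by (simp add: has_derivative_bounded_linear linear_neg bounded_linear.linear)
  ultimately show ?thesis by (simp add: o_def)
qed

lemma Ck_reflect: "Ck k f \<Longrightarrow> Ck k (\<lambda>x. f (a - x))"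
proof (induction k arbitrary: f)
  case 0
  then have "continuous_on UNIV f" by simp
  then have "continuous_on UNIV (\<lambda>x. f (a - x))"
    by (rule continuous_on_compose2[OF _ _ subset_UNIV]) (auto intro!: continuous_intros)
  then show ?case by simp
next
  case (Suc k)
  have "Ck (Suc k) (\<lambda>x. (\<lambda>x. f (a - x)) x)"
  proof (rule Ck_SucI)
    show "((\<lambda>x. f (a - x)) has_derivative (\<lambda>h. - (grad f (a - x) \<bullet> h))) (at x)" for x
      by (rule has_derivative_reflect) (rule C1_has_derivative[OF Suc.prems])
    show "Ck k (\<lambda>x. - (grad f (a - x) \<bullet> b))" if "b \<in> Basis" for b
      using Ck_mult[OF Ck_const[of k "-1"] Suc.IH[OF Ck_partial[OF Suc.prems that]]] by simp
  qed
  then show ?case .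
qed

lemma grad_reflect:
  assumes "Ck (Suc k) f"
  shows "grad (\<lambda>x. f (a - x)) x = - grad f (a - x)"
  by (rule grad_eqI) (use has_derivative_reflect[OF C1_has_derivative[OF assms]] in simp)

lemma grad_mult:
  assumes "Ck (Suc k) f" "Ck (Suc k) g"
  shows "grad (\<lambda>x. f x * g x) x = f x *\<^sub>R grad g x + g x *\<^sub>R grad f x"
  by (rule grad_eqI)
     (use has_derivative_mult[OF assms[THEN C1_has_derivative], of x] in
       \<open>simp add: inner_add_left algebra_simps\<close>)

lemma grad_eq_0_outside:
  assumes "\<And>x. R < norm x \<Longrightarrow> f x = 0" "R < norm x"
  shows "grad f x = 0"
proof (rule grad_eqI)
  have "open {x::'a. R < norm x}" by (intro open_Collect_less continuous_intros)
  then show "(f has_derivative (\<lambda>h. 0 \<bullet> h)) (at x)"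
    using has_derivative_transform_within_open[of "\<lambda>x. 0" "\<lambda>h. 0" x UNIV "{x. R < norm x}" f] assms
    by auto
qed

lemma test_function_iff:
  "test_function \<eta> \<longleftrightarrow> (\<forall>k. Ck k \<eta>) \<and> (\<exists>R. \<forall>x. R < norm x \<longrightarrow> \<eta> x = 0)"
proof -
  have "compact (closure (support_on UNIV \<eta>)) \<longleftrightarrow> (\<exists>R. \<forall>x. \<eta> x \<noteq> 0 \<longrightarrow> norm x \<le> R)"
    unfolding compact_closure bounded_iff support_on_def by simp
  also have "\<dots> \<longleftrightarrow> (\<exists>R. \<forall>x. R < norm x \<longrightarrow> \<eta> x = 0)"
    by (simp add: not_le[symmetric] imp_conv_disj disj_commute)
  finally have "compact (closure (support_on UNIV \<eta>)) \<longleftrightarrow> (\<exists>R. \<forall>x. R < norm x \<longrightarrow> \<eta> x = 0)" .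
  then show ?thesis by (simp add: test_function_def)
qed

lemma bounded_if_compact_support:
  fixes f :: "'a::euclidean_space \<Rightarrow> 'b::real_normed_vector"
  assumes "continuous_on UNIV f" "\<And>x. R < norm x \<Longrightarrow> f x = 0"
  obtains M where "\<And>x. norm (f x) \<le> M" "0 \<le> M"
proof -
  have "compact (f ` cball 0 R)"
    by (intro compact_continuous_image continuous_on_subset[OF assms(1)]) auto
  then have "bounded (f ` cball 0 R)" by (rule compact_imp_bounded)
  then obtain M where M: "\<forall>x\<in>cball 0 R. norm (f x) \<le> M"
    unfolding bounded_iff by auto
  have "norm (f x) \<le> max M 0" for x
    using bspec[OF M, of x] assms(2)[of x] by (cases "R < norm x") auto
  then show ?thesis using that by fastforce
qed

section \<open>Smooth bump functions\<close>

text \<open>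
  Multiplying the standard flat function \<open>exp (- 1 / t)\<close> by powers of \<open>1 / t\<close> gives a family whose
  derivatives are linear combinations of its members, so that smoothness of all members follows from
  one induction.
\<close>

definition flat_exp :: "nat \<Rightarrow> real \<Rightarrow> real" where
  "flat_exp k t = (if 0 < t then inverse t ^ k * exp (- inverse t) else 0)"

lemma flat_exp_tendsto_0: "(flat_exp k \<longlongrightarrow> 0) (at 0)"
proof -
  have lim: "((\<lambda>u::real. u ^ k / exp u) \<longlongrightarrow> 0) at_top"
    by (rule tendsto_power_div_exp_0)
  have r: "(flat_exp k \<longlongrightarrow> 0) (at_right 0)"
  proof (rule Lim_transform_eventually)
    show "((\<lambda>t. inverse t ^ k / exp (inverse t)) \<longlongrightarrow> 0) (at_right (0::real))"
      using filterlim_compose[OF lim filterlim_inverse_at_top_right] .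
    show "\<forall>\<^sub>F t in at_right 0. inverse t ^ k / exp (inverse t) = flat_exp k t"
      by (auto simp: eventually_at_filter flat_exp_def exp_minus field_simps)
  qed
  have l: "(flat_exp k \<longlongrightarrow> 0) (at_left 0)"
    by (rule Lim_transform_eventually[of "\<lambda>_. 0"])
       (auto simp: eventually_at_filter flat_exp_def)
  show ?thesis using l r by (simp add: filterlim_at_split)
qed

lemma flat_exp_deriv:
  "(flat_exp k has_real_derivative (flat_exp (k + 2) t - real k * flat_exp (k + 1) t)) (at t)"
proof -
  consider "t < 0" | "t = 0" | "0 < t" by linarith
  then show ?thesis
  proof cases
    case 1
    have "((\<lambda>_. 0) has_real_derivative 0) (at t)" by simp
    then have "(flat_exp k has_real_derivative 0) (at t)"
      by (rule has_field_derivative_transform_within_open[of _ _ _ "{..<0}"])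
         (use 1 in \<open>auto simp: flat_exp_def\<close>)
    then show ?thesis using 1 by (simp add: flat_exp_def)
  next
    case 2
    have "((\<lambda>h. (flat_exp k (0 + h) - flat_exp k 0) / h) \<longlongrightarrow> 0) (at 0)"
    proof (rule Lim_transform_eventually[OF flat_exp_tendsto_0[of "Suc k"]])
      show "\<forall>\<^sub>F h in at 0. flat_exp (Suc k) h = (flat_exp k (0 + h) - flat_exp k 0) / h"
        by (auto simp: eventually_at_filter flat_exp_def field_simps)
    qed
    then show ?thesis using 2 by (simp add: DERIV_def flat_exp_def)
  next
    case 3
    have "((\<lambda>t. inverse t ^ k * exp (- inverse t)) has_real_derivative
        (flat_exp (k + 2) t - real k * flat_exp (k + 1) t)) (at t)"
    proof (cases k)
      case 0
      show ?thesis unfolding 0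
        by (rule derivative_eq_intros refl | use 3 in \<open>simp add: flat_exp_def power2_eq_square\<close>)+
    next
      case (Suc j)
      show ?thesis unfolding Suc
        by (rule derivative_eq_intros refl
             | use 3 in \<open>simp add: flat_exp_def power2_eq_square field_simps\<close>)+
    qed
    then show ?thesis
      by (rule has_field_derivative_transform_within_open[of _ _ _ "{0<..}"])
         (use 3 in \<open>auto simp: flat_exp_def\<close>)
  qed
qed

text \<open>
  Composing with the squared norm avoids the singularity of the norm at the origin.
\<close>

lemma Ck_flat_exp_radial: "Ck n (\<lambda>x::'a::euclidean_space. flat_exp k (c - x \<bullet> x))"
proof (induction n arbitrary: k)
  case 0
  have "continuous_on UNIV (flat_exp k)"
    using flat_exp_deriv by (meson DERIV_isCont continuous_at_imp_continuous_on)
  then have "continuous_on UNIV (\<lambda>x::'a. flat_exp k (c - x \<bullet> x))"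
    by (rule continuous_on_compose2) (auto intro!: continuous_intros)
  then show ?case by simp
next
  case (Suc n)
  show ?case
  proof (rule Ck_SucI)
    fix x :: 'a
    have "((\<lambda>x::'a. c - x \<bullet> x) has_derivative (\<lambda>h. - 2 * (h \<bullet> x))) (at x)"
      by (auto intro!: derivative_eq_intros simp: inner_commute)
    from has_derivative_compose[OF this flat_exp_deriv[unfolded has_field_derivative_def]]
    show "((\<lambda>x. flat_exp k (c - x \<bullet> x)) has_derivative
       (\<lambda>h. (flat_exp (k + 2) (c - x \<bullet> x) + (- real k) * flat_exp (k + 1) (c - x \<bullet> x)) * (- 2 * (x \<bullet> h)))) (at x)"
      by (simp add: inner_commute)
  qed (intro Ck_mult Ck_add Ck_const Ck_inner Suc)
qed

text \<open>
  Nonempty open sets have positive measure; this turns almost-everywhere statements about continuous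
  functions into pointwise ones.
\<close>

lemma AE_lebesgue_open:
  assumes "AE x in lebesgue. P x" "open {x. \<not> P x}"
  shows "P x"
proof -
  obtain N where "{x. \<not> P x} \<subseteq> N" "N \<in> null_sets lebesgue"
    using assms(1) unfolding eventually_ae_filter by auto
  then have "negligible {x. \<not> P x}"
    by (metis negligible_iff_null_sets negligible_subset)
  then show ?thesis using open_not_negligible[OF assms(2)] by blast
qed

lemma continuous_imp_measurable:
  fixes f :: "'a::euclidean_space \<Rightarrow> 'b::euclidean_space"
  assumes "continuous_on UNIV f"
  shows "f \<in> borel_measurable lborel" "f \<in> borel_measurable lebesgue"
proof -
  show "f \<in> borel_measurable lborel"
    using borel_measurable_continuous_onI[OF assms] by simp
  then show "f \<in> borel_measurable lebesgue" by (rule measurable_completion)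
qed

lemma integrable_continuous_compact_support:
  fixes f :: "'a::euclidean_space \<Rightarrow> 'b::euclidean_space"
  assumes "continuous_on UNIV f" "\<And>x. R < norm x \<Longrightarrow> f x = 0"
  shows "integrable lebesgue f"
proof -
  have "integrable lborel (\<lambda>x. indicator (cball 0 R) x *\<^sub>R f x)"
    by (rule borel_integrable_compact) (auto intro: continuous_on_subset[OF assms(1)])
  moreover have "(\<lambda>x. indicator (cball 0 R) x *\<^sub>R f x) = f"
    using assms(2) by (auto simp: indicator_def fun_eq_iff not_le)
  ultimately show ?thesis
    using continuous_imp_measurable[OF assms(1)] by (simp add: integrable_completion)
qed

lemma integrable_indicator_cball:
  "integrable lebesgue (\<lambda>x::'a::euclidean_space. (C::real) * indicator (cball 0 R) x)"
proof -
  have "integrable lborel (\<lambda>x::'a. indicator (cball 0 R) x *\<^sub>R C)"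
    by (rule borel_integrable_compact) auto
  then show ?thesis
    by (subst integrable_completion) (auto simp: mult.commute)
qed

text \<open>
  No scaling relation between mollifiers of different radii is imposed: only the radius of the support
  enters the convergence of mollifications.
\<close>

definition mollifier :: "real \<Rightarrow> ('a::euclidean_space \<Rightarrow> real) \<Rightarrow> bool" where
  "mollifier r \<rho> \<longleftrightarrow> (\<forall>k. Ck k \<rho>) \<and> (\<forall>x. 0 \<le> \<rho> x) \<and> (\<forall>x. r < norm x \<longrightarrow> \<rho> x = 0) \<and>
     (LINT x|lebesgue. \<rho> x) = 1"

lemma mollifier_exists:
  assumes "0 < r"
  obtains \<rho> :: "'a::euclidean_space \<Rightarrow> real" where "mollifier r \<rho>"
proof -
  define \<beta> where "\<beta> = (\<lambda>x::'a. flat_exp 0 (r\<^sup>2 - x \<bullet> x))"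
  have Ck: "Ck k \<beta>" for k unfolding \<beta>_def by (rule Ck_flat_exp_radial)
  have ge: "0 \<le> \<beta> x" for x by (simp add: \<beta>_def flat_exp_def)
  have supp: "\<beta> x = 0" if "r < norm x" for x
  proof -
    have "r\<^sup>2 \<le> (norm x)\<^sup>2" using that assms by (intro power_mono) auto
    then show ?thesis by (simp add: \<beta>_def flat_exp_def power2_norm_eq_inner)
  qed
  have "\<beta> 0 \<noteq> 0" using assms by (simp add: \<beta>_def flat_exp_def)
  have cont: "continuous_on UNIV \<beta>" using Ck Ck_imp_continuous by blast
  have int: "integrable lebesgue \<beta>"
    using integrable_continuous_compact_support[OF cont supp] .
  have "(LINT x|lebesgue. \<beta> x) \<noteq> 0"
  proof
    assume "(LINT x|lebesgue. \<beta> x) = 0"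
    then have "AE x in lebesgue. \<beta> x = 0"
      using integral_nonneg_eq_0_iff_AE[OF int] ge by simp
    moreover have "open {x. \<beta> x \<noteq> 0}"
      by (rule open_Collect_neq[OF cont continuous_on_const])
    ultimately have "\<beta> 0 = 0" by (rule AE_lebesgue_open)
    then show False using \<open>\<beta> 0 \<noteq> 0\<close> by contradiction
  qed
  moreover have "0 \<le> (LINT x|lebesgue. \<beta> x)" using ge by simp
  ultimately have pos: "0 < (LINT x|lebesgue. \<beta> x)" by linarith
  have "mollifier r (\<lambda>x. inverse (LINT x|lebesgue. \<beta> x) * \<beta> x)"
    unfolding mollifier_def using pos ge supp by (auto intro!: Ck_mult Ck_const Ck)
  then show ?thesis by (rule that)
qed


section \<open>Convolution\<close>

definition conv :: "('a::euclidean_space \<Rightarrow> real) \<Rightarrow> ('a \<Rightarrow> real) \<Rightarrow> 'a \<Rightarrow> real" where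
  "conv k f x = (LINT y|lebesgue. k (x - y) * f y)"

lemma integrable_bounded_scaleR:
  fixes f :: "'a::euclidean_space \<Rightarrow> 'b::euclidean_space" and k :: "'a \<Rightarrow> real"
  assumes "k \<in> borel_measurable lebesgue" "\<And>x. \<bar>k x\<bar> \<le> M" "integrable lebesgue f"
  shows "integrable lebesgue (\<lambda>x. k x *\<^sub>R f x)"
proof (rule Bochner_Integration.integrable_bound)
  show "integrable lebesgue (\<lambda>x. M *\<^sub>R f x)" using assms(3) by simp
  show "(\<lambda>x. k x *\<^sub>R f x) \<in> borel_measurable lebesgue"
    using assms(1) borel_measurable_integrable[OF assms(3)] by simp
  have "0 \<le> M" using assms(2)[of 0] by linarith
  then show "AE x in lebesgue. norm (k x *\<^sub>R f x) \<le> norm (M *\<^sub>R f x)"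
    using assms(2) by (auto intro!: mult_right_mono)
qed

lemma continuous_reflect:
  fixes k :: "'a::euclidean_space \<Rightarrow> 'b::topological_space"
  assumes "continuous_on UNIV k"
  shows "continuous_on UNIV (\<lambda>y. k (x - y))"
  by (rule continuous_on_compose2[OF assms]) (auto intro!: continuous_intros)

lemma norm_diff_large: "norm x + r < norm y \<Longrightarrow> r < norm (x - y)"
  using norm_triangle_ineq2[of y x] norm_minus_commute[of x y] by linarith

lemma conv_integrable:
  fixes f k :: "'a::euclidean_space \<Rightarrow> real"
  assumes "continuous_on UNIV k" "\<And>z. \<bar>k z\<bar> \<le> M" "integrable lebesgue f"
  shows "integrable lebesgue (\<lambda>y. k (x - y) * f y)"
  using integrable_bounded_scaleR[OF continuous_imp_measurable(2)[OF continuous_reflect[OF assms(1)]] assms(2,3)]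
  by simp

lemma continuous_conv:
  fixes f k :: "'a::euclidean_space \<Rightarrow> real"
  assumes k: "continuous_on UNIV k" "\<And>z. \<bar>k z\<bar> \<le> M" and f: "integrable lebesgue f"
  shows "continuous_on UNIV (conv k f)"
proof -
  have "(\<lambda>n. conv k f (X n)) \<longlonglongrightarrow> conv k f x" if X: "X \<longlonglongrightarrow> x" for X x
    unfolding conv_def
  proof (rule integral_dominated_convergence[where w="\<lambda>y. M * \<bar>f y\<bar>"])
    show "(\<lambda>y. k (x - y) * f y) \<in> borel_measurable lebesgue"
      "(\<lambda>y. k (X n - y) * f y) \<in> borel_measurable lebesgue" for n
      using conv_integrable[OF k f] by auto
    show "integrable lebesgue (\<lambda>y. M * \<bar>f y\<bar>)" using f by simp
    show "AE y in lebesgue. (\<lambda>n. k (X n - y) * f y) \<longlonglongrightarrow> k (x - y) * f y"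
    proof (rule AE_I2)
      fix y
      have "isCont k (x - y)" using k(1) by (simp add: continuous_on_eq_continuous_at)
      moreover have "(\<lambda>n. X n - y) \<longlonglongrightarrow> x - y" using X by (intro tendsto_intros)
      ultimately have "(\<lambda>n. k (X n - y)) \<longlonglongrightarrow> k (x - y)" by (rule isCont_tendsto_compose)
      then show "(\<lambda>n. k (X n - y) * f y) \<longlonglongrightarrow> k (x - y) * f y" by (intro tendsto_intros)
    qed
    show "AE y in lebesgue. norm (k (X n - y) * f y) \<le> M * \<bar>f y\<bar>" for n
      using k(2) by (auto simp: abs_mult intro!: mult_right_mono)
  qed
  then show ?thesis
    by (simp add: continuous_on_sequentially o_def)
qed

text \<open>
  The difference quotients of the kernel converge pointwise and are bounded by twice its Lipschitz
  constant, so dominated convergence applies to any integrable \<open>f\<close>.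
\<close>

lemma has_derivative_conv:
  fixes f k :: "'a::euclidean_space \<Rightarrow> real"
  assumes k: "\<And>z. (k has_derivative (\<lambda>h. D z \<bullet> h)) (at z)" "\<And>z. \<bar>k z\<bar> \<le> M"
    and D: "continuous_on UNIV D" "\<And>z. norm (D z) \<le> L"
    and f: "integrable lebesgue f"
  shows "(conv k f has_derivative (\<lambda>h. LINT y|lebesgue. (D (x - y) \<bullet> h) * f y)) (at x)"
proof -
  have kc: "continuous_on UNIV k"
    using has_derivative_continuous[OF k(1)] by (simp add: continuous_on_eq_continuous_at)
  have Dc: "continuous_on UNIV (\<lambda>z. D z \<bullet> h)" for h
    using D(1) by (intro continuous_intros)
  have Db: "\<bar>D z \<bullet> h\<bar> \<le> L * norm h" for z h
    using Cauchy_Schwarz_ineq2[of "D z" h] mult_right_mono[OF D(2)[of z], of "norm h"] by simp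
  have Di: "integrable lebesgue (\<lambda>y. (D (x - y) \<bullet> h) * f y)" for h
    by (rule conv_integrable[OF Dc Db f])
  have ki: "integrable lebesgue (\<lambda>y. k (z - y) * f y)" for z
    by (rule conv_integrable[OF kc k(2) f])
  have Lip: "\<bar>k (z + h) - k z\<bar> \<le> L * norm h" for z h
  proof -
    have "norm (k (z + h) - k z) \<le> L * norm ((z + h) - z)"
    proof (rule differentiable_bound[of UNIV])
      show "(k has_derivative (\<lambda>h. D x \<bullet> h)) (at x within UNIV)" for x using k(1) by simp
      show "onorm (\<lambda>h. D x \<bullet> h) \<le> L" for x
        by (rule onorm_le) (use Db in simp)
    qed auto
    then show ?thesis by simp
  qed
  have lin: "bounded_linear (\<lambda>h. LINT y|lebesgue. (D (x - y) \<bullet> h) * f y)"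
    unfolding linear_conv_bounded_linear[symmetric]
  proof (rule linearI)
    show "(LINT y|lebesgue. (D (x - y) \<bullet> (h + h')) * f y) =
        (LINT y|lebesgue. (D (x - y) \<bullet> h) * f y) + (LINT y|lebesgue. (D (x - y) \<bullet> h') * f y)" for h h'
      by (simp add: inner_add_right distrib_right Di flip: Bochner_Integration.integral_add)
    show "(LINT y|lebesgue. (D (x - y) \<bullet> (c *\<^sub>R h)) * f y) =
        c *\<^sub>R (LINT y|lebesgue. (D (x - y) \<bullet> h) * f y)" for c h
      by (simp add: mult.assoc)
  qed
  have "((\<lambda>h. norm (conv k f (x + h) - conv k f x -
      (LINT y|lebesgue. (D (x - y) \<bullet> h) * f y)) / norm h) \<longlongrightarrow> 0) (at 0)"
    unfolding tendsto_at_iff_sequentially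
  proof (intro allI impI)
    fix X :: "nat \<Rightarrow> 'a"
    assume X: "\<forall>i. X i \<in> UNIV - {0}" "X \<longlonglongrightarrow> 0"
    define q where "q n y = (k (x + X n - y) - k (x - y) - D (x - y) \<bullet> X n) / norm (X n)" for n y
    have "(\<lambda>n. LINT y|lebesgue. q n y * f y) \<longlonglongrightarrow> (LINT (y::'a)|lebesgue. 0)"
    proof (rule integral_dominated_convergence[where w="\<lambda>y. 2 * L * \<bar>f y\<bar>"])
      show "(\<lambda>y. q n y * f y) \<in> borel_measurable lebesgue" for n
      proof -
        have "(\<lambda>y. q n y) \<in> borel_measurable lebesgue" unfolding q_def
          by (intro borel_measurable_divide borel_measurable_diff borel_measurable_const
              continuous_imp_measurable(2) continuous_reflect[OF kc] continuous_reflect[OF Dc])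
        then show ?thesis using f by simp
      qed
      show "integrable lebesgue (\<lambda>y. 2 * L * \<bar>f y\<bar>)" using f by simp
      show "AE y in lebesgue. (\<lambda>n. q n y * f y) \<longlonglongrightarrow> 0"
      proof (rule AE_I2)
        fix y
        have "((\<lambda>h. norm (k ((x - y) + h) - k (x - y) - D (x - y) \<bullet> h) / norm h) \<longlongrightarrow> 0) (at 0)"
          using k(1)[of "x - y"] by (simp add: has_derivative_at)
        moreover have "filterlim X (at 0) sequentially"
          using X by (simp add: filterlim_at)
        ultimately have "(\<lambda>n. norm (k ((x - y) + X n) - k (x - y) - D (x - y) \<bullet> X n) / norm (X n)) \<longlonglongrightarrow> 0"
          by (rule filterlim_compose)
        then have "(\<lambda>n. \<bar>q n y\<bar>) \<longlonglongrightarrow> 0"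
          by (simp add: q_def algebra_simps)
        then have "(\<lambda>n. q n y) \<longlonglongrightarrow> 0" by (simp add: tendsto_rabs_zero_iff)
        then show "(\<lambda>n. q n y * f y) \<longlonglongrightarrow> 0" by (rule tendsto_mult_left_zero)
      qed
      show "AE y in lebesgue. norm (q n y * f y) \<le> 2 * L * \<bar>f y\<bar>" for n
      proof (rule AE_I2)
        fix y
        have eq: "x + X n - y = (x - y) + X n" by simp
        have "\<bar>k (x + X n - y) - k (x - y) - D (x - y) \<bullet> X n\<bar> \<le> L * norm (X n) + L * norm (X n)"
          using Lip[of "x - y" "X n"] Db[of "x - y" "X n"] unfolding eq by linarith
        then have "\<bar>k (x + X n - y) - k (x - y) - D (x - y) \<bullet> X n\<bar> \<le> (2 * L) * norm (X n)"
          by simp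
        then have "\<bar>q n y\<bar> \<le> 2 * L"
          using X(1) by (simp add: q_def pos_divide_le_eq)
        then show "norm (q n y * f y) \<le> 2 * L * \<bar>f y\<bar>"
          by (simp add: abs_mult mult_right_mono)
      qed
    qed simp
    moreover have "(LINT y|lebesgue. q n y * f y) =
        (conv k f (x + X n) - conv k f x - (LINT y|lebesgue. (D (x - y) \<bullet> X n) * f y)) / norm (X n)" for n
      unfolding q_def conv_def
      by (simp add: diff_divide_distrib left_diff_distrib ki Di)
    ultimately have "(\<lambda>n. \<bar>(conv k f (x + X n) - conv k f x -
        (LINT y|lebesgue. (D (x - y) \<bullet> X n) * f y)) / norm (X n)\<bar>) \<longlonglongrightarrow> 0"
      using tendsto_rabs_zero by fastforce
    then show "((\<lambda>h. norm (conv k f (x + h) - conv k f x -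
        (LINT y|lebesgue. (D (x - y) \<bullet> h) * f y)) / norm h) \<circ> X) \<longlonglongrightarrow> 0"
      by (simp add: o_def)
  qed
  with lin show ?thesis by (simp add: has_derivative_at)
qed

lemma C1_has_derivative_conv:
  fixes f k :: "'a::euclidean_space \<Rightarrow> real"
  assumes k: "Ck (Suc n) k" "\<And>x. R < norm x \<Longrightarrow> k x = 0" and f: "integrable lebesgue f"
  shows "(conv k f has_derivative (\<lambda>h. conv (\<lambda>z. grad k z \<bullet> h) f x)) (at x)"
proof -
  obtain M where M: "\<And>x. norm (k x) \<le> M"
    using bounded_if_compact_support[OF Ck_imp_continuous[OF k(1)] k(2)] by blast
  obtain L where L: "\<And>x. norm (grad k x) \<le> L"
    using bounded_if_compact_support[OF continuous_on_grad[OF k(1)], of R] grad_eq_0_outside[of R k] k(2) by blast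
  show ?thesis
    unfolding conv_def[of "\<lambda>z. grad k z \<bullet> h" f x for h]
    by (rule has_derivative_conv[OF C1_has_derivative[OF k(1)] _ continuous_on_grad[OF k(1)] L f, of M])
       (use M in simp)
qed

lemma grad_conv:
  fixes f k :: "'a::euclidean_space \<Rightarrow> real"
  assumes k: "Ck (Suc n) k" "\<And>x. R < norm x \<Longrightarrow> k x = 0" and f: "integrable lebesgue f"
  shows "grad (conv k f) x \<bullet> h = conv (\<lambda>z. grad k z \<bullet> h) f x"
proof -
  note d = C1_has_derivative_conv[OF assms]
  then have "conv k f differentiable (at x)" unfolding differentiable_def by blast
  from has_derivative_unique[OF d has_derivative_grad[OF this]]
  show ?thesis by (simp add: fun_eq_iff)
qed

lemma Ck_conv:
  fixes f k :: "'a::euclidean_space \<Rightarrow> real"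
  assumes "Ck n k" "\<And>x. R < norm x \<Longrightarrow> k x = 0" "integrable lebesgue f"
  shows "Ck n (conv k f)"
  using assms(1,2)
proof (induction n arbitrary: k)
  case 0
  then have c: "continuous_on UNIV k" by simp
  obtain M where M: "\<And>x. norm (k x) \<le> M"
    using bounded_if_compact_support[OF c 0(2)] by blast
  show ?case using continuous_conv[OF c _ assms(3), of M] M by simp
next
  case (Suc n)
  show ?case
  proof (rule Ck_SucI)
    show "(conv k f has_derivative (\<lambda>h. conv (\<lambda>z. grad k z \<bullet> h) f x)) (at x)" for x
      by (rule C1_has_derivative_conv[OF Suc.prems assms(3)])
    show "Ck n (conv (\<lambda>z. grad k z \<bullet> b) f)" if "b \<in> Basis" for b
      by (rule Suc.IH[OF Ck_partial[OF Suc.prems(1) that]]) (simp add: grad_eq_0_outside[OF Suc.prems(2)])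
  qed
qed

lemma conv_eq_0_outside:
  assumes "\<And>x. R < norm x \<Longrightarrow> k x = 0" "\<And>x. S < norm x \<Longrightarrow> f x = 0" "R + S < norm x"
  shows "conv k f x = 0"
proof -
  have "k (x - y) * f y = 0" for y
  proof (cases "S < norm y")
    case False
    then have "R < norm (x - y)" using assms(3) norm_triangle_ineq2[of x y] by linarith
    then show ?thesis using assms(1) by simp
  qed (simp add: assms(2))
  then have "(\<lambda>y. k (x - y) * f y) = (\<lambda>y. 0)" by (rule ext)
  then show ?thesis by (simp only: conv_def) simp
qed

lemma lborel_reflect: "distr lborel borel (\<lambda>y. x - y) = (lborel :: 'a::euclidean_space measure)"
  using lborel_affine[of "-1" x] by (simp add: density_1)

text \<open>
  With this symmetry a derivative can be moved onto either factor: onto the mollifier, to see that a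
  mollification is smooth, or onto the other function, to see that gradients converge as well.
\<close>

lemma conv_commute:
  fixes f k :: "'a::euclidean_space \<Rightarrow> real"
  assumes "continuous_on UNIV k" "continuous_on UNIV f"
  shows "conv k f = conv f k"
proof
  fix x
  have kf: "continuous_on UNIV (\<lambda>y. k (x - y) * f y)" "continuous_on UNIV (\<lambda>y. f (x - y) * k y)"
    by (rule continuous_on_mult[OF continuous_reflect[OF assms(1)] assms(2)],
        rule continuous_on_mult[OF continuous_reflect[OF assms(2)] assms(1)])
  have "conv k f x = (LINT y|lborel. k (x - y) * f y)"
    unfolding conv_def using continuous_imp_measurable(1)[OF kf(1)] by (rule integral_completion)
  also have "\<dots> = (LINT y|distr lborel borel (\<lambda>y. x - y). k (x - y) * f y)"
    by (simp add: lborel_reflect)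
  also have "\<dots> = (LINT y|lborel. k (x - (x - y)) * f (x - y))"
    by (rule integral_distr) (use continuous_imp_measurable(1)[OF kf(1)] in simp_all)
  also have "\<dots> = (LINT y|lborel. f (x - y) * k y)" by (simp add: mult.commute)
  also have "\<dots> = conv f k x"
    unfolding conv_def using continuous_imp_measurable(1)[OF kf(2)] by (rule integral_completion[symmetric])
  finally show "conv k f x = conv f k x" .
qed

lemma mollifierD:
  assumes "mollifier r \<rho>"
  shows "Ck k \<rho>" "0 \<le> \<rho> x" "r < norm x \<Longrightarrow> \<rho> x = 0" "(LINT x|lebesgue. \<rho> x) = 1"
    "continuous_on UNIV \<rho>" "integrable lebesgue \<rho>"
proof -
  show *: "Ck k \<rho>" "0 \<le> \<rho> x" "r < norm x \<Longrightarrow> \<rho> x = 0" "(LINT x|lebesgue. \<rho> x) = 1" for k x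
    using assms by (auto simp: mollifier_def)
  show c: "continuous_on UNIV \<rho>" using Ck_imp_continuous[OF *(1)] .
  show "integrable lebesgue \<rho>" using integrable_continuous_compact_support[OF c *(3)] .
qed

lemma mollifier_sequence:
  obtains \<rho> :: "nat \<Rightarrow> 'a::euclidean_space \<Rightarrow> real" where "\<And>n. mollifier (inverse (real (Suc n))) (\<rho> n)"
proof -
  have "\<forall>n. \<exists>\<rho>::'a \<Rightarrow> real. mollifier (inverse (real (Suc n))) \<rho>"
    using mollifier_exists by (metis inverse_positive_iff_positive of_nat_0_less_iff zero_less_Suc)
  then show ?thesis using that by metis
qed

lemma conv_mollifier_integrable:
  fixes f :: "'a::euclidean_space \<Rightarrow> real"
  assumes \<rho>: "mollifier r \<rho>" and f: "integrable lebesgue f"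
  shows "integrable lebesgue (\<lambda>y. \<rho> (x - y) * f y)"
proof -
  obtain M where "\<And>x. norm (\<rho> x) \<le> M"
    using bounded_if_compact_support[OF mollifierD(5,3)[OF \<rho>]] by blast
  then show ?thesis using conv_integrable[OF mollifierD(5)[OF \<rho>] _ f, of M x] by simp
qed

lemma Ck_conv_mollifier:
  fixes f :: "'a::euclidean_space \<Rightarrow> real"
  assumes "mollifier r \<rho>" "integrable lebesgue f"
  shows "Ck k (conv \<rho> f)"
  by (rule Ck_conv[OF mollifierD(1)[OF assms(1)] mollifierD(3)[OF assms(1)] assms(2)])

lemma grad_conv_mollifier:
  fixes f :: "'a::euclidean_space \<Rightarrow> real"
  assumes \<rho>: "mollifier r \<rho>" and f: "integrable lebesgue f"
  shows "grad (conv \<rho> f) x \<bullet> h = conv (\<lambda>z. grad \<rho> z \<bullet> h) f x"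
  by (rule grad_conv[OF mollifierD(1)[OF \<rho>] mollifierD(3)[OF \<rho>] f])

text \<open>
  A mollification at \<open>x\<close> is a weighted mean of the values near \<open>x\<close>.
\<close>

lemma conv_mollifier_close:
  fixes g :: "'a::euclidean_space \<Rightarrow> real"
  assumes \<rho>: "mollifier r \<rho>" and g: "continuous_on UNIV g" "\<And>x. R < norm x \<Longrightarrow> g x = 0"
    and e: "\<And>z. norm z \<le> r \<Longrightarrow> \<bar>g (x - z) - c\<bar> \<le> e"
  shows "\<bar>conv \<rho> g x - c\<bar> \<le> e"
proof -
  obtain M where M: "\<And>x. norm (g x) \<le> M"
    using bounded_if_compact_support[OF g] by blast
  have i: "integrable lebesgue (\<lambda>y. g (x - y) * \<rho> y)"
    using conv_integrable[OF g(1) _ mollifierD(6)[OF \<rho>], of M] M by simp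
  have "conv \<rho> g x - c = conv g \<rho> x - c * (LINT y|lebesgue. \<rho> y)"
    using conv_commute[OF mollifierD(5)[OF \<rho>] g(1)] mollifierD(4)[OF \<rho>] by simp
  also have "\<dots> = (LINT y|lebesgue. (g (x - y) - c) * \<rho> y)"
    using i mollifierD(6)[OF \<rho>] by (simp add: conv_def left_diff_distrib)
  finally have "\<bar>conv \<rho> g x - c\<bar> = \<bar>LINT y|lebesgue. (g (x - y) - c) * \<rho> y\<bar>" by simp
  also have "\<dots> \<le> (LINT y|lebesgue. e * \<rho> y)"
  proof -
    have "norm (LINT y|lebesgue. (g (x - y) - c) * \<rho> y) \<le> (LINT y|lebesgue. norm ((g (x - y) - c) * \<rho> y))"
      by (rule integral_norm_bound)
    also have "\<dots> \<le> (LINT y|lebesgue. e * \<rho> y)"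
    proof (rule integral_mono)
      show "integrable lebesgue (\<lambda>y. norm ((g (x - y) - c) * \<rho> y))"
        using i mollifierD(6)[OF \<rho>] by (simp add: left_diff_distrib)
      show "integrable lebesgue (\<lambda>y. e * \<rho> y)" using mollifierD(6)[OF \<rho>] by simp
      show "norm ((g (x - y) - c) * \<rho> y) \<le> e * \<rho> y" for y
        using e[of y] mollifierD(2,3)[OF \<rho>, of y]
        by (cases "norm y \<le> r") (auto simp: abs_mult intro!: mult_right_mono)
    qed
    finally show ?thesis by simp
  qed
  also have "\<dots> = e" using mollifierD(4)[OF \<rho>] by simp
  finally show ?thesis .
qed

lemma conv_mollifier_bound:
  fixes g :: "'a::euclidean_space \<Rightarrow> real"
  assumes \<rho>: "mollifier r \<rho>" and g: "continuous_on UNIV g" "\<And>x. R < norm x \<Longrightarrow> g x = 0"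
    and M: "\<And>x. \<bar>g x\<bar> \<le> M"
  shows "\<bar>conv \<rho> g x\<bar> \<le> M"
  using conv_mollifier_close[OF \<rho> g, where x=x and c=0 and e=M] M by simp

lemma conv_mollifier_tendsto:
  fixes g :: "'a::euclidean_space \<Rightarrow> real"
  assumes \<rho>: "\<And>n. mollifier (inverse (real (Suc n))) (\<rho> n)"
    and g: "continuous_on UNIV g" "\<And>x. R < norm x \<Longrightarrow> g x = 0"
  shows "(\<lambda>n. conv (\<rho> n) g x) \<longlonglongrightarrow> g x"
proof (rule LIMSEQ_I)
  fix e :: real assume "0 < e"
  have "isCont g x" using g(1) by (simp add: continuous_on_eq_continuous_at)
  then obtain d where d: "0 < d" "\<And>y. dist y x < d \<Longrightarrow> dist (g y) (g x) < e / 2"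
    using \<open>0 < e\<close> unfolding continuous_at_eps_delta by (metis half_gt_zero)
  have "\<forall>\<^sub>F n in sequentially. inverse (real (Suc n)) < d"
    using order_tendstoD(2)[OF LIMSEQ_inverse_real_of_nat d(1)] .
  then obtain N where N: "\<And>n. N \<le> n \<Longrightarrow> inverse (real (Suc n)) < d"
    unfolding eventually_sequentially by blast
  have "norm (conv (\<rho> n) g x - g x) < e" if "N \<le> n" for n
  proof -
    have "\<bar>conv (\<rho> n) g x - g x\<bar> \<le> e / 2"
    proof (rule conv_mollifier_close[OF \<rho> g])
      fix z :: 'a assume "norm z \<le> inverse (real (Suc n))"
      then have "dist (x - z) x < d" using N[OF that] by (simp add: dist_norm)
      then show "\<bar>g (x - z) - g x\<bar> \<le> e / 2" using d(2) by (fastforce simp: dist_real_def)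
    qed
    then show ?thesis using \<open>0 < e\<close> by simp
  qed
  then show "\<exists>N. \<forall>n\<ge>N. norm (conv (\<rho> n) g x - g x) < e" by blast
qed

lemma grad_conv_right:
  fixes g :: "'a::euclidean_space \<Rightarrow> real"
  assumes \<rho>: "mollifier r \<rho>" and g: "Ck (Suc 0) g" "\<And>x. R < norm x \<Longrightarrow> g x = 0"
  shows "grad (conv \<rho> g) x \<bullet> h = conv \<rho> (\<lambda>z. grad g z \<bullet> h) x"
proof -
  have "continuous_on UNIV (\<lambda>z. grad g z \<bullet> h)"
    using continuous_on_grad[OF g(1)] by (intro continuous_intros)
  then show ?thesis
    using grad_conv[OF g mollifierD(6)[OF \<rho>]]
      conv_commute[OF mollifierD(5)[OF \<rho>] Ck_imp_continuous[OF g(1)]]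
      conv_commute[OF mollifierD(5)[OF \<rho>]]
    by metis
qed


section \<open>Convergence of mollifications in mean square\<close>

lemma integrable_of_square:
  fixes f :: "'a::euclidean_space \<Rightarrow> real"
  assumes "f \<in> borel_measurable lebesgue" "integrable lebesgue (\<lambda>x. (f x)\<^sup>2)"
    "\<And>x. R < norm x \<Longrightarrow> f x = 0"
  shows "integrable lebesgue f"
proof (rule Bochner_Integration.integrable_bound)
  have "integrable lebesgue (\<lambda>x::'a. indicator (cball 0 R) x :: real)"
    using integrable_indicator_cball[of 1] by simp
  then show "integrable lebesgue (\<lambda>x. indicator (cball 0 R) x + (f x)\<^sup>2)"
    using assms(2) by (rule Bochner_Integration.integrable_add)
  show "AE x in lebesgue. norm (f x) \<le> norm (indicator (cball 0 R) x + (f x)\<^sup>2)"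
  proof (rule AE_I2)
    fix x
    have "0 \<le> (\<bar>f x\<bar> - 1)\<^sup>2" by simp
    then have "2 * \<bar>f x\<bar> \<le> 1 + (f x)\<^sup>2" by (simp add: power2_eq_square algebra_simps)
    then show "norm (f x) \<le> norm (indicator (cball 0 R) x + (f x)\<^sup>2)"
      using assms(3)[of x] by (cases "R < norm x") auto
  qed
qed (use assms in simp)

text \<open>
  Jensen's inequality for the probability density \<open>y \<mapsto> \<rho> (x - y)\<close>, as nonnegativity of a variance.
\<close>

lemma conv_mollifier_Jensen:
  fixes h :: "'a::euclidean_space \<Rightarrow> real"
  assumes \<rho>: "mollifier r \<rho>" and h: "integrable lebesgue h" "integrable lebesgue (\<lambda>x. (h x)\<^sup>2)"
  shows "(conv \<rho> h x)\<^sup>2 \<le> conv \<rho> (\<lambda>y. (h y)\<^sup>2) x"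
proof -
  define m where "m = conv \<rho> h x"
  have i: "integrable lebesgue (\<lambda>y. \<rho> (x - y) * h y)" "integrable lebesgue (\<lambda>y. \<rho> (x - y) * (h y)\<^sup>2)"
    by (rule conv_mollifier_integrable[OF \<rho> h(1)], rule conv_mollifier_integrable[OF \<rho> h(2)])
  have refl: "(\<lambda>y. \<rho> (x - y)) \<in> borel_measurable lborel"
    by (rule continuous_imp_measurable(1)[OF continuous_reflect[OF mollifierD(5)[OF \<rho>]]])
  have i1: "integrable lebesgue (\<lambda>y. \<rho> (x - y))"
  proof (rule integrable_continuous_compact_support[OF continuous_reflect[OF mollifierD(5)[OF \<rho>]]])
    fix y :: 'a assume "norm x + r < norm y"
    then show "\<rho> (x - y) = 0" by (intro mollifierD(3)[OF \<rho>] norm_diff_large)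
  qed
  have "(LINT y|lebesgue. \<rho> (x - y)) = (LINT y|lborel. \<rho> (x - y))"
    using refl by (rule integral_completion)
  also have "\<dots> = (LINT y|distr lborel borel (\<lambda>y. x - y). \<rho> y)"
    by (rule integral_distr[symmetric]) (use continuous_imp_measurable(1)[OF mollifierD(5)[OF \<rho>]] in simp_all)
  also have "\<dots> = (LINT y|lebesgue. \<rho> y)"
    unfolding lborel_reflect
    by (rule integral_completion[symmetric]) (use continuous_imp_measurable(1)[OF mollifierD(5)[OF \<rho>]] in simp_all)
  finally have 1: "(LINT y|lebesgue. \<rho> (x - y)) = 1" using mollifierD(4)[OF \<rho>] by simp
  have "0 \<le> (LINT y|lebesgue. \<rho> (x - y) * (h y - m)\<^sup>2)"
    using mollifierD(2)[OF \<rho>] by simp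
  also have "\<dots> = (LINT y|lebesgue. \<rho> (x - y) * (h y)\<^sup>2 - 2 * m * (\<rho> (x - y) * h y) + m\<^sup>2 * \<rho> (x - y))"
    by (rule Bochner_Integration.integral_cong) (auto simp: power2_eq_square algebra_simps)
  also have "\<dots> = conv \<rho> (\<lambda>y. (h y)\<^sup>2) x - 2 * m * m + m\<^sup>2"
    using i i1 1 by (simp add: conv_def m_def)
  finally show ?thesis by (simp add: m_def power2_eq_square)
qed

text \<open>
  The pointwise Jensen inequality is integrated with Tonelli's theorem. The integrand has to be
  measurable on the product space, which is why \<open>h\<close> is a Borel function here; a Lebesgue measurable
  function is then replaced by a Borel version of it.
\<close>

lemma conv_contraction_Borel:
  fixes h :: "'a::euclidean_space \<Rightarrow> real"
  assumes \<rho>: "mollifier r \<rho>" and h: "integrable lebesgue h" "integrable lebesgue (\<lambda>x. (h x)\<^sup>2)"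
    and [measurable]: "h \<in> borel_measurable borel"
  shows "(\<integral>\<^sup>+x. ennreal ((conv \<rho> h x)\<^sup>2) \<partial>lborel) \<le> (\<integral>\<^sup>+y. ennreal ((h y)\<^sup>2) \<partial>lborel)"
proof -
  have [measurable]: "\<rho> \<in> borel_measurable borel"
    using continuous_imp_measurable(1)[OF mollifierD(5)[OF \<rho>]] by simp
  note \<rho>0 = mollifierD(2)[OF \<rho>]
  have 1: "(\<integral>\<^sup>+x. ennreal (\<rho> (x - y)) \<partial>lborel) = 1" for y
  proof -
    have "(\<integral>\<^sup>+x. ennreal (\<rho> (x - y)) \<partial>lborel) = (\<integral>\<^sup>+x. ennreal (\<rho> x) \<partial>distr lborel borel ((+) (- y)))"
      by (subst nn_integral_distr) auto
    also have "\<dots> = (\<integral>\<^sup>+x. ennreal (\<rho> x) \<partial>lebesgue)"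
      by (simp add: lborel_distr_plus nn_integral_completion)
    also have "\<dots> = 1"
      using nn_integral_eq_integral[OF mollifierD(6)[OF \<rho>]] \<rho>0 mollifierD(4)[OF \<rho>] by simp
    finally show ?thesis .
  qed
  have "(\<integral>\<^sup>+x. ennreal ((conv \<rho> h x)\<^sup>2) \<partial>lborel)
      \<le> (\<integral>\<^sup>+x. \<integral>\<^sup>+y. ennreal (\<rho> (x - y) * (h y)\<^sup>2) \<partial>lborel \<partial>lborel)"
  proof (rule nn_integral_mono)
    fix x
    from nn_integral_eq_integral[OF conv_mollifier_integrable[OF \<rho> h(2)], of x]
    have "(\<integral>\<^sup>+y. ennreal (\<rho> (x - y) * (h y)\<^sup>2) \<partial>lborel) = ennreal (conv \<rho> (\<lambda>y. (h y)\<^sup>2) x)"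
      using \<rho>0 by (simp add: conv_def nn_integral_completion)
    then show "ennreal ((conv \<rho> h x)\<^sup>2) \<le> (\<integral>\<^sup>+y. ennreal (\<rho> (x - y) * (h y)\<^sup>2) \<partial>lborel)"
      using conv_mollifier_Jensen[OF \<rho> h] by (simp add: ennreal_leI)
  qed
  also have "\<dots> = (\<integral>\<^sup>+y. \<integral>\<^sup>+x. ennreal (\<rho> (x - y) * (h y)\<^sup>2) \<partial>lborel \<partial>lborel)"
    by (rule lborel_pair.Fubini') measurable
  also have "\<dots> = (\<integral>\<^sup>+y. \<integral>\<^sup>+x. ennreal (\<rho> (x - y)) * ennreal ((h y)\<^sup>2) \<partial>lborel \<partial>lborel)"
    by (simp add: ennreal_mult \<rho>0)
  also have "\<dots> = (\<integral>\<^sup>+y. ennreal ((h y)\<^sup>2) \<partial>lborel)"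
    by (subst nn_integral_multc) (simp_all add: 1)
  finally show ?thesis .
qed

lemma conv_contraction:
  fixes h :: "'a::euclidean_space \<Rightarrow> real"
  assumes \<rho>: "mollifier r \<rho>" and h: "integrable lebesgue h" "integrable lebesgue (\<lambda>x. (h x)\<^sup>2)"
  shows "integrable lebesgue (\<lambda>x. (conv \<rho> h x)\<^sup>2)"
    "(LINT x|lebesgue. (conv \<rho> h x)\<^sup>2) \<le> (LINT x|lebesgue. (h x)\<^sup>2)"
proof -
  obtain g where g: "g \<in> borel_measurable lborel" "AE x in lborel. h x = g x"
    using completion_ex_borel_measurable_real[OF borel_measurable_integrable[OF h(1)]] by blast
  have hg: "AE x in lebesgue. h x = g x" using g(2) by (rule AE_completion)
  have gm: "g \<in> borel_measurable lebesgue" using g(1) by (rule measurable_completion)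
  have gi: "integrable lebesgue g" "integrable lebesgue (\<lambda>x. (g x)\<^sup>2)"
  proof -
    show "integrable lebesgue g"
      by (rule Bochner_Integration.integrable_cong_AE_imp[OF h(1) gm]) (use hg in auto)
    show "integrable lebesgue (\<lambda>x. (g x)\<^sup>2)"
      by (rule Bochner_Integration.integrable_cong_AE_imp[OF h(2)]) (use hg gm in auto)
  qed
  have ch: "conv \<rho> h = conv \<rho> g"
  proof
    fix x
    show "conv \<rho> h x = conv \<rho> g x" unfolding conv_def
      using conv_mollifier_integrable[OF \<rho> h(1), of x] conv_mollifier_integrable[OF \<rho> gi(1), of x] hg
      by (intro integral_cong_AE borel_measurable_integrable) auto
  qed
  have c: "continuous_on UNIV (conv \<rho> h)"
    by (rule Ck_imp_continuous[OF Ck_conv_mollifier[OF \<rho> h(1)]])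
  then have m: "(\<lambda>x. (conv \<rho> h x)\<^sup>2) \<in> borel_measurable lebesgue"
    by (intro continuous_imp_measurable(2) continuous_intros)
  have "(\<integral>\<^sup>+x. ennreal ((conv \<rho> h x)\<^sup>2) \<partial>lebesgue) \<le> (\<integral>\<^sup>+x. ennreal ((g x)\<^sup>2) \<partial>lebesgue)"
    using conv_contraction_Borel[OF \<rho> gi] g(1) by (simp add: nn_integral_completion ch)
  also have "\<dots> = (\<integral>\<^sup>+x. ennreal ((h x)\<^sup>2) \<partial>lebesgue)"
    by (rule nn_integral_cong_AE) (use hg in auto)
  also have "\<dots> = ennreal (LINT x|lebesgue. (h x)\<^sup>2)"
    by (rule nn_integral_eq_integral[OF h(2)]) simp
  finally have le: "(\<integral>\<^sup>+x. ennreal ((conv \<rho> h x)\<^sup>2) \<partial>lebesgue) \<le> ennreal (LINT x|lebesgue. (h x)\<^sup>2)" .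
  show int: "integrable lebesgue (\<lambda>x. (conv \<rho> h x)\<^sup>2)"
    using m le_less_trans[OF le ennreal_less_top] by (intro integrableI_nonneg) auto
  show "(LINT x|lebesgue. (conv \<rho> h x)\<^sup>2) \<le> (LINT x|lebesgue. (h x)\<^sup>2)"
    using le nn_integral_eq_integral[OF int] by simp
qed

lemma integrable_of_bound_ball:
  fixes u :: "'a::euclidean_space \<Rightarrow> real"
  assumes "u \<in> borel_measurable lebesgue" "\<And>x. \<bar>u x\<bar> \<le> C * indicator (cball 0 R) x"
  shows "integrable lebesgue u"
proof (rule Bochner_Integration.integrable_bound[OF integrable_indicator_cball assms(1)])
  show "AE x in lebesgue. norm (u x) \<le> norm (C * indicator (cball 0 R) x)"
    using assms(2) by (intro AE_I2) (metis abs_le_D1 abs_ge_self order_trans real_norm_def)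
qed

text \<open>
  A Lebesgue measurable function is an almost everywhere limit of continuous functions. Truncating
  their values and multiplying by a cutoff provides a dominating function, so that the convergence also
  holds in mean square.
\<close>

lemma L2_approx_continuous:
  fixes f :: "'a::euclidean_space \<Rightarrow> real"
  assumes f: "f \<in> borel_measurable lebesgue" "integrable lebesgue (\<lambda>x. (f x)\<^sup>2)"
      "\<And>x. R < norm x \<Longrightarrow> f x = 0" and e: "0 < e"
  obtains g where "continuous_on UNIV g" "\<And>x. R + 1 < norm x \<Longrightarrow> g x = 0"
    "integrable lebesgue (\<lambda>x. (f x - g x)\<^sup>2)" "(LINT x|lebesgue. (f x - g x)\<^sup>2) < e"
proof -
  define clip where "clip M t = max (- M) (min M t)" for M t :: real
  have clip_abs: "0 \<le> M \<Longrightarrow> \<bar>clip M t\<bar> \<le> M" for M t by (simp add: clip_def)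
  have clip_0: "0 \<le> M \<Longrightarrow> clip M 0 = 0" for M by (simp add: clip_def)
  have "(\<lambda>n. LINT x|lebesgue. (f x - clip (real n) (f x))\<^sup>2) \<longlonglongrightarrow> (LINT (x::'a)|lebesgue. 0)"
  proof (rule integral_dominated_convergence[where w="\<lambda>x. (f x)\<^sup>2"])
    show "AE x in lebesgue. (\<lambda>n. (f x - clip (real n) (f x))\<^sup>2) \<longlonglongrightarrow> 0"
    proof (rule AE_I2)
      fix x
      obtain N where N: "\<bar>f x\<bar> \<le> real N" using real_arch_simple by blast
      have "f x - clip (real n) (f x) = 0" if "N \<le> n" for n
      proof -
        have "\<bar>f x\<bar> \<le> real n" using N that by linarith
        then show ?thesis by (auto simp: clip_def)
      qed
      then have "\<forall>\<^sub>F n in sequentially. (f x - clip (real n) (f x))\<^sup>2 = 0"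
        unfolding eventually_sequentially by auto
      then show "(\<lambda>n. (f x - clip (real n) (f x))\<^sup>2) \<longlonglongrightarrow> 0" by (rule tendsto_eventually)
    qed
    show "AE x in lebesgue. norm ((f x - clip (real n) (f x))\<^sup>2) \<le> (f x)\<^sup>2" for n
      by (rule AE_I2) (auto simp: clip_def abs_le_square_iff[symmetric])
  qed (use f in \<open>simp_all add: clip_def\<close>)
  then have "\<forall>\<^sub>F n in sequentially. (LINT x|lebesgue. (f x - clip (real n) (f x))\<^sup>2) < e / 4"
    using e by (intro order_tendstoD) auto
  then obtain n where n: "(LINT x|lebesgue. (f x - clip (real n) (f x))\<^sup>2) < e / 4"
    unfolding eventually_sequentially by blast
  define M where "M = real n"
  have M0: "0 \<le> M" by (simp add: M_def)
  define \<kappa> where "\<kappa> x = max 0 (min 1 (R + 1 - norm x))" for x :: 'a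
  have \<kappa>: "0 \<le> \<kappa> x" "\<kappa> x \<le> 1" "R + 1 < norm x \<Longrightarrow> \<kappa> x = 0" for x by (auto simp: \<kappa>_def)
  have cut: "\<kappa> x * clip M (f x) = clip M (f x)" for x
    using f(3)[of x] clip_0[OF M0] by (cases "R < norm x") (auto simp: \<kappa>_def)
  have "f measurable_on UNIV" using f(1) by (rule lebesgue_measurable_imp_measurable_on) simp
  then obtain N G where N: "negligible N" and G: "\<And>n. continuous_on UNIV (G n)"
      and lim: "\<And>x. x \<notin> N \<Longrightarrow> (\<lambda>n. G n x) \<longlonglongrightarrow> f x"
    unfolding measurable_on_def by auto
  define g where "g k x = \<kappa> x * clip M (G k x)" for k x
  have gc: "continuous_on UNIV (g k)" for k
    unfolding g_def \<kappa>_def clip_def by (intro continuous_intros G)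
  have g0: "g k x = 0" if "R + 1 < norm x" for k x using \<kappa>(3)[OF that] by (simp add: g_def)
  have gb: "\<bar>g k x\<bar> \<le> M" for k x
    using mult_mono[OF \<kappa>(2)[of x] clip_abs[OF M0]] \<kappa>(1)[of x] by (simp add: g_def abs_mult)
  have gm: "g k \<in> borel_measurable lebesgue" for k using gc by (rule continuous_imp_measurable(2))
  have fm: "(\<lambda>x. clip M (f x)) \<in> borel_measurable lebesgue" using f(1) by (simp add: clip_def)
  have bd: "\<bar>(clip M (f x) - g k x)\<^sup>2\<bar> \<le> (2 * M)\<^sup>2 * indicator (cball 0 (R + 1)) x" for k x
  proof (cases "R + 1 < norm x")
    case True
    then show ?thesis using f(3)[of x] g0[OF True] clip_0[OF M0] by simp
  next
    case False
    have "\<bar>clip M (f x) - g k x\<bar> \<le> 2 * M" using clip_abs[OF M0, of "f x"] gb[of k x] by linarith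
    then have "(clip M (f x) - g k x)\<^sup>2 \<le> (2 * M)\<^sup>2" using M0 by (intro abs_le_square_iff[THEN iffD1]) simp
    then show ?thesis using False by simp
  qed
  have "(\<lambda>k. LINT x|lebesgue. (clip M (f x) - g k x)\<^sup>2) \<longlonglongrightarrow> (LINT (x::'a)|lebesgue. 0)"
  proof (rule integral_dominated_convergence[where w="\<lambda>x. (2 * M)\<^sup>2 * indicator (cball 0 (R + 1)) x"])
    show "integrable lebesgue (\<lambda>x::'a. (2 * M)\<^sup>2 * indicator (cball 0 (R + 1)) x)"
      by (rule integrable_indicator_cball)
    have "AE x in lebesgue. x \<notin> N"
      using N by (simp add: negligible_iff_null_sets AE_not_in)
    then show "AE x in lebesgue. (\<lambda>k. (clip M (f x) - g k x)\<^sup>2) \<longlonglongrightarrow> 0"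
    proof eventually_elim
      case (elim x)
      have "(\<lambda>k. g k x) \<longlonglongrightarrow> \<kappa> x * clip M (f x)"
        unfolding g_def clip_def by (intro tendsto_intros lim elim)
      then have "(\<lambda>k. (clip M (f x) - g k x)\<^sup>2) \<longlonglongrightarrow> (clip M (f x) - clip M (f x))\<^sup>2"
        unfolding cut by (intro tendsto_intros)
      then show ?case by simp
    qed
    show "AE x in lebesgue. norm ((clip M (f x) - g k x)\<^sup>2) \<le> (2 * M)\<^sup>2 * indicator (cball 0 (R + 1)) x" for k
      using bd by simp
  qed (use fm gm in simp_all)
  then have "\<forall>\<^sub>F k in sequentially. (LINT x|lebesgue. (clip M (f x) - g k x)\<^sup>2) < e / 4"
    using e by (intro order_tendstoD) auto
  then obtain k where k: "(LINT x|lebesgue. (clip M (f x) - g k x)\<^sup>2) < e / 4"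
    unfolding eventually_sequentially by blast
  have i1: "integrable lebesgue (\<lambda>x. (f x - clip M (f x))\<^sup>2)"
    by (rule Bochner_Integration.integrable_bound[OF f(2)])
       (use f fm M0 in \<open>auto intro!: AE_I2 simp: clip_def abs_le_square_iff[symmetric]\<close>)
  have i2: "integrable lebesgue (\<lambda>x. (clip M (f x) - g k x)\<^sup>2)"
    by (rule integrable_of_bound_ball[OF _ bd]) (use fm gm in simp)
  have le: "(f x - g k x)\<^sup>2 \<le> 2 * (f x - clip M (f x))\<^sup>2 + 2 * (clip M (f x) - g k x)\<^sup>2" for x
    using zero_le_power2[of "(f x - clip M (f x)) - (clip M (f x) - g k x)"]
    by (simp add: power2_eq_square algebra_simps)
  have i3: "integrable lebesgue (\<lambda>x. 2 * (f x - clip M (f x))\<^sup>2 + 2 * (clip M (f x) - g k x)\<^sup>2)"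
    using i1 i2 by simp
  have i: "integrable lebesgue (\<lambda>x. (f x - g k x)\<^sup>2)"
    by (rule Bochner_Integration.integrable_bound[OF i3]) (use f(1) gm le in auto)
  have "(LINT x|lebesgue. (f x - g k x)\<^sup>2) \<le>
      (LINT x|lebesgue. 2 * (f x - clip M (f x))\<^sup>2 + 2 * (clip M (f x) - g k x)\<^sup>2)"
    by (rule integral_mono[OF i i3 le])
  also have "\<dots> < e" using i1 i2 n k by (simp add: M_def)
  finally show ?thesis using that[of "g k"] gc g0 i by blast
qed

lemma conv_mollifier_add:
  fixes f :: "'a::euclidean_space \<Rightarrow> real"
  assumes \<rho>: "mollifier r \<rho>" and f: "integrable lebesgue f" "integrable lebesgue g"
  shows "conv \<rho> (\<lambda>x. f x + g x) x = conv \<rho> f x + conv \<rho> g x"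
  using conv_mollifier_integrable[OF \<rho> f(1), of x] conv_mollifier_integrable[OF \<rho> f(2), of x]
  by (simp add: conv_def distrib_left)

lemma conv_tendsto_L2_continuous:
  fixes g :: "'a::euclidean_space \<Rightarrow> real"
  assumes \<rho>: "\<And>n. mollifier (inverse (real (Suc n))) (\<rho> n)"
    and g: "continuous_on UNIV g" "\<And>x. R < norm x \<Longrightarrow> g x = 0"
  shows "integrable lebesgue (\<lambda>x. (conv (\<rho> n) g x - g x)\<^sup>2)"
    "(\<lambda>n. LINT x|lebesgue. (conv (\<rho> n) g x - g x)\<^sup>2) \<longlonglongrightarrow> 0"
proof -
  obtain M where M: "\<And>x. norm (g x) \<le> M" "0 \<le> M"
    using bounded_if_compact_support[OF g] by blast
  have gi: "integrable lebesgue g" using integrable_continuous_compact_support[OF g] .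
  have c: "continuous_on UNIV (conv (\<rho> n) g)" for n
    using Ck_imp_continuous[OF Ck_conv_mollifier[OF \<rho> gi]] .
  have m: "(\<lambda>x. (conv (\<rho> n) g x - g x)\<^sup>2) \<in> borel_measurable lebesgue" for n
    by (intro continuous_imp_measurable(2) continuous_intros c g(1))
  have bd: "\<bar>(conv (\<rho> n) g x - g x)\<^sup>2\<bar> \<le> (2 * M)\<^sup>2 * indicator (cball 0 (R + 1)) x" for n x
  proof (cases "R + 1 < norm x")
    case True
    have "inverse (real (Suc n)) \<le> 1" by (simp add: field_simps)
    then have "inverse (real (Suc n)) + R < norm x" using True by linarith
    from conv_eq_0_outside[OF mollifierD(3)[OF \<rho>] g(2) this] show ?thesis
      using g(2)[of x] True by simp
  next
    case False
    have "\<bar>conv (\<rho> n) g x - g x\<bar> \<le> 2 * M"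
      using conv_mollifier_bound[of _ "\<rho> n" g R M x, OF \<rho> g] M(1) M(1)[of x] by fastforce
    then have "(conv (\<rho> n) g x - g x)\<^sup>2 \<le> (2 * M)\<^sup>2" using M(2) by (intro abs_le_square_iff[THEN iffD1]) simp
    then show ?thesis using False by simp
  qed
  show "integrable lebesgue (\<lambda>x. (conv (\<rho> n) g x - g x)\<^sup>2)"
    by (rule integrable_of_bound_ball[OF m bd])
  have "(\<lambda>n. LINT x|lebesgue. (conv (\<rho> n) g x - g x)\<^sup>2) \<longlonglongrightarrow> (LINT (x::'a)|lebesgue. 0)"
  proof (rule integral_dominated_convergence[where w="\<lambda>x. (2 * M)\<^sup>2 * indicator (cball 0 (R + 1)) x"])
    show "integrable lebesgue (\<lambda>x::'a. (2 * M)\<^sup>2 * indicator (cball 0 (R + 1)) x)"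
      by (rule integrable_indicator_cball)
    show "AE x in lebesgue. (\<lambda>n. (conv (\<rho> n) g x - g x)\<^sup>2) \<longlonglongrightarrow> 0"
    proof (rule AE_I2)
      fix x
      have "(\<lambda>n. (conv (\<rho> n) g x - g x)\<^sup>2) \<longlonglongrightarrow> (g x - g x)\<^sup>2"
        by (intro tendsto_intros conv_mollifier_tendsto[OF \<rho> g])
      then show "(\<lambda>n. (conv (\<rho> n) g x - g x)\<^sup>2) \<longlonglongrightarrow> 0" by simp
    qed
    show "AE x in lebesgue. norm ((conv (\<rho> n) g x - g x)\<^sup>2) \<le> (2 * M)\<^sup>2 * indicator (cball 0 (R + 1)) x" for n
      using bd by simp
  qed (use m in simp_all)
  then show "(\<lambda>n. LINT x|lebesgue. (conv (\<rho> n) g x - g x)\<^sup>2) \<longlonglongrightarrow> 0" by simp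
qed

text \<open>
  Density argument: the claim is clear for continuous functions with compact support, and mollification
  does not increase the mean square of the error made by replacing \<open>f\<close> with such a function.
\<close>

lemma conv_tendsto_L2:
  fixes f :: "'a::euclidean_space \<Rightarrow> real"
  assumes \<rho>: "\<And>n. mollifier (inverse (real (Suc n))) (\<rho> n)"
    and f: "f \<in> borel_measurable lebesgue" "integrable lebesgue (\<lambda>x. (f x)\<^sup>2)"
      "\<And>x. R < norm x \<Longrightarrow> f x = 0"
  shows "integrable lebesgue (\<lambda>x. (conv (\<rho> n) f x - f x)\<^sup>2)"
    "(\<lambda>n. LINT x|lebesgue. (conv (\<rho> n) f x - f x)\<^sup>2) \<longlonglongrightarrow> 0"
proof -
  have fi: "integrable lebesgue f" using integrable_of_square[OF f] .
  have key: "integrable lebesgue (\<lambda>x. (conv (\<rho> n) f x - f x)\<^sup>2) \<and>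
      (LINT x|lebesgue. (conv (\<rho> n) f x - f x)\<^sup>2) \<le>
        6 * (LINT x|lebesgue. (f x - g x)\<^sup>2) + 3 * (LINT x|lebesgue. (conv (\<rho> n) g x - g x)\<^sup>2)"
    if g: "continuous_on UNIV g" "\<And>x. R + 1 < norm x \<Longrightarrow> g x = 0"
      "integrable lebesgue (\<lambda>x. (f x - g x)\<^sup>2)" for g n
  proof -
    have gi: "integrable lebesgue g" using integrable_continuous_compact_support[OF g(1,2)] .
    define h where "h x = f x - g x" for x
    have hi: "integrable lebesgue h" "integrable lebesgue (\<lambda>x. (h x)\<^sup>2)"
      using fi gi g(3) unfolding h_def by simp_all
    have "f = (\<lambda>x. g x + h x)" by (simp add: h_def fun_eq_iff)
    then have cf: "conv (\<rho> n) f x = conv (\<rho> n) g x + conv (\<rho> n) h x" for x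
      using conv_mollifier_add[OF \<rho> gi hi(1), of n x] by simp
    note i = conv_contraction[OF \<rho> hi, of n] conv_tendsto_L2_continuous(1)[of \<rho>, OF \<rho> g(1,2)]
    have le: "(conv (\<rho> n) f x - f x)\<^sup>2 \<le>
        3 * (conv (\<rho> n) h x)\<^sup>2 + 3 * (conv (\<rho> n) g x - g x)\<^sup>2 + 3 * (h x)\<^sup>2" for x
    proof -
      have "(a + b - c)\<^sup>2 \<le> 3 * a\<^sup>2 + 3 * b\<^sup>2 + 3 * c\<^sup>2" for a b c :: real
        using zero_le_power2[of "a - b"] zero_le_power2[of "a + c"] zero_le_power2[of "b + c"]
        by (simp add: power2_eq_square algebra_simps)
      from this[of "conv (\<rho> n) h x" "conv (\<rho> n) g x - g x" "h x"] show ?thesis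
        by (simp add: cf h_def algebra_simps)
    qed
    have c: "continuous_on UNIV (conv (\<rho> n) f)"
      using Ck_imp_continuous[OF Ck_conv_mollifier[OF \<rho> fi]] .
    have m: "(\<lambda>x. (conv (\<rho> n) f x - f x)\<^sup>2) \<in> borel_measurable lebesgue"
      using continuous_imp_measurable(2)[OF c] f(1) by simp
    have ib: "integrable lebesgue (\<lambda>x. 3 * (conv (\<rho> n) h x)\<^sup>2 + 3 * (conv (\<rho> n) g x - g x)\<^sup>2 + 3 * (h x)\<^sup>2)"
      using i(1,3) hi(2) by simp
    have ii: "integrable lebesgue (\<lambda>x. (conv (\<rho> n) f x - f x)\<^sup>2)"
      by (rule Bochner_Integration.integrable_bound[OF ib m]) (use le in auto)
    have "(LINT x|lebesgue. (conv (\<rho> n) f x - f x)\<^sup>2) \<le>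
        (LINT x|lebesgue. 3 * (conv (\<rho> n) h x)\<^sup>2 + 3 * (conv (\<rho> n) g x - g x)\<^sup>2 + 3 * (h x)\<^sup>2)"
      by (rule integral_mono[OF ii ib le])
    also have "\<dots> \<le> 6 * (LINT x|lebesgue. (h x)\<^sup>2) + 3 * (LINT x|lebesgue. (conv (\<rho> n) g x - g x)\<^sup>2)"
      using i hi(2) by simp
    finally show ?thesis using ii by (simp add: h_def)
  qed
  obtain g1 where "continuous_on UNIV g1" "\<And>x. R + 1 < norm x \<Longrightarrow> g1 x = 0"
    "integrable lebesgue (\<lambda>x. (f x - g1 x)\<^sup>2)" "(LINT x|lebesgue. (f x - g1 x)\<^sup>2) < 1"
    using L2_approx_continuous[of f R 1, OF f] by auto
  from key[OF this(1-3)] show "integrable lebesgue (\<lambda>x. (conv (\<rho> n) f x - f x)\<^sup>2)" for n by blast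
  show "(\<lambda>n. LINT x|lebesgue. (conv (\<rho> n) f x - f x)\<^sup>2) \<longlonglongrightarrow> 0"
  proof (rule LIMSEQ_I)
    fix e :: real assume e: "0 < e"
    then obtain g where g: "continuous_on UNIV g" "\<And>x. R + 1 < norm x \<Longrightarrow> g x = 0"
      "integrable lebesgue (\<lambda>x. (f x - g x)\<^sup>2)" "(LINT x|lebesgue. (f x - g x)\<^sup>2) < e / 12"
      using L2_approx_continuous[of f R "e / 12", OF f] by auto
    have "\<forall>\<^sub>F n in sequentially. (LINT x|lebesgue. (conv (\<rho> n) g x - g x)\<^sup>2) < e / 6"
      using conv_tendsto_L2_continuous(2)[OF \<rho> g(1,2)] e by (intro order_tendstoD) auto
    then obtain N where N: "\<And>n. N \<le> n \<Longrightarrow> (LINT x|lebesgue. (conv (\<rho> n) g x - g x)\<^sup>2) < e / 6"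
      unfolding eventually_sequentially by blast
    have "norm ((LINT x|lebesgue. (conv (\<rho> n) f x - f x)\<^sup>2) - 0) < e" if "N \<le> n" for n
    proof -
      have "(LINT x|lebesgue. (conv (\<rho> n) f x - f x)\<^sup>2) < e"
        using key[OF g(1-3), of n] g(4) N[OF that] by linarith
      moreover have "0 \<le> (LINT x|lebesgue. (conv (\<rho> n) f x - f x)\<^sup>2)" by simp
      ultimately show ?thesis by simp
    qed
    then show "\<exists>N. \<forall>n\<ge>N. norm ((LINT x|lebesgue. (conv (\<rho> n) f x - f x)\<^sup>2) - 0) < e" by blast
  qed
qed

lemma integrable_mult_L2:
  fixes a b :: "'a::euclidean_space \<Rightarrow> real"
  assumes "a \<in> borel_measurable lebesgue" "integrable lebesgue (\<lambda>x. (a x)\<^sup>2)"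
    "b \<in> borel_measurable lebesgue" "integrable lebesgue (\<lambda>x. (b x)\<^sup>2)"
  shows "integrable lebesgue (\<lambda>x. a x * b x)"
proof (rule Bochner_Integration.integrable_bound)
  show "integrable lebesgue (\<lambda>x. (a x)\<^sup>2 + (b x)\<^sup>2)" using assms by simp
  have "\<bar>a x * b x\<bar> \<le> (a x)\<^sup>2 + (b x)\<^sup>2" for x
    using sum_squares_bound[of "\<bar>a x\<bar>" "\<bar>b x\<bar>"] abs_ge_zero[of "a x * b x"]
    unfolding abs_mult power2_abs by linarith
  then show "AE x in lebesgue. norm (a x * b x) \<le> norm ((a x)\<^sup>2 + (b x)\<^sup>2)" by simp
qed (use assms in simp)

text \<open>
  Mean square convergence suffices to pass to the limit against a fixed square integrable function.
  Young's inequality with a parameter \<open>t\<close> takes the place of the Cauchy-Schwarz inequality.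
\<close>

lemma integral_mult_tendsto_0:
  fixes a :: "'a::euclidean_space \<Rightarrow> real"
  assumes a: "a \<in> borel_measurable lebesgue" "integrable lebesgue (\<lambda>x. (a x)\<^sup>2)"
    and b: "\<And>n. b n \<in> borel_measurable lebesgue" "\<And>n. integrable lebesgue (\<lambda>x. (b n x)\<^sup>2)"
    and lim: "(\<lambda>n. LINT x|lebesgue. (b n x)\<^sup>2) \<longlonglongrightarrow> 0"
  shows "(\<lambda>n. LINT x|lebesgue. a x * b n x) \<longlonglongrightarrow> 0"
proof -
  have Young: "\<bar>a x * b n x\<bar> \<le> t * (a x)\<^sup>2 + inverse t * (b n x)\<^sup>2" if "0 < t" for t x n
  proof -
    have "0 \<le> inverse t * (t * \<bar>a x\<bar> - \<bar>b n x\<bar>)\<^sup>2" using that by simp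
    also have "\<dots> = t * (a x)\<^sup>2 + inverse t * (b n x)\<^sup>2 - 2 * \<bar>a x * b n x\<bar>"
      using that by (simp add: power2_eq_square abs_mult field_simps)
    finally show ?thesis by linarith
  qed
  have ib: "integrable lebesgue (\<lambda>x. t * (a x)\<^sup>2 + inverse t * (b n x)\<^sup>2)" for t n
    using a b by simp
  have i: "integrable lebesgue (\<lambda>x. a x * b n x)" for n
    by (rule integrable_mult_L2[OF a b])
  have est: "\<bar>LINT x|lebesgue. a x * b n x\<bar> \<le>
      t * (LINT x|lebesgue. (a x)\<^sup>2) + inverse t * (LINT x|lebesgue. (b n x)\<^sup>2)" if "0 < t" for t n
  proof -
    have "norm (LINT x|lebesgue. a x * b n x) \<le> (LINT x|lebesgue. norm (a x * b n x))"
      by (rule integral_norm_bound)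
    also have "\<dots> \<le> (LINT x|lebesgue. t * (a x)\<^sup>2 + inverse t * (b n x)\<^sup>2)"
      by (rule integral_mono[OF integrable_norm[OF i] ib]) (use Young[OF that] in simp)
    also have "\<dots> = t * (LINT x|lebesgue. (a x)\<^sup>2) + inverse t * (LINT x|lebesgue. (b n x)\<^sup>2)"
      using a b by simp
    finally show ?thesis by simp
  qed
  show "(\<lambda>n. LINT x|lebesgue. a x * b n x) \<longlonglongrightarrow> 0"
  proof (rule LIMSEQ_I)
    fix e :: real assume e: "0 < e"
    define A where "A = (LINT x|lebesgue. (a x)\<^sup>2)"
    have A: "0 \<le> A" by (simp add: A_def)
    define t where "t = e / (2 * (A + 1))"
    have t: "0 < t" using e A by (simp add: t_def)
    have tA: "t * A < e / 2" using e A by (simp add: t_def field_simps)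
    have "\<forall>\<^sub>F n in sequentially. (LINT x|lebesgue. (b n x)\<^sup>2) < t * (e / 2)"
      using lim e t by (intro order_tendstoD) auto
    then obtain N where N: "\<And>n. N \<le> n \<Longrightarrow> (LINT x|lebesgue. (b n x)\<^sup>2) < t * (e / 2)"
      unfolding eventually_sequentially by blast
    have "norm ((LINT x|lebesgue. a x * b n x) - 0) < e" if "N \<le> n" for n
    proof -
      have "inverse t * (LINT x|lebesgue. (b n x)\<^sup>2) < e / 2"
        using N[OF that] t by (simp add: field_simps)
      then show ?thesis using est[OF t, of n] tA by (simp add: A_def)
    qed
    then show "\<exists>N. \<forall>n\<ge>N. norm ((LINT x|lebesgue. a x * b n x) - 0) < e" by blast
  qed
qed


section \<open>Local integrability\<close>

lemma integrable_of_bound_local: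
  fixes u :: "'a::euclidean_space \<Rightarrow> 'b::euclidean_space" and w :: "'a \<Rightarrow> 'c::euclidean_space"
  assumes u: "u \<in> borel_measurable lebesgue" and w: "set_integrable lebesgue (cball 0 R) w"
    and le: "\<And>x. norm (u x) \<le> M * norm (w x)" and 0: "\<And>x. R < norm x \<Longrightarrow> u x = 0"
  shows "integrable lebesgue u"
proof (rule Bochner_Integration.integrable_bound[OF _ u])
  show "integrable lebesgue (\<lambda>x. M *\<^sub>R (indicator (cball 0 R) x *\<^sub>R w x))"
    using w unfolding set_integrable_def by (rule integrable_scaleR_right)
  have "norm (u x) \<le> norm (M *\<^sub>R (indicator (cball 0 R) x *\<^sub>R w x))" for x
  proof (cases "R < norm x")
    case False
    have "M * norm (w x) \<le> \<bar>M\<bar> * norm (w x)" by (intro mult_right_mono) auto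
    then show ?thesis using le[of x] False by simp
  qed (simp add: 0)
  then show "AE x in lebesgue. norm (u x) \<le> norm (M *\<^sub>R (indicator (cball 0 R) x *\<^sub>R w x))" by simp
qed

lemma L2_loc_measurable: "L2_loc f \<Longrightarrow> f \<in> borel_measurable lebesgue"
  by (simp add: L2_loc_def)

lemma L2_loc_square_integrable:
  "L2_loc f \<Longrightarrow> set_integrable lebesgue (cball 0 R) (\<lambda>x. (norm (f x))\<^sup>2)"
  by (simp add: L2_loc_def)

lemma L2_loc_mult_integrable:
  fixes f :: "'a::euclidean_space \<Rightarrow> 'b::euclidean_space" and g :: "'a \<Rightarrow> 'c::euclidean_space"
    and u :: "'a \<Rightarrow> 'd::euclidean_space"
  assumes f: "L2_loc f" and g: "L2_loc g" and u: "u \<in> borel_measurable lebesgue"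
    and le: "\<And>x. norm (u x) \<le> norm (f x) * norm (g x)"
  shows "set_integrable lebesgue (cball 0 R) u"
proof -
  have "set_integrable lebesgue (cball 0 R) (\<lambda>x. (norm (f x))\<^sup>2 + (norm (g x))\<^sup>2)"
    using f g by (intro set_integral_add L2_loc_square_integrable)
  note w = this
  have "integrable lebesgue (\<lambda>x. indicator (cball 0 R) x *\<^sub>R u x)"
  proof (rule integrable_of_bound_local[OF _ w])
    show "(\<lambda>x. indicator (cball 0 R) x *\<^sub>R u x) \<in> borel_measurable lebesgue"
      using u by (intro borel_measurable_scaleR borel_measurable_indicator) auto
    show "norm (indicator (cball 0 R) x *\<^sub>R u x) \<le> 1 * norm ((norm (f x))\<^sup>2 + (norm (g x))\<^sup>2)" for x
    proof -
      have "norm (f x) * norm (g x) \<le> (norm (f x))\<^sup>2 + (norm (g x))\<^sup>2"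
        using sum_squares_bound[of "norm (f x)" "norm (g x)"]
          mult_nonneg_nonneg[OF norm_ge_zero[of "f x"] norm_ge_zero[of "g x"]] by linarith
      then show ?thesis using le[of x] by (auto simp: indicator_def)
    qed
  qed auto
  then show ?thesis by (simp add: set_integrable_def)
qed

lemma L2_loc_dominated:
  fixes f :: "'a::euclidean_space \<Rightarrow> 'b::euclidean_space" and u :: "'a \<Rightarrow> 'c::euclidean_space"
  assumes f: "L2_loc f" and u: "u \<in> borel_measurable lebesgue"
    and le: "\<And>K. compact K \<Longrightarrow> \<exists>C. AE x in lebesgue. x \<in> K \<longrightarrow> norm (u x) \<le> C * norm (f x)"
  shows "L2_loc u"
  unfolding L2_loc_def set_integrable_def
proof (intro conjI allI impI)
  fix K :: "'a set" assume K: "compact K"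
  obtain C where C: "AE x in lebesgue. x \<in> K \<longrightarrow> norm (u x) \<le> C * norm (f x)"
    using le[OF K] by blast
  have i: "integrable lebesgue (\<lambda>x. indicator K x *\<^sub>R (norm (f x))\<^sup>2)"
    using f K by (simp add: L2_loc_def set_integrable_def)
  have Km: "K \<in> sets lebesgue" using compact_imp_closed[OF K] by auto
  show "integrable lebesgue (\<lambda>x. indicator K x *\<^sub>R (norm (u x))\<^sup>2)"
  proof (rule Bochner_Integration.integrable_bound)
    show "integrable lebesgue (\<lambda>x. C\<^sup>2 *\<^sub>R (indicator K x *\<^sub>R (norm (f x))\<^sup>2))"
      using i by (rule integrable_scaleR_right)
    show "(\<lambda>x. indicator K x *\<^sub>R (norm (u x))\<^sup>2) \<in> borel_measurable lebesgue"
      by (rule borel_measurable_scaleR[OF borel_measurable_indicator[OF Km]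
            borel_measurable_power[OF measurable_compose[OF u borel_measurable_norm]]])
    show "AE x in lebesgue. norm (indicator K x *\<^sub>R (norm (u x))\<^sup>2) \<le>
        norm (C\<^sup>2 *\<^sub>R (indicator K x *\<^sub>R (norm (f x))\<^sup>2))"
      using C
    proof eventually_elim
      case (elim x)
      show ?case
      proof (cases "x \<in> K")
        case True
        with elim have "(norm (u x))\<^sup>2 \<le> (C * norm (f x))\<^sup>2" by (intro power_mono) auto
        then show ?thesis using True by (simp add: power_mult_distrib)
      qed simp
    qed
  qed
qed (rule u)

lemma Linf_loc_mult_L2_loc:
  fixes f :: "'a::euclidean_space \<Rightarrow> 'b::euclidean_space"
  assumes \<phi>: "Linf_loc \<phi>" and f: "L2_loc f"
  shows "L2_loc (\<lambda>x. \<phi> x *\<^sub>R f x)"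
proof (rule L2_loc_dominated[OF f])
  show "(\<lambda>x. \<phi> x *\<^sub>R f x) \<in> borel_measurable lebesgue"
    by (rule borel_measurable_scaleR[OF \<phi>[unfolded Linf_loc_def, THEN conjunct1] L2_loc_measurable[OF f]])
  fix K :: "'a set" assume "compact K"
  then obtain C where C: "AE x in lebesgue. x \<in> K \<longrightarrow> \<bar>\<phi> x\<bar> \<le> C"
    using \<phi> unfolding Linf_loc_def by blast
  then have "AE x in lebesgue. x \<in> K \<longrightarrow> norm (\<phi> x *\<^sub>R f x) \<le> C * norm (f x)"
    by eventually_elim (auto intro!: mult_right_mono)
  then show "\<exists>C. AE x in lebesgue. x \<in> K \<longrightarrow> norm (\<phi> x *\<^sub>R f x) \<le> C * norm (f x)" by blast
qed

lemma L2_loc_cutoff: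
  fixes f k :: "'a::euclidean_space \<Rightarrow> real"
  assumes f: "L2_loc f" and k: "k \<in> borel_measurable lebesgue" "\<And>x. \<bar>k x\<bar> \<le> M"
    "\<And>x. R < norm x \<Longrightarrow> k x = 0"
  shows "(\<lambda>x. k x * f x) \<in> borel_measurable lebesgue" "integrable lebesgue (\<lambda>x. (k x * f x)\<^sup>2)"
proof -
  show m: "(\<lambda>x. k x * f x) \<in> borel_measurable lebesgue"
    using k(1) L2_loc_measurable[OF f] by simp
  show "integrable lebesgue (\<lambda>x. (k x * f x)\<^sup>2)"
  proof (rule integrable_of_bound_local[OF _ L2_loc_square_integrable[OF f, of R]])
    show "(\<lambda>x. (k x * f x)\<^sup>2) \<in> borel_measurable lebesgue" using m by simp
    show "norm ((k x * f x)\<^sup>2) \<le> M\<^sup>2 * norm ((norm (f x))\<^sup>2)" for x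
    proof -
      have "\<bar>k x\<bar> \<le> \<bar>M\<bar>" using k(2)[of x] by linarith
      then have "(k x)\<^sup>2 \<le> M\<^sup>2" by (simp add: abs_le_square_iff)
      then show ?thesis by (simp add: power_mult_distrib mult_right_mono)
    qed
    show "(k x * f x)\<^sup>2 = 0" if "R < norm x" for x using k(3)[OF that] by simp
  qed
qed

lemma L2_loc_indicator:
  fixes f :: "'a::euclidean_space \<Rightarrow> real"
  assumes "L2_loc f"
  shows "(\<lambda>x. indicator (cball 0 R) x * f x) \<in> borel_measurable lebesgue"
    "integrable lebesgue (\<lambda>x. (indicator (cball 0 R) x * f x)\<^sup>2)"
proof -
  have m: "(indicator (cball 0 R) :: 'a \<Rightarrow> real) \<in> borel_measurable lebesgue"
    by (rule borel_measurable_indicator) auto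
  have b: "\<bar>indicator (cball 0 R) x :: real\<bar> \<le> 1" for x :: 'a by (simp add: indicator_def)
  have z: "R < norm x \<Longrightarrow> (indicator (cball 0 R) x :: real) = 0" for x :: 'a by simp
  show "(\<lambda>x. indicator (cball 0 R) x * f x) \<in> borel_measurable lebesgue"
    "integrable lebesgue (\<lambda>x. (indicator (cball 0 R) x * f x)\<^sup>2)"
    by (rule L2_loc_cutoff[OF assms m b z], assumption)+
qed

lemma L2_loc_inner:
  fixes f :: "'a::euclidean_space \<Rightarrow> 'b::euclidean_space"
  assumes "L2_loc f"
  shows "L2_loc (\<lambda>x. f x \<bullet> h)"
proof (rule L2_loc_dominated[OF assms])
  show "(\<lambda>x. f x \<bullet> h) \<in> borel_measurable lebesgue" using L2_loc_measurable[OF assms] by simp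
  fix K :: "'a set"
  have "norm (f x \<bullet> h) \<le> norm h * norm (f x)" for x
    using Cauchy_Schwarz_ineq2[of "f x" h] by (simp add: mult.commute)
  then show "\<exists>C. AE x in lebesgue. x \<in> K \<longrightarrow> norm (f x \<bullet> h) \<le> C * norm (f x)"
    by (intro exI[of _ "norm h"] AE_I2) simp
qed

lemma continuous_imp_L2_loc:
  fixes f :: "'a::euclidean_space \<Rightarrow> 'b::euclidean_space"
  assumes "continuous_on UNIV f"
  shows "L2_loc f"
  unfolding L2_loc_def set_integrable_def
proof (intro conjI allI impI)
  show "f \<in> borel_measurable lebesgue" using assms by (rule continuous_imp_measurable(2))
  fix K :: "'a set" assume K: "compact K"
  have c: "continuous_on UNIV (\<lambda>x. (norm (f x))\<^sup>2)" using assms by (intro continuous_intros)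
  have "integrable lborel (\<lambda>x. indicator K x *\<^sub>R (norm (f x))\<^sup>2)"
    by (rule borel_integrable_compact[OF K]) (rule continuous_on_subset[OF c subset_UNIV])
  then show "integrable lebesgue (\<lambda>x. indicator K x *\<^sub>R (norm (f x))\<^sup>2)"
    using compact_imp_closed[OF K] continuous_imp_measurable(1)[OF c] by (subst integrable_completion) auto
qed

section \<open>Weak gradients\<close>

lemma weak_gradient_inner:
  fixes \<sigma> :: "'a::euclidean_space \<Rightarrow> real"
  assumes \<sigma>: "L2_loc \<sigma>" and G: "has_L2_weak_gradient \<sigma> G" and \<eta>: "test_function \<eta>"
  shows "integrable lebesgue (\<lambda>x. \<sigma> x * (grad \<eta> x \<bullet> h))"
    "integrable lebesgue (\<lambda>x. \<eta> x * (G x \<bullet> h))"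
    "(LINT x|lebesgue. \<sigma> x * (grad \<eta> x \<bullet> h)) = - (LINT x|lebesgue. \<eta> x * (G x \<bullet> h))"
proof -
  have Gl: "L2_loc G" using G by (simp add: has_L2_weak_gradient_def)
  obtain R where Ck: "\<And>k. Ck k \<eta>" and R: "\<And>x. R < norm x \<Longrightarrow> \<eta> x = 0"
    using \<eta> unfolding test_function_iff by blast
  have g0: "grad \<eta> x = 0" if "R < norm x" for x using grad_eq_0_outside[OF R that] .
  have gc: "continuous_on UNIV (grad \<eta>)" using continuous_on_grad[OF Ck] .
  obtain L where L: "\<And>x. norm (grad \<eta> x) \<le> L"
    using bounded_if_compact_support[OF gc g0] by blast
  have ec: "continuous_on UNIV \<eta>" using Ck_imp_continuous[OF Ck] .
  obtain M where M: "\<And>x. norm (\<eta> x) \<le> M"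
    using bounded_if_compact_support[OF ec R] by blast
  have one: "L2_loc (\<lambda>x::'a. 1::real)" by (rule continuous_imp_L2_loc) simp
  have \<sigma>i: "set_integrable lebesgue (cball 0 R) \<sigma>"
    by (rule L2_loc_mult_integrable[OF \<sigma> one L2_loc_measurable[OF \<sigma>]]) simp
  have Gi: "set_integrable lebesgue (cball 0 R) G"
    by (rule L2_loc_mult_integrable[OF Gl one L2_loc_measurable[OF Gl]]) simp
  have 1: "integrable lebesgue (\<lambda>x. \<sigma> x *\<^sub>R grad \<eta> x)"
  proof (rule integrable_of_bound_local[OF _ \<sigma>i])
    show "(\<lambda>x. \<sigma> x *\<^sub>R grad \<eta> x) \<in> borel_measurable lebesgue"
      using L2_loc_measurable[OF \<sigma>] continuous_imp_measurable(2)[OF gc] by simp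
    show "norm (\<sigma> x *\<^sub>R grad \<eta> x) \<le> L * norm (\<sigma> x)" for x
      using mult_left_mono[OF L[of x], of "\<bar>\<sigma> x\<bar>"] by (simp add: mult.commute)
    show "\<sigma> x *\<^sub>R grad \<eta> x = 0" if "R < norm x" for x using g0[OF that] by simp
  qed
  have 2: "integrable lebesgue (\<lambda>x. \<eta> x *\<^sub>R G x)"
  proof (rule integrable_of_bound_local[OF _ Gi])
    show "(\<lambda>x. \<eta> x *\<^sub>R G x) \<in> borel_measurable lebesgue"
      using L2_loc_measurable[OF Gl] continuous_imp_measurable(2)[OF ec] by simp
    show "norm (\<eta> x *\<^sub>R G x) \<le> M * norm (G x)" for x
      using mult_right_mono[OF M[of x], of "norm (G x)"] by simp
    show "\<eta> x *\<^sub>R G x = 0" if "R < norm x" for x using R[OF that] by simp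
  qed
  show "integrable lebesgue (\<lambda>x. \<sigma> x * (grad \<eta> x \<bullet> h))"
    using integrable_inner_left[OF 1, of h] by simp
  show "integrable lebesgue (\<lambda>x. \<eta> x * (G x \<bullet> h))"
    using integrable_inner_left[OF 2, of h] by simp
  have "(LINT x|lebesgue. \<sigma> x *\<^sub>R grad \<eta> x) = - (LINT x|lebesgue. \<eta> x *\<^sub>R G x)"
    using G \<eta> by (simp add: has_L2_weak_gradient_def)
  then have "(LINT x|lebesgue. \<sigma> x *\<^sub>R grad \<eta> x) \<bullet> h = (- (LINT x|lebesgue. \<eta> x *\<^sub>R G x)) \<bullet> h" by simp
  then show "(LINT x|lebesgue. \<sigma> x * (grad \<eta> x \<bullet> h)) = - (LINT x|lebesgue. \<eta> x * (G x \<bullet> h))"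
    using 1 2 by (simp flip: integral_inner_left)
qed

lemma test_function_reflect:
  assumes "mollifier r \<rho>"
  shows "test_function (\<lambda>y. \<rho> (x - y))"
  unfolding test_function_iff
proof (intro conjI allI exI impI)
  show "Ck k (\<lambda>y. \<rho> (x - y))" for k by (rule Ck_reflect[OF mollifierD(1)[OF assms]])
  fix y :: 'a assume "norm x + r < norm y"
  then show "\<rho> (x - y) = 0" by (intro mollifierD(3)[OF assms] norm_diff_large)
qed

text \<open>
  The function \<open>y \<mapsto> \<rho> (x - y)\<close> is a test function, so the gradient of a mollification is the
  mollification of the weak gradient, as long as the truncation at radius \<open>S\<close> is not seen from \<open>x\<close>.
\<close>

lemma grad_conv_weak_zero:
  fixes \<sigma> :: "'a::euclidean_space \<Rightarrow> real"
  assumes \<sigma>: "L2_loc \<sigma>" and G: "has_L2_weak_gradient \<sigma> G" and G0: "AE x in lebesgue. G x = 0"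
    and \<rho>: "mollifier r \<rho>" and f: "integrable lebesgue (\<lambda>y. indicator (cball 0 S) y * \<sigma> y)"
    and x: "norm x + r \<le> S"
  shows "grad (conv \<rho> (\<lambda>y. indicator (cball 0 S) y * \<sigma> y)) x \<bullet> h = 0"
proof -
  have "grad (conv \<rho> (\<lambda>y. indicator (cball 0 S) y * \<sigma> y)) x \<bullet> h =
      (LINT y|lebesgue. (grad \<rho> (x - y) \<bullet> h) * (indicator (cball 0 S) y * \<sigma> y))"
    by (subst grad_conv_mollifier[OF \<rho> f]) (unfold conv_def, rule refl)
  also have "\<dots> = (LINT y|lebesgue. - (\<sigma> y * (grad (\<lambda>y. \<rho> (x - y)) y \<bullet> h)))"
  proof (rule Bochner_Integration.integral_cong[OF refl])
    fix y
    have "grad \<rho> (x - y) = 0" if "S < norm y"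
    proof (rule grad_eq_0_outside[OF mollifierD(3)[OF \<rho>]])
      show "r < norm (x - y)"
        by (rule norm_diff_large) (use that x in linarith)
    qed
    then show "(grad \<rho> (x - y) \<bullet> h) * (indicator (cball 0 S) y * \<sigma> y) =
        - (\<sigma> y * (grad (\<lambda>y. \<rho> (x - y)) y \<bullet> h))"
      unfolding grad_reflect[OF mollifierD(1)[OF \<rho>]]
      by (cases "S < norm y") auto
  qed
  also have "\<dots> = (LINT y|lebesgue. \<rho> (x - y) * (G y \<bullet> h))"
    using weak_gradient_inner(3)[OF \<sigma> G test_function_reflect[OF \<rho>, of x], of h] by simp
  also have "\<dots> = (LINT (y::'a)|lebesgue. 0)"
  proof (rule integral_cong_AE)
    show "(\<lambda>y. \<rho> (x - y) * (G y \<bullet> h)) \<in> borel_measurable lebesgue"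
      using weak_gradient_inner(2)[OF \<sigma> G test_function_reflect[OF \<rho>, of x], of h] by simp
  qed (use G0 in auto)
  finally show ?thesis by simp
qed

text \<open>
  Truncate \<open>\<sigma>\<close> outside a slightly larger ball. The mollifications of the truncation have zero gradient
  on the given ball, hence are constant there, and a subsequence of them converges to \<open>\<sigma>\<close> almost
  everywhere on it.
\<close>

lemma weak_gradient_zero_const_on_ball:
  fixes \<sigma> :: "'a::euclidean_space \<Rightarrow> real"
  assumes \<sigma>: "L2_loc \<sigma>" and G: "has_L2_weak_gradient \<sigma> G" and G0: "AE x in lebesgue. G x = 0"
  shows "\<exists>c. AE x in lebesgue. x \<in> ball 0 R \<longrightarrow> \<sigma> x = c"
proof -
  obtain \<rho> :: "nat \<Rightarrow> 'a \<Rightarrow> real" where \<rho>: "\<And>n. mollifier (inverse (real (Suc n))) (\<rho> n)"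
    by (rule mollifier_sequence) blast
  define f where "f y = indicator (cball 0 (R + 1)) y * \<sigma> y" for y
  have f: "f \<in> borel_measurable lebesgue" "integrable lebesgue (\<lambda>x. (f x)\<^sup>2)"
    using L2_loc_indicator[OF \<sigma>, of "R + 1"] by (simp_all add: f_def[abs_def])
  have f0: "f x = 0" if "R + 1 < norm x" for x using that by (simp add: f_def)
  have fi: "integrable lebesgue f" using integrable_of_square[OF f f0] .
  have "\<exists>c. \<forall>x\<in>ball 0 R. conv (\<rho> n) f x = c" for n
  proof (rule has_derivative_zero_constant)
    fix x :: 'a assume x: "x \<in> ball 0 R"
    have Ck: "Ck (Suc 0) (conv (\<rho> n) f)"
      by (rule Ck_conv_mollifier[OF \<rho> fi])
    have "inverse (real (Suc n)) \<le> 1" by (simp add: field_simps)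
    then have "norm x + inverse (real (Suc n)) \<le> R + 1" using x by simp
    from grad_conv_weak_zero[OF \<sigma> G G0 \<rho> _ this] fi
    have "grad (conv (\<rho> n) f) x \<bullet> h = 0" for h by (simp add: f_def[abs_def])
    then show "(conv (\<rho> n) f has_derivative (\<lambda>h. 0)) (at x within ball 0 R)"
      using C1_has_derivative[OF Ck, of x] by (simp add: has_derivative_at_withinI)
  qed simp
  then obtain c where c: "\<And>n x. x \<in> ball 0 R \<Longrightarrow> conv (\<rho> n) f x = c n" by metis
  have "\<exists>s. strict_mono s \<and> (AE x in lebesgue. (\<lambda>n. (conv (\<rho> (s n)) f x - f x)\<^sup>2) \<longlonglongrightarrow> 0)"
  proof (rule tendsto_L1_AE_subseq)
    show "integrable lebesgue (\<lambda>x. (conv (\<rho> n) f x - f x)\<^sup>2)" for n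
      by (rule conv_tendsto_L2(1)[of \<rho>, OF \<rho> f f0])
    show "(\<lambda>n. LINT x|lebesgue. norm ((conv (\<rho> n) f x - f x)\<^sup>2)) \<longlonglongrightarrow> 0"
      using conv_tendsto_L2(2)[of \<rho>, OF \<rho> f f0] by simp
  qed
  then obtain s where s: "AE x in lebesgue. (\<lambda>n. (conv (\<rho> (s n)) f x - f x)\<^sup>2) \<longlonglongrightarrow> 0" by blast
  have "AE x in lebesgue. x \<in> ball 0 R \<longrightarrow> \<sigma> x = lim (\<lambda>n. c (s n))"
    using s
  proof eventually_elim
    case (elim x)
    show ?case
    proof
      assume x: "x \<in> ball 0 R"
      then have "(\<lambda>n. (c (s n) - \<sigma> x)\<^sup>2) \<longlonglongrightarrow> 0" using elim by (simp add: c f_def)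
      then have "(\<lambda>n. sqrt ((c (s n) - \<sigma> x)\<^sup>2)) \<longlonglongrightarrow> sqrt 0" by (rule tendsto_real_sqrt)
      then have "(\<lambda>n. \<bar>c (s n) - \<sigma> x\<bar>) \<longlonglongrightarrow> 0" by simp
      then have "(\<lambda>n. c (s n) - \<sigma> x) \<longlonglongrightarrow> 0" by (simp add: tendsto_rabs_zero_iff)
      then have "(\<lambda>n. c (s n)) \<longlonglongrightarrow> \<sigma> x" by (rule LIM_zero_cancel)
      then show "\<sigma> x = lim (\<lambda>n. c (s n))" by (simp add: limI)
    qed
  qed
  then show ?thesis by blast
qed

lemma weak_gradient_zero_imp_ae_constant:
  fixes \<sigma> :: "'a::euclidean_space \<Rightarrow> real"
  assumes "L2_loc \<sigma>" "has_L2_weak_gradient \<sigma> G" "AE x in lebesgue. G x = 0"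
  shows "ae_constant \<sigma>"
proof -
  have "\<forall>n::nat. \<exists>c. AE x in lebesgue. x \<in> ball 0 (real (Suc n)) \<longrightarrow> \<sigma> x = c"
    using weak_gradient_zero_const_on_ball[OF assms] by blast
  then obtain c where c: "\<And>n. AE x in lebesgue. x \<in> ball 0 (real (Suc n)) \<longrightarrow> \<sigma> x = c n"
    by metis
  have cc: "c n = c 0" for n
  proof (rule ccontr)
    assume ne: "c n \<noteq> c 0"
    have "AE x in lebesgue. (x::'a) \<notin> ball 0 1"
      using c[of n] c[of 0]
    proof eventually_elim
      case (elim x)
      have "ball 0 1 \<subseteq> ball (0::'a) (real (Suc n))" by (intro subset_ball) simp
      then show ?case using elim ne by auto
    qed
    moreover have "open {x. \<not> (x::'a) \<notin> ball 0 1}"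
      using open_ball[of "0::'a" 1] by (simp only: not_not Collect_mem_eq)
    ultimately have "(0::'a) \<notin> ball 0 1" by (rule AE_lebesgue_open)
    then show False by simp
  qed
  have "AE x in lebesgue. \<forall>n. x \<in> ball 0 (real (Suc n)) \<longrightarrow> \<sigma> x = c n"
    unfolding AE_all_countable using c by (rule allI)
  then have "AE x in lebesgue. \<sigma> x = c 0"
  proof eventually_elim
    case (elim x)
    obtain n where "norm x < real n" using reals_Archimedean2[of "norm x"] by (elim exE)
    then have "x \<in> ball 0 (real (Suc n))" by simp
    with elim have "\<sigma> x = c n" by blast
    then show ?case by (rule trans[OF _ cc])
  qed
  then show ?thesis unfolding ae_constant_def by blast
qed

section \<open>Solutions are subsolutions\<close>

text \<open>
  The product rule for \<open>\<eta> \<sigma>\<close> in mollified form: the definition of the weak gradient is applied to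
  the test function \<open>y \<mapsto> \<rho> (x - y) * \<eta> y\<close>.
\<close>

lemma grad_conv_weak:
  fixes \<sigma> :: "'a::euclidean_space \<Rightarrow> real"
  assumes \<sigma>: "L2_loc \<sigma>" and G: "has_L2_weak_gradient \<sigma> G" and \<eta>: "test_function \<eta>"
    and \<rho>: "mollifier r \<rho>" and f: "integrable lebesgue (\<lambda>y. \<eta> y * \<sigma> y)"
  shows "grad (conv \<rho> (\<lambda>y. \<eta> y * \<sigma> y)) x \<bullet> h =
    conv \<rho> (\<lambda>y. \<eta> y * (G y \<bullet> h) + (grad \<eta> y \<bullet> h) * \<sigma> y) x"
proof -
  define \<zeta> where "\<zeta> y = \<rho> (x - y) * \<eta> y" for y
  have t: "test_function (\<lambda>y. \<rho> (x - y))" by (rule test_function_reflect[OF \<rho>])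
  obtain R where Ck: "\<And>k. Ck k \<eta>" and R: "\<And>x. R < norm x \<Longrightarrow> \<eta> x = 0"
    using \<eta> unfolding test_function_iff by blast
  have Ckr: "Ck k (\<lambda>y. \<rho> (x - y))" for k using t by (simp add: test_function_iff)
  have \<zeta>: "test_function \<zeta>"
    unfolding test_function_iff \<zeta>_def
    by (intro conjI allI Ck_mult Ckr Ck exI[of _ R]) (simp add: R)
  have g\<zeta>: "grad \<zeta> y = \<rho> (x - y) *\<^sub>R grad \<eta> y - \<eta> y *\<^sub>R grad \<rho> (x - y)" for y
    unfolding \<zeta>_def[abs_def] grad_mult[OF Ckr Ck] grad_reflect[OF mollifierD(1)[OF \<rho>]] by simp
  note w = weak_gradient_inner[OF \<sigma> G \<zeta>, of h]
  have gr: "continuous_on UNIV (\<lambda>z. grad \<rho> z \<bullet> h)"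
    by (intro continuous_intros continuous_on_grad[OF mollifierD(1)[OF \<rho>]])
  have gr0: "grad \<rho> z \<bullet> h = 0" if "r < norm z" for z
    using grad_eq_0_outside[OF mollifierD(3)[OF \<rho>] that] by simp
  obtain M where M: "\<And>x. norm (grad \<rho> x \<bullet> h) \<le> M"
    using bounded_if_compact_support[OF gr gr0] by blast
  have i1: "integrable lebesgue (\<lambda>y. (grad \<rho> (x - y) \<bullet> h) * (\<eta> y * \<sigma> y))"
    using conv_integrable[OF gr _ f, of M x] M by simp
  have "(LINT y|lebesgue. (grad \<rho> (x - y) \<bullet> h) * (\<eta> y * \<sigma> y)) =
    (LINT y|lebesgue. ((grad \<rho> (x - y) \<bullet> h) * (\<eta> y * \<sigma> y) + \<sigma> y * (grad \<zeta> y \<bullet> h)) + \<zeta> y * (G y \<bullet> h))"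
    using i1 w by simp
  also have "\<dots> = (LINT y|lebesgue. \<rho> (x - y) * (\<eta> y * (G y \<bullet> h) + (grad \<eta> y \<bullet> h) * \<sigma> y))"
    by (rule Bochner_Integration.integral_cong) (auto simp: g\<zeta> \<zeta>_def inner_diff_left algebra_simps)
  finally have "conv (\<lambda>z. grad \<rho> z \<bullet> h) (\<lambda>y. \<eta> y * \<sigma> y) x =
      conv \<rho> (\<lambda>y. \<eta> y * (G y \<bullet> h) + (grad \<eta> y \<bullet> h) * \<sigma> y) x"
    unfolding conv_def .
  then show ?thesis
    unfolding grad_conv_mollifier[OF \<rho> f] .
qed

text \<open>
  The smooth functions \<open>\<psi> n = conv (\<rho> n) (\<eta> \<sigma>)\<close> are admissible in the equation, and their gradients
  converge in mean square to \<open>W = \<eta> G + \<sigma> grad \<eta>\<close>. In the limit \<open>\<phi>\<^sup>2 G\<close> is orthogonal to \<open>W\<close>, which is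
  the defining inequality of a subsolution with equality.
\<close>

lemma div_zero_imp_sigma_div_nonneg:
  fixes \<sigma> :: "'a::euclidean_space \<Rightarrow> real"
  assumes \<phi>: "Linf_loc \<phi>" and \<sigma>: "L2_loc \<sigma>" and G: "has_L2_weak_gradient \<sigma> G" and div: "div_zero \<phi> G"
  shows "sigma_div_nonneg \<phi> \<sigma> G"
  unfolding sigma_div_nonneg_def
proof (intro allI impI, elim conjE)
  fix \<eta> :: "'a \<Rightarrow> real" assume \<eta>: "test_function \<eta>"
  obtain \<rho> :: "nat \<Rightarrow> 'a \<Rightarrow> real" where \<rho>: "\<And>n. mollifier (inverse (real (Suc n))) (\<rho> n)"
    by (rule mollifier_sequence) blast
  have Gl: "L2_loc G" using G by (simp add: has_L2_weak_gradient_def)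
  obtain R where Ck: "\<And>k. Ck k \<eta>" and R: "\<And>x. R < norm x \<Longrightarrow> \<eta> x = 0"
    using \<eta> unfolding test_function_iff by blast
  have ec: "continuous_on UNIV \<eta>" using Ck_imp_continuous[OF Ck] .
  obtain M where M: "\<And>x. norm (\<eta> x) \<le> M"
    using bounded_if_compact_support[OF ec R] by blast
  note em = continuous_imp_measurable(2)[OF ec]
  have f: "(\<lambda>y. \<eta> y * \<sigma> y) \<in> borel_measurable lebesgue" "integrable lebesgue (\<lambda>y. (\<eta> y * \<sigma> y)\<^sup>2)"
    using L2_loc_cutoff[of \<sigma> \<eta> M R, OF \<sigma> em _ R] M by auto
  have f0: "\<eta> x * \<sigma> x = 0" if "R < norm x" for x using R[OF that] by simp
  have fi: "integrable lebesgue (\<lambda>y. \<eta> y * \<sigma> y)" using integrable_of_square[OF f f0] .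
  define W where "W h y = \<eta> y * (G y \<bullet> h) + (grad \<eta> y \<bullet> h) * \<sigma> y" for h y
  define V where "V h x = indicator (cball 0 (R + 1)) x * (\<phi> x * (\<phi> x * (G x \<bullet> h)))" for h x
  have W0: "W h x = 0" if "R < norm x" for h x
    using R[OF that] grad_eq_0_outside[OF R that] by (simp add: W_def)
  have Wm: "W h \<in> borel_measurable lebesgue" and Wi: "integrable lebesgue (\<lambda>x. (W h x)\<^sup>2)" for h
  proof -
    have gc: "continuous_on UNIV (\<lambda>y. grad \<eta> y \<bullet> h)"
      by (intro continuous_intros continuous_on_grad[OF Ck])
    have g0: "grad \<eta> y \<bullet> h = 0" if "R < norm y" for y
      using grad_eq_0_outside[OF R that] by simp
    obtain L where L: "\<And>x. norm (grad \<eta> x \<bullet> h) \<le> L"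
      using bounded_if_compact_support[OF gc g0] by blast
    have a: "(\<lambda>y. \<eta> y * (G y \<bullet> h)) \<in> borel_measurable lebesgue"
        "integrable lebesgue (\<lambda>y. (\<eta> y * (G y \<bullet> h))\<^sup>2)"
      using L2_loc_cutoff[of "\<lambda>y. G y \<bullet> h" \<eta> M R, OF L2_loc_inner[OF Gl] em _ R] M by auto
    have b: "(\<lambda>y. (grad \<eta> y \<bullet> h) * \<sigma> y) \<in> borel_measurable lebesgue"
        "integrable lebesgue (\<lambda>y. ((grad \<eta> y \<bullet> h) * \<sigma> y)\<^sup>2)"
      using L2_loc_cutoff[of \<sigma> _ L R, OF \<sigma> continuous_imp_measurable(2)[OF gc] _ g0] L by auto
    show m: "W h \<in> borel_measurable lebesgue" unfolding W_def[abs_def] using a(1) b(1) by simp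
    have "integrable lebesgue (\<lambda>y. 2 * (\<eta> y * (G y \<bullet> h))\<^sup>2 + 2 * ((grad \<eta> y \<bullet> h) * \<sigma> y)\<^sup>2)"
      using a b by simp
    then show "integrable lebesgue (\<lambda>x. (W h x)\<^sup>2)"
    proof (rule Bochner_Integration.integrable_bound)
      have "(a + b)\<^sup>2 \<le> 2 * a\<^sup>2 + 2 * b\<^sup>2" for a b :: real
        using zero_le_power2[of "a - b"] by (simp add: power2_eq_square algebra_simps)
      then show "AE x in lebesgue. norm ((W h x)\<^sup>2) \<le>
          norm (2 * (\<eta> x * (G x \<bullet> h))\<^sup>2 + 2 * ((grad \<eta> x \<bullet> h) * \<sigma> x)\<^sup>2)"
        by (simp add: W_def)
    qed (use m in simp)
  qed
  have Vl: "L2_loc (\<lambda>x. \<phi> x * (\<phi> x * (G x \<bullet> h)))" for h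
    using Linf_loc_mult_L2_loc[OF \<phi> Linf_loc_mult_L2_loc[OF \<phi> L2_loc_inner[OF Gl]]] by simp
  have V: "V h \<in> borel_measurable lebesgue" "integrable lebesgue (\<lambda>x. (V h x)\<^sup>2)" for h
    using L2_loc_indicator[OF Vl, of "R + 1" h] by (simp_all add: V_def[abs_def])
  define \<psi> where "\<psi> n = conv (\<rho> n) (\<lambda>y. \<eta> y * \<sigma> y)" for n
  have r1: "inverse (real (Suc n)) \<le> 1" for n by (simp add: field_simps)
  have \<psi>0: "\<psi> n x = 0" if "R + 1 < norm x" for n x
    unfolding \<psi>_def
    by (rule conv_eq_0_outside[of "inverse (real (Suc n))" _ R, OF mollifierD(3)[OF \<rho>] f0])
       (use r1[of n] that in linarith)+
  have t: "test_function (\<psi> n)" for n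
    unfolding test_function_iff
  proof (intro conjI allI exI impI)
    show "Ck k (\<psi> n)" for k unfolding \<psi>_def by (rule Ck_conv_mollifier[OF \<rho> fi])
  qed (rule \<psi>0)
  have g\<psi>: "grad (\<psi> n) x \<bullet> h = conv (\<rho> n) (W h) x" for n x h
    unfolding \<psi>_def W_def by (rule grad_conv_weak[OF \<sigma> G \<eta> \<rho> fi])
  have Wint: "integrable lebesgue (W h)" for h by (rule integrable_of_square[OF Wm Wi W0])
  have cm: "(\<lambda>x. conv (\<rho> n) (W h) x - W h x) \<in> borel_measurable lebesgue" for n h
    using continuous_imp_measurable(2)[OF Ck_imp_continuous[OF Ck_conv_mollifier[OF \<rho> Wint]]] Wm
    by simp
  have ci: "integrable lebesgue (\<lambda>x. V h x * (conv (\<rho> n) (W h) x - W h x))"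
    and cl: "(\<lambda>n. LINT x|lebesgue. V h x * (conv (\<rho> n) (W h) x - W h x)) \<longlonglongrightarrow> 0" for h n
  proof -
    note L2 = conv_tendsto_L2[of \<rho> "W h" R, OF \<rho> Wm Wi W0]
    show "integrable lebesgue (\<lambda>x. V h x * (conv (\<rho> n) (W h) x - W h x))"
      by (rule integrable_mult_L2[OF V cm L2(1)])
    show "(\<lambda>n. LINT x|lebesgue. V h x * (conv (\<rho> n) (W h) x - W h x)) \<longlonglongrightarrow> 0"
      by (rule integral_mult_tendsto_0[OF V cm L2])
  qed
  have VWi: "integrable lebesgue (\<lambda>x. V h x * W h x)" for h
    by (rule integrable_mult_L2[OF V Wm Wi])
  have sum0: "(\<Sum>b\<in>Basis. (LINT x|lebesgue. V b x * (conv (\<rho> n) (W b) x - W b x))) =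
      - (\<Sum>b\<in>Basis. (LINT x|lebesgue. V b x * W b x))" for n
  proof -
    have "(\<Sum>b\<in>Basis. (LINT x|lebesgue. V b x * (conv (\<rho> n) (W b) x - W b x))) +
        (\<Sum>b\<in>Basis. (LINT x|lebesgue. V b x * W b x)) =
        (LINT x|lebesgue. (\<Sum>b\<in>Basis. V b x * (conv (\<rho> n) (W b) x - W b x) + V b x * W b x))"
      using ci VWi by (simp add: sum.distrib)
    also have "\<dots> = (LINT x|lebesgue. (\<phi> x)\<^sup>2 * (G x \<bullet> grad (\<psi> n) x))"
    proof (rule Bochner_Integration.integral_cong[OF refl])
      fix x
      have "(\<Sum>b\<in>Basis. V b x * (conv (\<rho> n) (W b) x - W b x) + V b x * W b x) =
          (\<Sum>b\<in>Basis. V b x * (grad (\<psi> n) x \<bullet> b))"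
        by (simp add: g\<psi> algebra_simps)
      also have "\<dots> = (\<Sum>b\<in>Basis. (\<phi> x)\<^sup>2 * ((G x \<bullet> b) * (grad (\<psi> n) x \<bullet> b)))"
      proof (cases "R + 1 < norm x")
        case True
        then show ?thesis using grad_eq_0_outside[OF \<psi>0 True] by simp
      next
        case False
        then show ?thesis by (simp add: V_def power2_eq_square mult_ac)
      qed
      also have "\<dots> = (\<phi> x)\<^sup>2 * (G x \<bullet> grad (\<psi> n) x)"
        by (simp add: euclidean_inner[of "G x" "grad (\<psi> n) x"] sum_distrib_left)
      finally show "(\<Sum>b\<in>Basis. V b x * (conv (\<rho> n) (W b) x - W b x) + V b x * W b x) =
          (\<phi> x)\<^sup>2 * (G x \<bullet> grad (\<psi> n) x)" .
    qed
    also have "\<dots> = 0" using div t by (simp add: div_zero_def)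
    finally show ?thesis by linarith
  qed
  have "(\<lambda>n. \<Sum>b\<in>Basis. (LINT x|lebesgue. V b x * (conv (\<rho> n) (W b) x - W b x))) \<longlonglongrightarrow> (\<Sum>b\<in>(Basis::'a set). 0)"
    by (rule tendsto_sum) (rule cl)
  then have "(\<Sum>b\<in>Basis. (LINT x|lebesgue. V b x * W b x)) = 0"
    unfolding sum0 by (simp add: LIMSEQ_const_iff)
  then have "(LINT x|lebesgue. (\<Sum>b\<in>Basis. V b x * W b x)) = 0"
    using VWi by simp
  also have "(LINT x|lebesgue. (\<Sum>b\<in>Basis. V b x * W b x)) =
      (LINT x|lebesgue. \<eta> x * (\<phi> x)\<^sup>2 * (norm (G x))\<^sup>2 + (\<phi> x)\<^sup>2 * \<sigma> x * (G x \<bullet> grad \<eta> x))"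
  proof (rule Bochner_Integration.integral_cong[OF refl])
    fix x
    show "(\<Sum>b\<in>Basis. V b x * W b x) =
        \<eta> x * (\<phi> x)\<^sup>2 * (norm (G x))\<^sup>2 + (\<phi> x)\<^sup>2 * \<sigma> x * (G x \<bullet> grad \<eta> x)"
    proof (cases "R < norm x")
      case True
      then show ?thesis using grad_eq_0_outside[OF R True] R[OF True] by (simp add: W0)
    next
      case False
      then have "(\<Sum>b\<in>Basis. V b x * W b x) =
          (\<Sum>b\<in>Basis. \<eta> x * (\<phi> x)\<^sup>2 * ((G x \<bullet> b) * (G x \<bullet> b)) + (\<phi> x)\<^sup>2 * \<sigma> x * ((G x \<bullet> b) * (grad \<eta> x \<bullet> b)))"
        by (simp add: V_def W_def power2_eq_square algebra_simps)
      also have "\<dots> = \<eta> x * (\<phi> x)\<^sup>2 * (G x \<bullet> G x) + (\<phi> x)\<^sup>2 * \<sigma> x * (G x \<bullet> grad \<eta> x)"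
        by (simp add: euclidean_inner[of "G x" "G x"] euclidean_inner[of "G x" "grad \<eta> x"]
            sum_distrib_left sum.distrib)
      finally show ?thesis by (simp add: power2_norm_eq_inner)
    qed
  qed
  finally show "(LINT x|lebesgue. \<eta> x * (\<phi> x)\<^sup>2 * (norm (G x))\<^sup>2 +
      (\<phi> x)\<^sup>2 * \<sigma> x * (G x \<bullet> grad \<eta> x)) \<le> 0" by simp
qed


section \<open>The energy inequality\<close>

lemma norm_grad_conv_le:
  fixes \<eta> :: "'a::euclidean_space \<Rightarrow> real"
  assumes \<rho>: "mollifier r \<rho>" and \<eta>: "Ck (Suc 0) \<eta>" "\<And>x. R < norm x \<Longrightarrow> \<eta> x = 0"
    and L: "\<And>x. norm (grad \<eta> x) \<le> L"
  shows "norm (grad (conv \<rho> \<eta>) x) \<le> real DIM('a) * L"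
proof -
  have "\<bar>grad (conv \<rho> \<eta>) x \<bullet> b\<bar> \<le> L" if "b \<in> Basis" for b
  proof -
    have c: "continuous_on UNIV (\<lambda>z. grad \<eta> z \<bullet> b)"
      by (intro continuous_intros continuous_on_grad[OF \<eta>(1)])
    have z: "grad \<eta> z \<bullet> b = 0" if "R < norm z" for z
      using grad_eq_0_outside[OF \<eta>(2) that] by simp
    have le: "\<bar>grad \<eta> z \<bullet> b\<bar> \<le> L" for z
      using Basis_le_norm[OF that, of "grad \<eta> z"] L[of z] by linarith
    have eq: "grad (conv \<rho> \<eta>) x \<bullet> b = conv \<rho> (\<lambda>z. grad \<eta> z \<bullet> b) x"
      by (rule grad_conv_right[OF \<rho> \<eta>])
    show ?thesis
      unfolding eq
      by (rule conv_mollifier_bound[of r \<rho> _ R, OF \<rho> c z le])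
  qed
  then have "(\<Sum>b\<in>Basis. \<bar>grad (conv \<rho> \<eta>) x \<bullet> b\<bar>) \<le> (\<Sum>b\<in>(Basis::'a set). L)"
    by (rule sum_mono)
  then show ?thesis using norm_le_l1[of "grad (conv \<rho> \<eta>) x"] by simp
qed

text \<open>
  The cutoff functions used below are built from an antiderivative of \<open>1 / \<Psi>'\<close> and are therefore only
  continuously differentiable. They are admissible because their mollifications and the gradients of
  these converge boundedly.
\<close>

lemma sigma_div_nonneg_C1:
  fixes \<sigma> :: "'a::euclidean_space \<Rightarrow> real"
  assumes \<phi>: "Linf_loc \<phi>" and \<sigma>: "L2_loc \<sigma>" and G: "L2_loc G" and div: "sigma_div_nonneg \<phi> \<sigma> G"
    and \<eta>: "Ck (Suc 0) \<eta>" "\<And>x. R < norm x \<Longrightarrow> \<eta> x = 0" "\<And>x. 0 \<le> \<eta> x"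
  shows "(LINT x|lebesgue. \<eta> x * (\<phi> x)\<^sup>2 * (norm (G x))\<^sup>2 + (\<phi> x)\<^sup>2 * \<sigma> x * (G x \<bullet> grad \<eta> x)) \<le> 0"
proof -
  obtain \<rho> :: "nat \<Rightarrow> 'a \<Rightarrow> real" where \<rho>: "\<And>n. mollifier (inverse (real (Suc n))) (\<rho> n)"
    by (rule mollifier_sequence) blast
  note ec = Ck_imp_continuous[OF \<eta>(1)] and gc = continuous_on_grad[OF \<eta>(1)]
  have g0: "grad \<eta> x = 0" if "R < norm x" for x using grad_eq_0_outside[OF \<eta>(2) that] .
  obtain M where M: "\<And>x. norm (\<eta> x) \<le> M" "0 \<le> M"
    using bounded_if_compact_support[OF ec \<eta>(2)] by blast
  obtain L where L: "\<And>x. norm (grad \<eta> x) \<le> L" "0 \<le> L"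
    using bounded_if_compact_support[OF gc g0] by blast
  have ei: "integrable lebesgue \<eta>" using integrable_continuous_compact_support[OF ec \<eta>(2)] .
  define \<psi> where "\<psi> n = conv (\<rho> n) \<eta>" for n
  define E where "E \<zeta> x = \<zeta> x * (\<phi> x)\<^sup>2 * (norm (G x))\<^sup>2 + (\<phi> x)\<^sup>2 * \<sigma> x * (G x \<bullet> grad \<zeta> x)" for \<zeta> x
  have r1: "inverse (real (Suc n)) \<le> 1" for n by (simp add: field_simps)
  have \<psi>0: "\<psi> n x = 0" if "R + 1 < norm x" for n x
    unfolding \<psi>_def
    by (rule conv_eq_0_outside[of "inverse (real (Suc n))" _ R, OF mollifierD(3)[OF \<rho>] \<eta>(2)])
       (use r1[of n] that in linarith)+
  have \<psi>C: "Ck k (\<psi> n)" for k n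
    unfolding \<psi>_def by (rule Ck_conv_mollifier[OF \<rho> ei])
  have t: "test_function (\<psi> n)" for n
    unfolding test_function_iff
  proof (intro conjI allI exI impI)
    show "Ck k (\<psi> n)" for k by (rule \<psi>C)
  qed (rule \<psi>0)
  have \<psi>n: "0 \<le> \<psi> n x" for n x
    unfolding \<psi>_def conv_def using mollifierD(2)[OF \<rho>] \<eta>(3) by simp
  have le0: "(LINT x|lebesgue. E (\<psi> n) x) \<le> 0" for n
    using div t \<psi>n unfolding sigma_div_nonneg_def E_def by blast
  define D where "D = real DIM('a) * L"
  have g\<psi>: "norm (grad (\<psi> n) x) \<le> D" for n x
    unfolding \<psi>_def D_def by (rule norm_grad_conv_le[OF \<rho> \<eta>(1,2) L(1)])
  have b\<psi>: "\<bar>\<psi> n x\<bar> \<le> M" for n x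
    unfolding \<psi>_def using conv_mollifier_bound[of _ "\<rho> n" \<eta> R M x, OF \<rho> ec \<eta>(2)] M(1) by simp
  have l\<psi>: "(\<lambda>n. \<psi> n x) \<longlonglongrightarrow> \<eta> x" for x
    unfolding \<psi>_def by (rule conv_mollifier_tendsto[of \<rho> \<eta> R, OF \<rho> ec \<eta>(2)])
  have lg: "(\<lambda>n. G x \<bullet> grad (\<psi> n) x) \<longlonglongrightarrow> G x \<bullet> grad \<eta> x" for x
  proof -
    have eq: "grad (conv (\<rho> n) \<eta>) x \<bullet> G x = conv (\<rho> n) (\<lambda>z. grad \<eta> z \<bullet> G x) x" for n
      by (rule grad_conv_right[OF \<rho> \<eta>(1,2)])
    have "(\<lambda>n. grad (\<psi> n) x \<bullet> G x) \<longlonglongrightarrow> grad \<eta> x \<bullet> G x"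
      unfolding \<psi>_def eq
    proof (rule conv_mollifier_tendsto[of \<rho> "\<lambda>z. grad \<eta> z \<bullet> G x" R, OF \<rho>])
      show "continuous_on UNIV (\<lambda>z. grad \<eta> z \<bullet> G x)" by (intro continuous_intros gc)
    qed (simp add: g0)
    then show ?thesis by (simp add: inner_commute)
  qed
  have \<phi>m: "\<phi> \<in> borel_measurable lebesgue" using \<phi> by (simp add: Linf_loc_def)
  note \<sigma>m = L2_loc_measurable[OF \<sigma>] and Gm = L2_loc_measurable[OF G]
  have Em: "(\<lambda>x. E \<zeta> x) \<in> borel_measurable lebesgue" if "Ck (Suc 0) \<zeta>" for \<zeta>
    unfolding E_def
    using \<phi>m \<sigma>m Gm continuous_imp_measurable(2)[OF Ck_imp_continuous[OF that]]
      continuous_imp_measurable(2)[OF continuous_on_grad[OF that]]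
    by (intro borel_measurable_add borel_measurable_times borel_measurable_power
        borel_measurable_inner measurable_compose[OF Gm borel_measurable_norm])
  define A where "A x = M * (norm (\<phi> x *\<^sub>R G x))\<^sup>2 + D * (\<bar>\<phi> x * \<sigma> x\<bar> * norm (\<phi> x *\<^sub>R G x))" for x
  have Ai: "set_integrable lebesgue (cball 0 (R + 1)) A"
  proof -
    have U: "L2_loc (\<lambda>x. \<phi> x *\<^sub>R G x)" by (rule Linf_loc_mult_L2_loc[OF \<phi> G])
    have s: "L2_loc (\<lambda>x. \<phi> x * \<sigma> x)" using Linf_loc_mult_L2_loc[OF \<phi> \<sigma>] by simp
    have "set_integrable lebesgue (cball 0 (R + 1)) (\<lambda>x. \<bar>\<phi> x * \<sigma> x\<bar> * norm (\<phi> x *\<^sub>R G x))"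
    proof (rule L2_loc_mult_integrable[OF s U])
      show "(\<lambda>x. \<bar>\<phi> x * \<sigma> x\<bar> * norm (\<phi> x *\<^sub>R G x)) \<in> borel_measurable lebesgue"
        by (intro borel_measurable_times measurable_compose[OF L2_loc_measurable[OF U] borel_measurable_norm]
            borel_measurable_abs L2_loc_measurable[OF s] \<phi>m \<sigma>m)
    qed simp
    moreover note L2_loc_square_integrable[OF U, of "R + 1"]
    ultimately show ?thesis
      unfolding A_def[abs_def]
      by (intro set_integral_add set_integrable_mult_right)
  qed
  have bd: "\<bar>E (\<psi> n) x\<bar> \<le> indicator (cball 0 (R + 1)) x *\<^sub>R A x" for n x
  proof (cases "R + 1 < norm x")
    case True
    then show ?thesis using \<psi>0[OF True] grad_eq_0_outside[OF \<psi>0 True] by (simp add: E_def)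
  next
    case False
    have 1: "\<bar>\<psi> n x * (\<phi> x)\<^sup>2 * (norm (G x))\<^sup>2\<bar> \<le> M * (norm (\<phi> x *\<^sub>R G x))\<^sup>2"
      using mult_right_mono[OF b\<psi>[of n x], of "(norm (\<phi> x *\<^sub>R G x))\<^sup>2"]
      by (simp add: abs_mult power_mult_distrib mult.assoc)
    have "\<bar>G x \<bullet> grad (\<psi> n) x\<bar> \<le> norm (G x) * D"
      using Cauchy_Schwarz_ineq2[of "G x" "grad (\<psi> n) x"] mult_left_mono[OF g\<psi>[of n x] norm_ge_zero[of "G x"]]
      by linarith
    then have "\<bar>(\<phi> x)\<^sup>2 * \<sigma> x\<bar> * \<bar>G x \<bullet> grad (\<psi> n) x\<bar> \<le> \<bar>(\<phi> x)\<^sup>2 * \<sigma> x\<bar> * (norm (G x) * D)"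
      by (intro mult_left_mono) auto
    then have 2: "\<bar>(\<phi> x)\<^sup>2 * \<sigma> x * (G x \<bullet> grad (\<psi> n) x)\<bar> \<le> D * (\<bar>\<phi> x * \<sigma> x\<bar> * norm (\<phi> x *\<^sub>R G x))"
      by (simp add: abs_mult power2_eq_square mult_ac)
    from 1 2 have "\<bar>E (\<psi> n) x\<bar> \<le> A x" unfolding E_def A_def by linarith
    then show ?thesis using False by simp
  qed
  have "(\<lambda>n. LINT x|lebesgue. E (\<psi> n) x) \<longlonglongrightarrow> (LINT x|lebesgue. E \<eta> x)"
  proof (rule integral_dominated_convergence)
    show "integrable lebesgue (\<lambda>x. indicator (cball 0 (R + 1)) x *\<^sub>R A x)"
      using Ai by (simp add: set_integrable_def)
    show "AE x in lebesgue. (\<lambda>n. E (\<psi> n) x) \<longlonglongrightarrow> E \<eta> x"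
      unfolding E_def by (intro AE_I2 tendsto_intros l\<psi> lg)
    show "AE x in lebesgue. norm (E (\<psi> n) x) \<le> indicator (cball 0 (R + 1)) x *\<^sub>R A x" for n
      using bd by simp
  qed (rule Em[OF \<eta>(1)], rule Em[OF \<psi>C])
  from LIMSEQ_le_const2[OF this] le0 have "(LINT x|lebesgue. E \<eta> x) \<le> 0" by blast
  then show ?thesis by (simp add: E_def)
qed

text \<open>
  Testing with \<open>\<eta>\<^sup>2\<close> produces the cross term \<open>2 \<eta> \<sigma> \<phi>\<^sup>2 G \<bullet> grad \<eta>\<close>. By Young's inequality it is at most
  half of the energy density \<open>P\<close> plus twice the density \<open>Q\<close> of the right-hand side; absorbing the former
  leaves the factor 4.
\<close>

lemma Caccioppoli:
  fixes \<sigma> :: "'a::euclidean_space \<Rightarrow> real"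
  assumes \<phi>: "Linf_loc \<phi>" and \<sigma>: "L2_loc \<sigma>" and G: "L2_loc G" and div: "sigma_div_nonneg \<phi> \<sigma> G"
    and \<eta>: "Ck (Suc 0) \<eta>" "\<And>x. R < norm x \<Longrightarrow> \<eta> x = 0"
  shows "integrable lebesgue (\<lambda>x. (\<eta> x)\<^sup>2 * (norm (\<phi> x *\<^sub>R G x))\<^sup>2)"
    and "integrable lebesgue (\<lambda>x. (\<phi> x * \<sigma> x)\<^sup>2 * (norm (grad \<eta> x))\<^sup>2)"
    and "(LINT x|lebesgue. (\<eta> x)\<^sup>2 * (norm (\<phi> x *\<^sub>R G x))\<^sup>2) \<le>
      4 * (LINT x|lebesgue. (\<phi> x * \<sigma> x)\<^sup>2 * (norm (grad \<eta> x))\<^sup>2)"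
proof -
  note ec = Ck_imp_continuous[OF \<eta>(1)] and gc = continuous_on_grad[OF \<eta>(1)]
  have g0: "grad \<eta> x = 0" if "R < norm x" for x using grad_eq_0_outside[OF \<eta>(2) that] .
  obtain M where M: "\<And>x. norm (\<eta> x) \<le> M" "0 \<le> M"
    using bounded_if_compact_support[OF ec \<eta>(2)] by blast
  obtain L where L: "\<And>x. norm (grad \<eta> x) \<le> L" "0 \<le> L"
    using bounded_if_compact_support[OF gc g0] by blast
  have U: "L2_loc (\<lambda>x. \<phi> x *\<^sub>R G x)" by (rule Linf_loc_mult_L2_loc[OF \<phi> G])
  have s: "L2_loc (\<lambda>x. \<phi> x * \<sigma> x)" using Linf_loc_mult_L2_loc[OF \<phi> \<sigma>] by simp
  define P where "P x = (\<eta> x)\<^sup>2 * (norm (\<phi> x *\<^sub>R G x))\<^sup>2" for x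
  define Q where "Q x = (\<phi> x * \<sigma> x)\<^sup>2 * (norm (grad \<eta> x))\<^sup>2" for x
  have Pi: "integrable lebesgue P"
  proof (rule integrable_of_bound_local[OF _ L2_loc_square_integrable[OF U, of R]])
    show "P \<in> borel_measurable lebesgue"
      unfolding P_def[abs_def]
      by (intro borel_measurable_times borel_measurable_power continuous_imp_measurable(2)[OF ec]
          measurable_compose[OF L2_loc_measurable[OF U] borel_measurable_norm])
    show "norm (P x) \<le> M\<^sup>2 * norm ((norm (\<phi> x *\<^sub>R G x))\<^sup>2)" for x
      using M(1)[of x] M(2) by (auto simp: P_def abs_mult abs_le_square_iff[symmetric] intro!: mult_right_mono)
    show "P x = 0" if "R < norm x" for x using \<eta>(2)[OF that] by (simp add: P_def)
  qed
  have Qi: "integrable lebesgue Q"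
  proof (rule integrable_of_bound_local[OF _ L2_loc_square_integrable[OF s, of R]])
    show "Q \<in> borel_measurable lebesgue"
      unfolding Q_def[abs_def]
      by (intro borel_measurable_times borel_measurable_power L2_loc_measurable[OF s]
          measurable_compose[OF continuous_imp_measurable(2)[OF gc] borel_measurable_norm])
        (use \<phi> L2_loc_measurable[OF \<sigma>] in \<open>simp_all add: Linf_loc_def\<close>)
    show "norm (Q x) \<le> L\<^sup>2 * norm ((norm (\<phi> x * \<sigma> x))\<^sup>2)" for x
    proof -
      have "(norm (grad \<eta> x))\<^sup>2 \<le> L\<^sup>2" using L(1)[of x] by (intro power_mono) auto
      from mult_left_mono[OF this, of "(\<phi> x * \<sigma> x)\<^sup>2"] show ?thesis by (simp add: Q_def mult.commute)
    qed
    show "Q x = 0" if "R < norm x" for x using g0[OF that] by (simp add: Q_def)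
  qed
  show "integrable lebesgue (\<lambda>x. (\<eta> x)\<^sup>2 * (norm (\<phi> x *\<^sub>R G x))\<^sup>2)"
    "integrable lebesgue (\<lambda>x. (\<phi> x * \<sigma> x)\<^sup>2 * (norm (grad \<eta> x))\<^sup>2)"
    using Pi Qi by (simp_all add: P_def[abs_def] Q_def[abs_def])
  define E where "E x = (\<eta> x * \<eta> x) * (\<phi> x)\<^sup>2 * (norm (G x))\<^sup>2 +
      (\<phi> x)\<^sup>2 * \<sigma> x * (G x \<bullet> grad (\<lambda>x. \<eta> x * \<eta> x) x)" for x
  have E0: "(LINT x|lebesgue. E x) \<le> 0"
    unfolding E_def
    by (rule sigma_div_nonneg_C1[OF \<phi> \<sigma> G div Ck_mult[OF \<eta>(1) \<eta>(1)], of R]) (simp_all add: \<eta>(2))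
  have EP: "E x = P x + 2 * (\<eta> x * (\<phi> x * \<sigma> x) * ((\<phi> x *\<^sub>R G x) \<bullet> grad \<eta> x))" for x
    unfolding E_def grad_mult[OF \<eta>(1) \<eta>(1)]
    by (simp add: P_def inner_add_right power2_eq_square algebra_simps)
  have cross: "\<bar>2 * (\<eta> x * (\<phi> x * \<sigma> x) * ((\<phi> x *\<^sub>R G x) \<bullet> grad \<eta> x))\<bar> \<le> P x / 2 + 2 * Q x" for x
  proof -
    define a where "a = \<bar>\<eta> x\<bar> * norm (\<phi> x *\<^sub>R G x)"
    define b where "b = \<bar>\<phi> x * \<sigma> x\<bar> * norm (grad \<eta> x)"
    have "\<bar>(\<phi> x *\<^sub>R G x) \<bullet> grad \<eta> x\<bar> \<le> norm (\<phi> x *\<^sub>R G x) * norm (grad \<eta> x)"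
      by (rule Cauchy_Schwarz_ineq2)
    then have "\<bar>\<eta> x * (\<phi> x * \<sigma> x)\<bar> * \<bar>(\<phi> x *\<^sub>R G x) \<bullet> grad \<eta> x\<bar> \<le>
        \<bar>\<eta> x * (\<phi> x * \<sigma> x)\<bar> * (norm (\<phi> x *\<^sub>R G x) * norm (grad \<eta> x))"
      by (intro mult_left_mono) auto
    also have "\<dots> = a * b" by (simp add: a_def b_def abs_mult mult_ac)
    also have "2 * (a * b) \<le> a\<^sup>2 / 2 + 2 * b\<^sup>2"
      using zero_le_power2[of "a - 2 * b"] by (simp add: power2_eq_square algebra_simps)
    finally have "2 * (\<bar>\<eta> x * (\<phi> x * \<sigma> x)\<bar> * \<bar>(\<phi> x *\<^sub>R G x) \<bullet> grad \<eta> x\<bar>) \<le> a\<^sup>2 / 2 + 2 * b\<^sup>2" by simp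
    moreover have "a\<^sup>2 = P x" "b\<^sup>2 = Q x" by (simp_all only: a_def b_def P_def Q_def power_mult_distrib power2_abs)
    ultimately show ?thesis by (simp only: abs_mult abs_numeral)
  qed
  have "integrable lebesgue (\<lambda>x. 2 * P x + 2 * Q x)" using Pi Qi by simp
  moreover have "E \<in> borel_measurable lebesgue"
    unfolding EP[abs_def]
    using borel_measurable_integrable[OF Pi] continuous_imp_measurable(2)[OF ec] continuous_imp_measurable(2)[OF gc]
      L2_loc_measurable[OF \<sigma>] \<phi>[unfolded Linf_loc_def, THEN conjunct1] L2_loc_measurable[OF U]
    by (intro borel_measurable_add borel_measurable_times borel_measurable_inner borel_measurable_const)
  moreover have "AE x in lebesgue. norm (E x) \<le> norm (2 * P x + 2 * Q x)"
  proof (rule AE_I2)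
    fix x
    have "0 \<le> P x" "0 \<le> Q x" by (simp_all add: P_def Q_def)
    then show "norm (E x) \<le> norm (2 * P x + 2 * Q x)" using cross[of x] unfolding EP real_norm_def by linarith
  qed
  ultimately have Ei: "integrable lebesgue E" by (rule Bochner_Integration.integrable_bound)
  have "(LINT x|lebesgue. P x / 2 - 2 * Q x) \<le> (LINT x|lebesgue. E x)"
  proof (rule integral_mono)
    show "P x / 2 - 2 * Q x \<le> E x" for x using cross[of x] unfolding EP by linarith
  qed (use Pi Qi Ei in simp_all)
  then have "(LINT x|lebesgue. P x) / 2 - 2 * (LINT x|lebesgue. Q x) \<le> 0"
    using Pi Qi E0 by simp
  then show "(LINT x|lebesgue. (\<eta> x)\<^sup>2 * (norm (\<phi> x *\<^sub>R G x))\<^sup>2) \<le>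
      4 * (LINT x|lebesgue. (\<phi> x * \<sigma> x)\<^sup>2 * (norm (grad \<eta> x))\<^sup>2)"
    by (simp add: P_def Q_def)
qed

section \<open>Weighted mass of balls\<close>

text \<open>
  If the mass of every ball is at most that of the measure with an atom of size \<open>F a\<close> and radial density
  \<open>d = F'\<close>, then the same comparison holds for integrals of a decreasing radial weight \<open>q\<close>: write
  \<open>q\<close> as the integral of the indicator functions of its superlevel sets, which are balls.
  On the left the level \<open>t\<close> runs over \<open>[0, q)\<close>, on the right over \<open>[0, q]\<close>. The lengths agree,
  and with this choice the comparison of levels stays correct where \<open>q\<close> has a plateau.
\<close>

lemma ball_weight_bound:
  fixes w :: "'a::euclidean_space \<Rightarrow> ennreal" and q d F :: "real \<Rightarrow> real"
  assumes w[measurable]: "w \<in> borel_measurable borel"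
    and mass: "\<And>R. a \<le> R \<Longrightarrow> (\<integral>\<^sup>+x. w x * indicator (ball 0 R) x \<partial>lborel) \<le> ennreal (F R)"
    and q: "continuous_on UNIV q" "\<And>r s. r \<le> s \<Longrightarrow> q s \<le> q r" "\<And>r. 0 \<le> q r" "\<And>r. q r \<le> q a"
    and d: "continuous_on UNIV d" "\<And>r. 0 \<le> d r"
    and F: "\<And>r. a \<le> r \<Longrightarrow> (F has_real_derivative d r) (at r)" "0 \<le> F a"
    and R: "a \<le> b"
  shows "(\<integral>\<^sup>+x. w x * indicator (ball 0 b) x * ennreal (q (norm x)) \<partial>lborel) \<le>
    ennreal (F a) * ennreal (q a) + (\<integral>\<^sup>+r. ennreal (d r * q r) * indicator {a..b} r \<partial>lborel)"
proof -
  have qm[measurable]: "q \<in> borel_measurable borel" and dm[measurable]: "d \<in> borel_measurable borel"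
    using q(1) d(1) by (auto intro: borel_measurable_continuous_onI)
  have len: "(\<integral>\<^sup>+t. indicator {0..<c} t \<partial>lborel) = ennreal c" "(\<integral>\<^sup>+t. indicator {0..c} t \<partial>lborel) = ennreal c"
    if "0 \<le> c" for c :: real using that by simp_all
  have FTC: "(\<integral>\<^sup>+r. ennreal (d r) * indicator {a..s} r \<partial>lborel) = ennreal (F s - F a)"
    if "a \<le> s" for s
    using that F(1) d(2) by (intro nn_integral_FTC_Icc) auto
  have Fmono: "F a \<le> F s" if "a \<le> s" for s
  proof (rule DERIV_nonneg_imp_nondecreasing[OF that])
    fix x assume "a \<le> x"
    then show "\<exists>y. (F has_real_derivative y) (at x) \<and> 0 \<le> y" using F(1) d(2) by blast
  qed
  have FR: "ennreal (F s) = ennreal (F a) + (\<integral>\<^sup>+r. ennreal (d r) * indicator {a..s} r \<partial>lborel)"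
    if "a \<le> s" for s
    unfolding FTC[OF that] using Fmono[OF that] F(2) by (simp flip: ennreal_plus)
  have level: "(\<integral>\<^sup>+x. w x * indicator (ball 0 b) x * indicator {0..<q (norm x)} t \<partial>lborel) \<le>
      ennreal (F a) * indicator {0..<q a} t +
      (\<integral>\<^sup>+r. ennreal (d r) * indicator {a..b} r * indicator {0..q r} t \<partial>lborel)" for t
  proof (cases "0 \<le> t \<and> t < q a")
    case False
    then have "indicator {0..<q (norm x)} t = (0::ennreal)" for x :: 'a
      using q(4)[of "norm x"] by (auto simp: indicator_def)
    then show ?thesis by simp
  next
    case True
    obtain s where s: "a \<le> s" "s \<le> b" "\<And>r. r \<le> s \<Longrightarrow> t \<le> q r"
      "\<And>r. t < q r \<Longrightarrow> r < b \<Longrightarrow> r < s"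
    proof (cases "t < q b")
      case True
      then show ?thesis using that[of b] R q(2) by fastforce
    next
      case False
      then obtain s where "a \<le> s" "s \<le> b" "q s = t"
        using IVT2'[of q b t a] True R continuous_on_subset[OF q(1)] by auto
      then show ?thesis using that[of s] q(2) by (metis linorder_not_le)
    qed
    have "(\<integral>\<^sup>+x. w x * indicator (ball 0 b) x * indicator {0..<q (norm x)} t \<partial>lborel) \<le>
        (\<integral>\<^sup>+x. w x * indicator (ball 0 s) x \<partial>lborel)"
      by (rule nn_integral_mono) (use s(4) in \<open>auto simp: indicator_def\<close>)
    also have "\<dots> \<le> ennreal (F s)" by (rule mass[OF s(1)])
    also have "\<dots> = ennreal (F a) + (\<integral>\<^sup>+r. ennreal (d r) * indicator {a..s} r \<partial>lborel)"
      by (rule FR[OF s(1)])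
    also have "\<dots> \<le> ennreal (F a) * indicator {0..<q a} t +
      (\<integral>\<^sup>+r. ennreal (d r) * indicator {a..b} r * indicator {0..q r} t \<partial>lborel)"
    proof (rule add_mono)
      show "ennreal (F a) \<le> ennreal (F a) * indicator {0..<q a} t" using True by simp
      show "(\<integral>\<^sup>+r. ennreal (d r) * indicator {a..s} r \<partial>lborel) \<le>
          (\<integral>\<^sup>+r. ennreal (d r) * indicator {a..b} r * indicator {0..q r} t \<partial>lborel)"
        by (rule nn_integral_mono) (use s(2,3) True in \<open>auto simp: indicator_def\<close>)
    qed
    finally show ?thesis .
  qed
  have "(\<integral>\<^sup>+x. w x * indicator (ball 0 b) x * ennreal (q (norm x)) \<partial>lborel) =
      (\<integral>\<^sup>+x. \<integral>\<^sup>+t. w x * indicator (ball 0 b) x * indicator {0..<q (norm x)} t \<partial>lborel \<partial>lborel)"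
    by (rule nn_integral_cong, subst nn_integral_cmult) (simp_all add: len q(3))
  also have "\<dots> = (\<integral>\<^sup>+t. \<integral>\<^sup>+x. w x * indicator (ball 0 b) x * indicator {0..<q (norm x)} t \<partial>lborel \<partial>lborel)"
    by (rule lborel_pair.Fubini'[symmetric]) (simp add: indicator_def)
  also have "\<dots> \<le> (\<integral>\<^sup>+t. ennreal (F a) * indicator {0..<q a} t +
      (\<integral>\<^sup>+r. ennreal (d r) * indicator {a..b} r * indicator {0..q r} t \<partial>lborel) \<partial>lborel)"
    by (rule nn_integral_mono) (rule level)
  also have "\<dots> = (\<integral>\<^sup>+t. ennreal (F a) * indicator {0..<q a} t \<partial>lborel) +
      (\<integral>\<^sup>+t. \<integral>\<^sup>+r. ennreal (d r) * indicator {a..b} r * indicator {0..q r} t \<partial>lborel \<partial>lborel)"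
    by (rule nn_integral_add) (simp_all add: indicator_def)
  also have "(\<integral>\<^sup>+t. ennreal (F a) * indicator {0..<q a} t \<partial>lborel) = ennreal (F a) * ennreal (q a)"
    by (subst nn_integral_cmult) (simp_all add: len q(3))
  also have "(\<integral>\<^sup>+t. \<integral>\<^sup>+r. ennreal (d r) * indicator {a..b} r * indicator {0..q r} t \<partial>lborel \<partial>lborel) =
      (\<integral>\<^sup>+r. \<integral>\<^sup>+t. ennreal (d r) * indicator {a..b} r * indicator {0..q r} t \<partial>lborel \<partial>lborel)"
    by (rule lborel_pair.Fubini') (simp add: indicator_def)
  also have "\<dots> = (\<integral>\<^sup>+r. ennreal (d r * q r) * indicator {a..b} r \<partial>lborel)"
    by (rule nn_integral_cong, subst nn_integral_cmult)
       (simp_all add: len q(3) d(2) ennreal_mult mult_ac)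
  finally show ?thesis .
qed

text \<open>
  The profile is constant near 0, which removes the singularity of the norm there.
\<close>

lemma radial_C1:
  fixes k k' :: "real \<Rightarrow> real"
  assumes k: "\<And>r. (k has_real_derivative k' r) (at r)" "continuous_on UNIV k'"
    and a: "0 < a" "\<And>r. r \<le> a \<Longrightarrow> k r = c" "\<And>r. r \<le> a \<Longrightarrow> k' r = 0"
  shows "Ck (Suc 0) (\<lambda>x::'a::euclidean_space. k (norm x))"
    and "norm (grad (\<lambda>x::'a. k (norm x)) x) \<le> \<bar>k' (norm x)\<bar>"
proof -
  define D where "D x = (k' (norm x) / max a (norm x)) *\<^sub>R x" for x :: 'a
  have der: "((\<lambda>x::'a. k (norm x)) has_derivative (\<lambda>h. D x \<bullet> h)) (at x)" for x
  proof (cases "norm x < a")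
    case True
    have "((\<lambda>x::'a. c) has_derivative (\<lambda>h. 0)) (at x)" by simp
    then have "((\<lambda>x::'a. k (norm x)) has_derivative (\<lambda>h. 0)) (at x)"
      by (rule has_derivative_transform_within_open[of _ _ _ _ "ball 0 a"]) (use True a(2) in auto)
    moreover have "D x = 0" using True a(3) by (simp add: D_def)
    ultimately show ?thesis by simp
  next
    case False
    then have x: "x \<noteq> 0" using a(1) by auto
    have "((\<lambda>x::'a. k (norm x)) has_derivative (\<lambda>h. k' (norm x) * (sgn x \<bullet> h))) (at x)"
      using has_derivative_compose[OF has_derivative_norm[OF x]
          k(1)[of "norm x", unfolded has_field_derivative_def]] by (simp add: inner_commute)
    moreover have "D x \<bullet> h = k' (norm x) * (sgn x \<bullet> h)" for h
      using False by (simp add: D_def sgn_div_norm max_def field_simps)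
    ultimately show ?thesis by simp
  qed
  have "continuous_on UNIV (\<lambda>x::'a. k' (norm x))"
    by (rule continuous_on_compose2[OF k(2)]) (auto intro!: continuous_intros)
  then have cont: "continuous_on UNIV D"
    unfolding D_def[abs_def] using a(1) by (intro continuous_intros) auto
  show "Ck (Suc 0) (\<lambda>x::'a. k (norm x))" using C1I(1)[OF der cont] by simp
  have m: "0 < max a (norm x)" using a(1) by (simp add: less_max_iff_disj)
  have "norm (D x) = \<bar>k' (norm x)\<bar> * (norm x / max a (norm x))"
    using m by (simp add: D_def abs_divide)
  also have "norm x / max a (norm x) \<le> 1" using m by (simp add: divide_le_eq)
  then have "\<bar>k' (norm x)\<bar> * (norm x / max a (norm x)) \<le> \<bar>k' (norm x)\<bar> * 1"
    by (intro mult_left_mono) auto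
  finally show "norm (grad (\<lambda>x::'a. k (norm x)) x) \<le> \<bar>k' (norm x)\<bar>"
    unfolding C1I(2)[OF der cont] by simp
qed


section \<open>Divergence of the integral implies the Liouville property\<close>

text \<open>
  Continuously differentiable cutoff profiles are composed from this function, which is flat for \<open>t \<le> 0\<close>.
\<close>

lemma square_positive_part_deriv:
  "((\<lambda>t::real. (max 0 t)\<^sup>2) has_real_derivative 2 * max 0 t) (at t)"
proof -
  consider "t < 0" | "t = 0" | "0 < t" by linarith
  then show ?thesis
  proof cases
    case 1
    have "((\<lambda>_. 0::real) has_real_derivative 0) (at t)" by simp
    then have "((\<lambda>t::real. (max 0 t)\<^sup>2) has_real_derivative 0) (at t)"
      by (rule has_field_derivative_transform_within_open[of _ _ _ "{..<0}"]) (use 1 in auto)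
    then show ?thesis using 1 by simp
  next
    case 2
    have "((\<lambda>h::real. ((max 0 (0 + h))\<^sup>2 - (max 0 0)\<^sup>2) / h) \<longlongrightarrow> 0) (at 0)"
    proof (rule Lim_null_comparison)
      show "((\<lambda>h::real. \<bar>h\<bar>) \<longlongrightarrow> 0) (at 0)" using tendsto_rabs_zero[OF tendsto_ident_at[of 0]] by simp
      have "norm (((max 0 (0 + h))\<^sup>2 - (max 0 0)\<^sup>2) / h) \<le> \<bar>h\<bar>" for h :: real
        by (auto simp: max_def power2_eq_square)
      then show "\<forall>\<^sub>F h in at 0. norm (((max 0 (0 + h))\<^sup>2 - (max 0 0)\<^sup>2) / h) \<le> \<bar>h::real\<bar>" by simp
    qed
    then show ?thesis using 2 by (simp add: DERIV_def)
  next
    case 3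
    have "((\<lambda>t. t\<^sup>2) has_real_derivative 2 * t) (at t)" by (auto intro!: derivative_eq_intros)
    then have "((\<lambda>t::real. (max 0 t)\<^sup>2) has_real_derivative 2 * t) (at t)"
      by (rule has_field_derivative_transform_within_open[of _ _ _ "{0<..}"]) (use 3 in auto)
    then show ?thesis using 3 by simp
  qed
qed

lemma antiderivative_strict_mono:
  fixes F f :: "real \<Rightarrow> real"
  assumes "\<And>x. (F has_real_derivative f x) (at x)" "\<And>x. 0 < f x"
  shows "strict_mono F"
  by (rule strict_monoI, rule DERIV_pos_imp_increasing) (use assms in blast)+

lemma deriv_at_interior:
  fixes \<Psi> \<Psi>' :: "real \<Rightarrow> real"
  assumes "\<And>R. R \<ge> 1 \<Longrightarrow> (\<Psi> has_real_derivative \<Psi>' R) (at R within {1..})" "1 < r"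
  shows "(\<Psi> has_real_derivative \<Psi>' r) (at r)"
  using assms(1)[of r] assms(2) at_within_interior[of r "{1..}"] by (simp add: interior_Ici[of 0])

lemma global_antiderivative:
  fixes f :: "real \<Rightarrow> real"
  assumes "continuous_on UNIV f"
  obtains F where "\<And>x. (F has_real_derivative f x) (at x)" "F a = 0"
proof -
  have "\<exists>F. \<forall>x. -\<infinity> < ereal x \<longrightarrow> ereal x < \<infinity> \<longrightarrow> (F has_vector_derivative f x) (at x)"
    by (rule einterval_antiderivative) (use assms in \<open>auto simp: continuous_on_eq_continuous_at\<close>)
  then obtain F where F: "\<And>x. (F has_real_derivative f x) (at x)"
    by (auto simp: has_real_derivative_iff_has_vector_derivative)
  have "((\<lambda>x. F x - F a) has_real_derivative f x) (at x)" for x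
    using DERIV_diff[OF F DERIV_const[of "F a"]] by simp
  then show ?thesis using that[of "\<lambda>x. F x - F a"] by simp
qed

lemma L2_loc_integrable_ball:
  assumes "L2_loc f"
  shows "integrable lebesgue (\<lambda>x. indicator (ball 0 R) x * (norm (f x))\<^sup>2)"
  using set_integrable_subset[OF L2_loc_square_integrable[OF assms, of R], of "ball 0 R"]
  by (simp add: set_integrable_def)

lemma L2_mass_ball:
  fixes s :: "'a::euclidean_space \<Rightarrow> real"
  assumes "L2_loc s"
  shows "(\<integral>\<^sup>+x. ennreal ((s x)\<^sup>2) * indicator (ball 0 R) x \<partial>lebesgue) =
    ennreal (LINT x:ball 0 R|lebesgue. (s x)\<^sup>2)"
proof -
  have i: "integrable lebesgue (\<lambda>x. indicator (ball 0 R) x * (s x)\<^sup>2)"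
    using L2_loc_integrable_ball[OF assms] by simp
  have "(\<integral>\<^sup>+x. ennreal ((s x)\<^sup>2) * indicator (ball 0 R) x \<partial>lebesgue) =
      (\<integral>\<^sup>+x. ennreal (indicator (ball 0 R) x * (s x)\<^sup>2) \<partial>lebesgue)"
    by (rule nn_integral_cong) (simp add: indicator_def)
  also have "\<dots> = ennreal (LINT x|lebesgue. indicator (ball 0 R) x * (s x)\<^sup>2)"
    by (rule nn_integral_eq_integral[OF i]) simp
  finally show ?thesis by (simp add: set_lebesgue_integral_def)
qed

text \<open>
  In terms of \<open>m t = (max 0 t)\<^sup>2\<close> the cutoff is \<open>\<eta> x = m (1 - m (P |x| / T))\<close> with \<open>T = P b\<close>. It equals 1
  where \<open>P \<le> 0\<close>, that is, on the ball of radius \<open>a\<close>; it vanishes where \<open>P \<ge> T\<close>; and its slope is at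
  most \<open>4 / (T d)\<close>. The factor 64 is the 4 of the Caccioppoli inequality times the square of this 4.
\<close>

lemma energy_estimate:
  fixes \<sigma> :: "'a::euclidean_space \<Rightarrow> real" and d P :: "real \<Rightarrow> real"
  assumes \<phi>: "Linf_loc \<phi>" and \<sigma>: "L2_loc \<sigma>" and G: "L2_loc G" and div: "sigma_div_nonneg \<phi> \<sigma> G"
    and growth: "growth_bound \<Psi> \<phi> \<sigma>"
    and aR: "1 \<le> a" and ab: "a < b"
    and d: "continuous_on UNIV d" "\<And>r. 0 < d r" "\<And>r s. r \<le> s \<Longrightarrow> d r \<le> d s" "\<And>r. d a \<le> d r"
    and \<Psi>: "\<And>r. a \<le> r \<Longrightarrow> (\<Psi> has_real_derivative d r) (at r)" "0 \<le> \<Psi> a"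
    and P: "\<And>r. (P has_real_derivative inverse (d r)) (at r)" "P a = 0"
  shows "0 < P b"
    "(LINT x|lebesgue. indicator (ball 0 a) x * (norm (\<phi> x *\<^sub>R G x))\<^sup>2) \<le>
      64 / (P b)\<^sup>2 * (\<Psi> a * (inverse (d a))\<^sup>2 + P b)"
proof -
  define T where "T = P b"
  have Psm: "strict_mono P"
    by (rule antiderivative_strict_mono[OF P(1)]) (simp add: d(2))
  have Ple: "P r \<le> P s" if "r \<le> s" for r s using Psm that by (simp add: strict_mono_less_eq)
  show T: "0 < P b" using strict_monoD[OF Psm ab] P(2) by simp
  define m where "m t = (max 0 t)\<^sup>2" for t :: real
  have md: "(m has_real_derivative 2 * max 0 t) (at t)" for t
    unfolding m_def[abs_def] by (rule square_positive_part_deriv)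
  have Pc: "continuous_on UNIV P"
    using P(1) by (intro continuous_at_imp_continuous_on) (auto intro: DERIV_isCont)
  define k where "k r = m (1 - m (P r / T))" for r
  define k' where "k' r = 2 * max 0 (1 - m (P r / T)) * (- (2 * max 0 (P r / T) * (inverse (d r) / T)))" for r
  have kd: "(k has_real_derivative k' r) (at r)" for r
  proof -
    have "((\<lambda>r. P r / T) has_real_derivative inverse (d r) / T) (at r)"
      by (rule DERIV_cdivide[OF P(1)])
    then have "((\<lambda>r. m (P r / T)) has_real_derivative 2 * max 0 (P r / T) * (inverse (d r) / T)) (at r)"
      by (rule DERIV_chain2[OF md])
    from DERIV_diff[OF DERIV_const[of 1] this]
    have "((\<lambda>r. 1 - m (P r / T)) has_real_derivative - (2 * max 0 (P r / T) * (inverse (d r) / T))) (at r)"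
      by simp
    then show ?thesis unfolding k_def[abs_def] k'_def by (rule DERIV_chain2[OF md])
  qed
  have k'c: "continuous_on UNIV k'"
    unfolding k'_def[abs_def] m_def
    using d(1,2) Pc T by (intro continuous_intros) (auto simp: T_def less_imp_neq[symmetric])
  have T0: "0 < T" using T by (simp add: T_def)
  have inner: "k r = 1" "k' r = 0" if "r \<le> a" for r
  proof -
    have "P r / T \<le> 0" using Ple[OF that] P(2) T0 by (simp add: divide_le_0_iff)
    then have "max 0 (P r / T) = 0" by simp
    then show "k r = 1" "k' r = 0" by (simp_all add: k_def k'_def m_def)
  qed
  have outer: "k r = 0" "k' r = 0" if "b \<le> r" for r
  proof -
    have "1 \<le> P r / T" using Ple[OF that] T0 by (simp add: T_def)
    then have "1 \<le> m (P r / T)" by (simp add: m_def one_le_power)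
    then have "max 0 (1 - m (P r / T)) = 0" by simp
    then show "k r = 0" "k' r = 0" by (simp_all add: k_def k'_def m_def)
  qed
  have k'b: "\<bar>k' r\<bar> \<le> 4 / T * inverse (d r)" for r
  proof (cases "b \<le> r")
    case True
    then show ?thesis using outer T0 d(2)[of r] by simp
  next
    case False
    have "P r / T \<le> 1" using Ple[of r b] False T0 by (simp add: T_def)
    then have "max 0 (P r / T) \<le> 1" by simp
    moreover have "max 0 (1 - m (P r / T)) \<le> 1" by (simp add: m_def)
    ultimately have "max 0 (1 - m (P r / T)) * max 0 (P r / T) \<le> 1 * 1" by (intro mult_mono) auto
    moreover have "0 \<le> inverse (d r) / T" using d(2)[of r] T0 by simp
    ultimately have "4 * (max 0 (1 - m (P r / T)) * max 0 (P r / T)) * (inverse (d r) / T) \<le> 4 * 1 * (inverse (d r) / T)"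
      by (intro mult_right_mono mult_left_mono) auto
    moreover have "\<bar>k' r\<bar> = 4 * (max 0 (1 - m (P r / T)) * max 0 (P r / T)) * (inverse (d r) / T)"
      using d(2)[of r] T0 by (simp add: k'_def abs_mult)
    ultimately show ?thesis by (simp add: divide_inverse mult_ac)
  qed
  define \<eta> where "\<eta> x = k (norm x)" for x :: 'a
  have a0: "0 < a" using aR by simp
  have \<eta>C: "Ck (Suc 0) \<eta>"
    unfolding \<eta>_def[abs_def] by (rule radial_C1(1)[OF kd k'c a0 inner])
  have \<eta>g: "norm (grad \<eta> x) \<le> \<bar>k' (norm x)\<bar>" for x
    unfolding \<eta>_def[abs_def] by (rule radial_C1(2)[OF kd k'c a0 inner])
  have \<eta>0: "\<eta> x = 0" if "b < norm x" for x using outer(1)[of "norm x"] that by (simp add: \<eta>_def)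
  note C = Caccioppoli[of \<phi> \<sigma> G \<eta> b, OF \<phi> \<sigma> G div \<eta>C \<eta>0]
  \<comment> \<open>This weight times \<open>16 / T\<^sup>2\<close> dominates the square of the slope, and its product
    with \<open>d\<close> is again \<open>1 / d\<close>, whose integral over \<open>[a, b]\<close> is \<open>T\<close>.\<close>
  define q where "q r = (inverse (d r))\<^sup>2" for r
  have q: "continuous_on UNIV q" "0 \<le> q r" "q r \<le> q a" for r
    unfolding q_def using d(1,2,4) by (auto intro!: continuous_intros power_mono le_imp_inverse_le
      simp: less_imp_le less_imp_neq[symmetric])
  have dq: "d r * q r = inverse (d r)" for r
    using d(2)[of r] by (simp add: q_def power2_eq_square)
  have qanti: "q s \<le> q r" if "r \<le> s" for r s
    unfolding q_def using d(2) d(3)[OF that]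
    by (auto intro!: power_mono le_imp_inverse_le simp: less_imp_le)
  have s: "L2_loc (\<lambda>x. \<phi> x * \<sigma> x)" using Linf_loc_mult_L2_loc[OF \<phi> \<sigma>] by simp
  have "(\<lambda>x. ennreal ((\<phi> x * \<sigma> x)\<^sup>2)) \<in> borel_measurable lebesgue"
    by (intro measurable_compose[OF _ measurable_ennreal] borel_measurable_power L2_loc_measurable[OF s])
  then obtain w where w: "w \<in> borel_measurable lborel" "AE x in lborel. ennreal ((\<phi> x * \<sigma> x)\<^sup>2) = w x"
    using completion_ex_borel_measurable by blast
  have mass: "(\<integral>\<^sup>+x. w x * indicator (ball 0 R) x \<partial>lborel) \<le> ennreal (\<Psi> R)" if "a \<le> R" for R
  proof -
    have "(\<integral>\<^sup>+x. w x * indicator (ball 0 R) x \<partial>lborel) =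
        (\<integral>\<^sup>+x. ennreal ((\<phi> x * \<sigma> x)\<^sup>2) * indicator (ball 0 R) x \<partial>lborel)"
      by (rule nn_integral_cong_AE) (use w(2) in auto)
    also have "\<dots> = (\<integral>\<^sup>+x. ennreal ((\<phi> x * \<sigma> x)\<^sup>2) * indicator (ball 0 R) x \<partial>lebesgue)"
      by (simp add: nn_integral_completion)
    also have "\<dots> = ennreal (LINT x:ball 0 R|lebesgue. (\<phi> x * \<sigma> x)\<^sup>2)" by (rule L2_mass_ball[OF s])
    also have "\<dots> \<le> ennreal (\<Psi> R)"
      using growth that aR by (intro ennreal_leI) (simp add: growth_bound_def)
    finally show ?thesis .
  qed
  have "(\<integral>\<^sup>+x. w x * indicator (ball 0 b) x * ennreal (q (norm x)) \<partial>lborel) \<le>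
      ennreal (\<Psi> a) * ennreal (q a) + (\<integral>\<^sup>+r. ennreal (d r * q r) * indicator {a..b} r \<partial>lborel)"
    by (rule ball_weight_bound[OF _ mass q(1) qanti q(2,3) d(1) less_imp_le[OF d(2)] \<Psi> less_imp_le[OF ab]])
       (use w(1) in simp_all)
  also have "(\<integral>\<^sup>+r. ennreal (d r * q r) * indicator {a..b} r \<partial>lborel) =
      (\<integral>\<^sup>+r. ennreal (inverse (d r)) * indicator {a..b} r \<partial>lborel)"
    by (simp only: dq)
  also have "\<dots> = ennreal (P b - P a)"
  proof (rule nn_integral_FTC_Icc)
    show "(\<lambda>r. inverse (d r)) \<in> borel_measurable borel"
      using d(1,2) by (intro borel_measurable_continuous_onI continuous_intros) (auto simp: less_imp_neq[symmetric])
  qed (use P(1) d(2) ab in \<open>auto simp: less_imp_le\<close>)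
  finally have wb: "(\<integral>\<^sup>+x. w x * indicator (ball 0 b) x * ennreal (q (norm x)) \<partial>lborel) \<le>
      ennreal (\<Psi> a * q a + T)"
    using P(2) \<Psi>(2) q(2) T0 by (simp add: T_def ennreal_plus ennreal_mult)
  define Q where "Q x = (\<phi> x * \<sigma> x)\<^sup>2 * (norm (grad \<eta> x))\<^sup>2" for x
  have Qb: "Q x \<le> 16 / T\<^sup>2 * ((\<phi> x * \<sigma> x)\<^sup>2 * indicator (ball 0 b) x * q (norm x))" for x
  proof (cases "b \<le> norm x")
    case True
    then show ?thesis using \<eta>g[of x] outer(2)[OF True] by (simp add: Q_def)
  next
    case False
    have "norm (grad \<eta> x) \<le> 4 / T * inverse (d (norm x))" using \<eta>g[of x] k'b[of "norm x"] by linarith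
    then have "(norm (grad \<eta> x))\<^sup>2 \<le> (4 / T * inverse (d (norm x)))\<^sup>2" by (intro power_mono) auto
    then have "(norm (grad \<eta> x))\<^sup>2 \<le> 16 / T\<^sup>2 * q (norm x)"
      by (simp only: q_def power_mult_distrib power_divide) simp
    from mult_left_mono[OF this, of "(\<phi> x * \<sigma> x)\<^sup>2"] False show ?thesis by (simp add: Q_def mult_ac)
  qed
  have "ennreal (LINT x|lebesgue. Q x) = (\<integral>\<^sup>+x. ennreal (Q x) \<partial>lebesgue)"
    by (rule nn_integral_eq_integral[symmetric]) (use C(2) in \<open>simp_all add: Q_def[abs_def]\<close>)
  also have "\<dots> = (\<integral>\<^sup>+x. ennreal (Q x) \<partial>lborel)" by (rule nn_integral_completion)
  also have "\<dots> \<le> (\<integral>\<^sup>+x. ennreal (16 / T\<^sup>2) * (w x * indicator (ball 0 b) x * ennreal (q (norm x))) \<partial>lborel)"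
  proof (rule nn_integral_mono_AE, use w(2) in eventually_elim)
    fix x assume wx: "ennreal ((\<phi> x * \<sigma> x)\<^sup>2) = w x"
    have "ennreal (Q x) \<le> ennreal (16 / T\<^sup>2 * ((\<phi> x * \<sigma> x)\<^sup>2 * indicator (ball 0 b) x * q (norm x)))"
      by (rule ennreal_leI[OF Qb])
    also have "\<dots> = ennreal (16 / T\<^sup>2) * (w x * indicator (ball 0 b) x * ennreal (q (norm x)))"
    proof -
      have prod: "ennreal (c * (a * indicator S x * b)) = ennreal c * (ennreal a * indicator S x * ennreal b)"
        if "0 \<le> c" "0 \<le> a" "0 \<le> b" for a b c :: real and S
        using that by (simp add: indicator_def ennreal_mult)
      show ?thesis unfolding wx[symmetric] by (rule prod) (use q(2) in simp_all)
    qed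
    finally show "ennreal (Q x) \<le> ennreal (16 / T\<^sup>2) * (w x * indicator (ball 0 b) x * ennreal (q (norm x)))" .
  qed
  also have "\<dots> = ennreal (16 / T\<^sup>2) * (\<integral>\<^sup>+x. w x * indicator (ball 0 b) x * ennreal (q (norm x)) \<partial>lborel)"
  proof (rule nn_integral_cmult)
    have "(\<lambda>x::'a. q (norm x)) \<in> borel_measurable lborel"
      by (intro continuous_imp_measurable(1) continuous_on_compose2[OF q(1)] continuous_intros) auto
    then have "(\<lambda>x::'a. ennreal (q (norm x))) \<in> borel_measurable lborel"
      by (rule measurable_compose[OF _ measurable_ennreal])
    then show "(\<lambda>x. w x * indicator (ball 0 b) x * ennreal (q (norm x))) \<in> borel_measurable lborel"
      by (intro borel_measurable_times_ennreal borel_measurable_indicator w(1)) simp_all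
  qed
  also have "\<dots> \<le> ennreal (16 / T\<^sup>2) * ennreal (\<Psi> a * q a + T)" by (rule mult_left_mono[OF wb]) simp
  also have "\<dots> = ennreal (16 / T\<^sup>2 * (\<Psi> a * q a + T))"
    by (rule ennreal_mult[symmetric]) (use \<Psi>(2) q(2) T0 in simp_all)
  finally have Q: "(LINT x|lebesgue. Q x) \<le> 16 / T\<^sup>2 * (\<Psi> a * q a + T)"
    using \<Psi>(2) q(2) T0 by (subst (asm) ennreal_le_iff) auto
  have "(LINT x|lebesgue. indicator (ball 0 a) x * (norm (\<phi> x *\<^sub>R G x))\<^sup>2) \<le>
      (LINT x|lebesgue. (\<eta> x)\<^sup>2 * (norm (\<phi> x *\<^sub>R G x))\<^sup>2)"
  proof (rule integral_mono)
    show "integrable lebesgue (\<lambda>x. indicator (ball 0 a) x * (norm (\<phi> x *\<^sub>R G x))\<^sup>2)"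
      by (rule L2_loc_integrable_ball[OF Linf_loc_mult_L2_loc[OF \<phi> G]])
    show "indicator (ball 0 a) x * (norm (\<phi> x *\<^sub>R G x))\<^sup>2 \<le> (\<eta> x)\<^sup>2 * (norm (\<phi> x *\<^sub>R G x))\<^sup>2" for x
      using inner(1)[of "norm x"] by (simp add: indicator_def \<eta>_def)
  qed (rule C(1))
  also have "\<dots> \<le> 4 * (LINT x|lebesgue. Q x)" using C(3) by (simp add: Q_def)
  also have "\<dots> \<le> 4 * (16 / T\<^sup>2 * (\<Psi> a * q a + T))" by (rule mult_left_mono[OF Q]) simp
  finally show "(LINT x|lebesgue. indicator (ball 0 a) x * (norm (\<phi> x *\<^sub>R G x))\<^sup>2) \<le>
      64 / (P b)\<^sup>2 * (\<Psi> a * (inverse (d a))\<^sup>2 + P b)"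
    by (simp add: T_def q_def)
qed

text \<open>
  The bound of the energy estimate is of order \<open>1 / P b\<close>, and \<open>P b\<close> can be made arbitrarily large.
\<close>

lemma flux_zero_on_ball:
  fixes \<sigma> :: "'a::euclidean_space \<Rightarrow> real" and d P :: "real \<Rightarrow> real"
  assumes \<phi>: "Linf_loc \<phi>" and \<sigma>: "L2_loc \<sigma>" and G: "L2_loc G" and div: "sigma_div_nonneg \<phi> \<sigma> G"
    and growth: "growth_bound \<Psi> \<phi> \<sigma>"
    and aR: "1 \<le> a"
    and d: "continuous_on UNIV d" "\<And>r. 0 < d r" "\<And>r s. r \<le> s \<Longrightarrow> d r \<le> d s" "\<And>r. d a \<le> d r"
    and \<Psi>: "\<And>r. a \<le> r \<Longrightarrow> (\<Psi> has_real_derivative d r) (at r)" "0 \<le> \<Psi> a"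
    and P: "\<And>r. (P has_real_derivative inverse (d r)) (at r)" "P a = 0"
    and unbounded: "\<And>K. \<exists>R>a. K < P R"
  shows "AE x in lebesgue. x \<in> ball 0 a \<longrightarrow> \<phi> x *\<^sub>R G x = 0"
proof -
  define X where "X = (LINT x|lebesgue. indicator (ball 0 a) x * (norm (\<phi> x *\<^sub>R G x))\<^sup>2)"
  define A where "A = \<Psi> a * (inverse (d a))\<^sup>2"
  have A: "0 \<le> A" using \<Psi>(2) by (simp add: A_def)
  have "X \<le> 0"
  proof (rule ccontr)
    assume "\<not> X \<le> 0"
    then have X: "0 < X" by simp
    obtain R where R: "a < R" "max 1 (64 * (A + 1) / X) < P R" using unbounded by blast
    define T where "T = P R"
    have T: "1 < T" "64 * (A + 1) / X < T" using R(2) by (simp_all add: T_def)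
    have "X \<le> 64 / T\<^sup>2 * (A + T)"
      using energy_estimate(2)[OF \<phi> \<sigma> G div growth aR R(1) d \<Psi> P] by (simp add: X_def A_def T_def)
    also have "\<dots> \<le> 64 / T\<^sup>2 * ((A + 1) * T)"
    proof (rule mult_left_mono)
      have "A * 1 \<le> A * T" using A T(1) by (intro mult_left_mono) auto
      then show "A + T \<le> (A + 1) * T" by (simp add: algebra_simps)
    qed simp
    also have "\<dots> = 64 * (A + 1) / T" using T(1) by (simp add: power2_eq_square field_simps)
    also have "\<dots> < X" using T X by (simp add: field_simps)
    finally show False by simp
  qed
  moreover have "0 \<le> X" unfolding X_def by simp
  ultimately have X0: "X = 0" by simp
  from integral_nonneg_eq_0_iff_AE[OF L2_loc_integrable_ball[OF Linf_loc_mult_L2_loc[OF \<phi> G], of a]] X0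
  have "AE x in lebesgue. indicator (ball 0 a) x * (norm (\<phi> x *\<^sub>R G x))\<^sup>2 = 0"
    by (simp add: X_def)
  then show ?thesis by eventually_elim (auto simp: indicator_def)
qed

text \<open>
  Convexity enters through the tangent inequality, which makes \<open>\<Psi>'\<close> increasing beyond \<open>R\<^sub>0\<close>. For each
  radius \<open>a > R\<^sub>0\<close> the derivative is frozen below \<open>a\<close>, so that \<open>d\<close> is increasing on the whole line. The
  integral over \<open>[1, a]\<close> is finite, so divergence takes place at infinity.
\<close>

lemma subsolution_ae_constant:
  fixes \<sigma> :: "'a::euclidean_space \<Rightarrow> real"
  assumes deriv: "\<And>R. R \<ge> 1 \<Longrightarrow> (\<Psi> has_real_derivative \<Psi>' R) (at R within {1..})"
    and cont: "continuous_on {1..} \<Psi>'"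
    and pos: "\<And>R. R \<ge> 1 \<Longrightarrow> \<Psi> R > 0" "\<And>R. R \<ge> 1 \<Longrightarrow> \<Psi>' R > 0"
    and R0: "R\<^sub>0 > 1" and conv: "convex_on {R\<^sub>0..} \<Psi>"
    and inf: "(\<integral>\<^sup>+ R\<in>{1..}. ennreal (1 / \<Psi>' R) \<partial>lborel) = \<infinity>"
    and \<phi>: "Linf_loc \<phi>" "AE x in lebesgue. 0 < \<phi> x" and \<sigma>: "L2_loc \<sigma>"
    and G: "has_L2_weak_gradient \<sigma> G" and div: "sigma_div_nonneg \<phi> \<sigma> G"
    and growth: "growth_bound \<Psi> \<phi> \<sigma>"
  shows "ae_constant \<sigma>"
proof -
  have Gl: "L2_loc G" using G by (simp add: has_L2_weak_gradient_def)
  note der = deriv_at_interior[OF deriv]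
  have tangent: "\<Psi>' r * (s - r) \<le> \<Psi> s - \<Psi> r" if "R\<^sub>0 < r" "R\<^sub>0 < s" for r s
  proof (rule convex_on_imp_above_tangent[OF conv])
    show "(\<Psi> has_real_derivative \<Psi>' r) (at r within {R\<^sub>0..})"
      using der[of r] that R0 by (simp add: has_field_derivative_at_within)
  qed (use that in \<open>auto simp: interior_Ici[of "R\<^sub>0 - 1"]\<close>)
  have mono: "\<Psi>' r \<le> \<Psi>' s" if "R\<^sub>0 < r" "r \<le> s" for r s
  proof (cases "r = s")
    case False
    then have "0 < s - r" using that by simp
    moreover have "\<Psi>' r * (s - r) \<le> \<Psi>' s * (s - r)"
      using tangent[of r s] tangent[of s r] that by (simp add: algebra_simps)
    ultimately show ?thesis by simp
  qed simp
  have ball0: "AE x in lebesgue. x \<in> ball 0 a \<longrightarrow> \<phi> x *\<^sub>R G x = 0" if aR: "R\<^sub>0 < a" for a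
  proof -
    have a1: "1 < a" using R0 aR by simp
    define d where "d r = \<Psi>' (max r a)" for r
    have dc: "continuous_on UNIV d"
      unfolding d_def using a1 by (intro continuous_on_compose2[OF cont] continuous_intros) auto
    have dpos: "0 < d r" for r using pos(2)[of "max r a"] a1 by (simp add: d_def)
    have dm: "d r \<le> d s" if "r \<le> s" for r s unfolding d_def by (rule mono) (use aR that in auto)
    have d1: "d a \<le> d r" for r unfolding d_def by (rule mono) (use aR in auto)
    have der1: "(\<Psi> has_real_derivative d r) (at r)" if "a \<le> r" for r
      using der[of r] that a1 by (simp add: d_def max_absorb1)
    have ic: "continuous_on UNIV (\<lambda>r. inverse (d r))"
      using dc dpos by (intro continuous_intros) (auto simp: less_imp_neq[symmetric])
    obtain P where P: "\<And>r. (P has_real_derivative inverse (d r)) (at r)" "P a = 0"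
      using global_antiderivative[OF ic] by blast
    have unb: "\<exists>R>a. K < P R" for K
    proof (rule ccontr)
      assume "\<not> ?thesis"
      then have K: "P R \<le> K" if "a < R" for R using that by force
      have "strict_mono P" by (rule antiderivative_strict_mono[OF P(1)]) (simp add: dpos)
      then have Pmono: "P r \<le> P s" if "r \<le> s" for r s using that by (simp add: strict_mono_less_eq)
      have bdd: "bdd_above (range P)"
      proof (rule bdd_aboveI2[of _ _ K])
        fix r
        have "P (max r (a + 1)) \<le> K" by (rule K) (simp add: less_max_iff_disj)
        then show "P r \<le> K" using Pmono[of r "max r (a + 1)"] by simp
      qed
      define L where "L = (SUP r. P r)"
      have lim: "(P \<longlongrightarrow> L) at_top"
      proof (rule increasing_tendsto)
        show "\<forall>\<^sub>F r in at_top. P r \<le> L" unfolding L_def using bdd by (auto intro!: cSUP_upper always_eventually)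
        fix y assume "y < L"
        then obtain r where "y < P r" unfolding L_def using less_cSUP_iff[OF _ bdd] by auto
        then have "y < P s" if "r \<le> s" for s using Pmono[OF that] by simp
        then show "\<forall>\<^sub>F s in at_top. y < P s" unfolding eventually_at_top_linorder by blast
      qed
      have im: "(\<lambda>r. inverse (d r)) \<in> borel_measurable borel" using ic by (rule borel_measurable_continuous_onI)
      have tail: "(\<integral>\<^sup>+r. ennreal (inverse (d r)) * indicator {a..} r \<partial>lborel) = ennreal (L - P a)"
        by (rule nn_integral_FTC_atLeast[OF im P(1) _ lim]) (use dpos in \<open>simp add: less_imp_le\<close>)
      have "continuous_on {1..a} (\<lambda>r. inverse (\<Psi>' r))"
        using pos(2) by (intro continuous_intros continuous_on_subset[OF cont]) (auto simp: less_imp_neq[symmetric])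
      then have "bounded ((\<lambda>r. inverse (\<Psi>' r)) ` {1..a})"
        by (intro compact_imp_bounded compact_continuous_image) auto
      then obtain C where C: "\<forall>r\<in>{1..a}. \<bar>inverse (\<Psi>' r)\<bar> \<le> C"
        unfolding bounded_iff by auto
      have "(\<integral>\<^sup>+ R\<in>{1..}. ennreal (1 / \<Psi>' R) \<partial>lborel) \<le>
          (\<integral>\<^sup>+r. ennreal C * indicator {1..a} r + ennreal (inverse (d r)) * indicator {a..} r \<partial>lborel)"
      proof (rule nn_integral_mono)
        fix r :: real
        show "ennreal (1 / \<Psi>' r) * indicator {1..} r \<le>
            ennreal C * indicator {1..a} r + ennreal (inverse (d r)) * indicator {a..} r"
        proof (cases "a \<le> r")
          case True
          then show ?thesis using a1 by (auto simp: d_def max_absorb1 inverse_eq_divide indicator_def)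
        next
          case False
          then show ?thesis using C[rule_format, of r] pos(2)[of r] by (auto simp: indicator_def inverse_eq_divide intro!: ennreal_leI)
        qed
      qed
      also have "\<dots> = (\<integral>\<^sup>+r. ennreal C * indicator {1..a} r \<partial>lborel) + ennreal (L - P a)"
        using im by (subst nn_integral_add) (simp_all add: tail)
      also have "\<dots> < \<infinity>"
        using a1 by (subst nn_integral_cmult) (simp_all add: ennreal_mult_less_top)
      finally show False using inf by simp
    qed
    show ?thesis
      by (rule flux_zero_on_ball[OF \<phi>(1) \<sigma> Gl div growth _ dc dpos dm d1 der1 _ P unb])
         (use a1 pos(1)[of a] in auto)
  qed
  have "AE x in lebesgue. \<forall>n. x \<in> ball 0 (R\<^sub>0 + real (Suc n)) \<longrightarrow> \<phi> x *\<^sub>R G x = 0"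
    unfolding AE_all_countable using ball0 by simp
  then have "AE x in lebesgue. G x = 0"
    using \<phi>(2)
  proof eventually_elim
    case (elim x)
    obtain n where "norm x < real n" using reals_Archimedean2[of "norm x"] by (elim exE)
    then have "x \<in> ball 0 (R\<^sub>0 + real (Suc n))" using R0 by simp
    with elim(1) have "\<phi> x *\<^sub>R G x = 0" by blast
    then show ?case using elim(2) by simp
  qed
  then show ?thesis by (rule weak_gradient_zero_imp_ae_constant[OF \<sigma> G])
qed


section \<open>Convergence of the integral gives a nonconstant solution\<close>

text \<open>
  The integral of every difference quotient vanishes because Lebesgue measure is translation invariant.
\<close>

lemma integral_directional_derivative_zero:
  fixes f f' :: "'a::euclidean_space \<Rightarrow> real"
  assumes der: "\<And>x. ((\<lambda>t. f (x + t *\<^sub>R b)) has_real_derivative f' x) (at 0)"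
    and cont: "continuous_on UNIV f" "continuous_on UNIV f'"
    and supp: "\<And>x. R < norm x \<Longrightarrow> f x = 0" "\<And>x. R < norm x \<Longrightarrow> f' x = 0"
  shows "(LINT x|lebesgue. f' x) = 0"
proof -
  obtain M where M: "\<And>x. norm (f' x) \<le> M" "0 \<le> M"
    using bounded_if_compact_support[OF cont(2) supp(2)] by blast
  define h where "h n = inverse (real (Suc n))" for n
  have h: "0 < h n" "h n \<le> 1" for n by (simp_all add: h_def field_simps)
  have h0: "h \<longlonglongrightarrow> 0" unfolding h_def by (rule LIMSEQ_inverse_real_of_nat)
  have der': "((\<lambda>t. f (x + t *\<^sub>R b)) has_real_derivative f' (x + s *\<^sub>R b)) (at s)" for x s
    using der[of "x + s *\<^sub>R b"] DERIV_shift[of "\<lambda>t. f (x + t *\<^sub>R b)" "f' (x + s *\<^sub>R b)" 0 s]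
    by (simp add: algebra_simps)
  define u where "u n x = (f (x + h n *\<^sub>R b) - f x) / h n" for n x
  have fc: "continuous_on UNIV (\<lambda>x. f (x + c))" for c
    by (rule continuous_on_compose2[OF cont(1)]) (auto intro!: continuous_intros)
  have fi: "integrable lebesgue f" by (rule integrable_continuous_compact_support[OF cont(1) supp(1)])
  have fci: "integrable lebesgue (\<lambda>x. f (x + c))" for c
  proof (rule integrable_continuous_compact_support[OF fc])
    fix x :: 'a assume "R + norm c < norm x"
    then have "R < norm (x + c)" using norm_diff_ineq[of x c] by linarith
    then show "f (x + c) = 0" by (rule supp(1))
  qed
  have trans: "(LINT x|lebesgue. f (x + c)) = (LINT x|lebesgue. f x)" for c
  proof -
    have "(LINT x|lebesgue. f (x + c)) = (LINT x|lborel. f (x + c))"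
      by (rule integral_completion[OF continuous_imp_measurable(1)[OF fc]])
    also have "\<dots> = (LINT x|lborel. f (c + x))" by (simp only: add.commute)
    also have "\<dots> = (LINT x|distr lborel borel ((+) c). f x)"
      by (rule integral_distr[symmetric]) (use continuous_imp_measurable(1)[OF cont(1)] in simp_all)
    also have "\<dots> = (LINT x|lebesgue. f x)"
      unfolding lborel_distr_plus by (rule integral_completion[OF continuous_imp_measurable(1)[OF cont(1)], symmetric])
    finally show ?thesis .
  qed
  have bd: "norm (u n x) \<le> M * indicator (cball 0 (R + norm b)) x" for n x
  proof (cases "R + norm b < norm x")
    case True
    have "norm (h n *\<^sub>R b) \<le> norm b" using h[of n] by (simp add: mult_left_le_one_le)
    then have "R < norm (x + h n *\<^sub>R b)" "R < norm x"
      using True norm_diff_ineq[of x "h n *\<^sub>R b"] norm_ge_zero[of b] by linarith+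
    then show ?thesis using supp(1) M(2) by (simp add: u_def)
  next
    case False
    have "\<exists>z>0. z < h n \<and> f (x + h n *\<^sub>R b) - f (x + 0 *\<^sub>R b) = (h n - 0) * f' (x + z *\<^sub>R b)"
      by (rule MVT2[OF h(1)[of n], of "\<lambda>t. f (x + t *\<^sub>R b)" "\<lambda>t. f' (x + t *\<^sub>R b)"]) (rule der')
    then obtain z where "f (x + h n *\<^sub>R b) - f (x + 0 *\<^sub>R b) = (h n - 0) * f' (x + z *\<^sub>R b)"
      by auto
    then have "u n x = f' (x + z *\<^sub>R b)" using h(1)[of n] by (simp add: u_def)
    then show ?thesis using M(1) False by simp
  qed
  have um: "u n \<in> borel_measurable lebesgue" for n
    unfolding u_def[abs_def] using fc[of "h n *\<^sub>R b"] cont(1) h(1)[of n]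
    by (intro continuous_imp_measurable(2) continuous_intros) auto
  have "(\<lambda>n. LINT x|lebesgue. u n x) \<longlonglongrightarrow> (LINT x|lebesgue. f' x)"
  proof (rule integral_dominated_convergence[where w="\<lambda>x. M * indicator (cball 0 (R + norm b)) x"])
    show "integrable lebesgue (\<lambda>x::'a. M * indicator (cball 0 (R + norm b)) x)"
      by (rule integrable_indicator_cball)
    show "AE x in lebesgue. (\<lambda>n. u n x) \<longlonglongrightarrow> f' x"
    proof (rule AE_I2)
      fix x
      have "((\<lambda>t. (f (x + (0 + t) *\<^sub>R b) - f (x + 0 *\<^sub>R b)) / t) \<longlongrightarrow> f' x) (at 0)"
        using der[of x] unfolding DERIV_def .
      moreover have "filterlim h (at 0) sequentially"
        unfolding filterlim_at using h0 h(1) by (auto intro!: always_eventually simp: less_imp_neq[symmetric])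
      ultimately have "(\<lambda>n. (f (x + (0 + h n) *\<^sub>R b) - f (x + 0 *\<^sub>R b)) / h n) \<longlonglongrightarrow> f' x"
        by (rule filterlim_compose)
      then show "(\<lambda>n. u n x) \<longlonglongrightarrow> f' x" by (simp add: u_def)
    qed
    show "AE x in lebesgue. norm (u n x) \<le> M * indicator (cball 0 (R + norm b)) x" for n
      using bd by simp
  qed (use um continuous_imp_measurable(2)[OF cont(2)] in simp_all)
  moreover have "(LINT x|lebesgue. u n x) = 0" for n
    unfolding u_def using fi fci trans by simp
  ultimately show ?thesis by (simp add: LIMSEQ_const_iff)
qed

text \<open>
  Only differentiability in the direction \<open>b\<close> is asked for, so that the lemma covers functions that are
  merely continuous in the other coordinates.
\<close>

lemma integration_by_parts_test:
  fixes f f' :: "'a::euclidean_space \<Rightarrow> real"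
  assumes der: "\<And>x. ((\<lambda>t. f (x + t *\<^sub>R b)) has_real_derivative f' x) (at 0)"
    and cont: "continuous_on UNIV f" "continuous_on UNIV f'"
    and \<eta>: "test_function \<eta>"
  shows "(LINT x|lebesgue. f x * (grad \<eta> x \<bullet> b)) = - (LINT x|lebesgue. \<eta> x * f' x)"
proof -
  obtain R where Ck: "\<And>k. Ck k \<eta>" and R: "\<And>x. R < norm x \<Longrightarrow> \<eta> x = 0"
    using \<eta> unfolding test_function_iff by blast
  note ec = Ck_imp_continuous[OF Ck] and gc = continuous_on_grad[OF Ck]
  have g0: "grad \<eta> x = 0" if "R < norm x" for x using grad_eq_0_outside[OF R that] .
  have "((\<lambda>t. f (x + t *\<^sub>R b) * \<eta> (x + t *\<^sub>R b)) has_real_derivative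
      f x * (grad \<eta> x \<bullet> b) + \<eta> x * f' x) (at 0)" for x
  proof -
    have "((\<lambda>t::real. x + t *\<^sub>R b) has_derivative (\<lambda>t. t *\<^sub>R b)) (at 0)"
      by (auto intro!: derivative_eq_intros)
    moreover have "(\<eta> has_derivative (\<lambda>h. grad \<eta> x \<bullet> h)) (at (x + 0 *\<^sub>R b))"
      using C1_has_derivative[OF Ck] by simp
    ultimately have "((\<lambda>t. \<eta> (x + t *\<^sub>R b)) has_derivative (\<lambda>t. grad \<eta> x \<bullet> (t *\<^sub>R b))) (at 0)"
      by (rule has_derivative_compose)
    then have "((\<lambda>t. \<eta> (x + t *\<^sub>R b)) has_real_derivative grad \<eta> x \<bullet> b) (at 0)"
      by (simp add: has_field_derivative_def mult_commute_abs)
    from DERIV_mult[OF der this] show ?thesis by (simp add: algebra_simps)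
  qed
  note der\<eta> = this
  have c1: "continuous_on UNIV (\<lambda>x. f x * (grad \<eta> x \<bullet> b))"
    by (rule continuous_on_mult[OF cont(1) continuous_on_inner[OF gc continuous_on_const]])
  have c2: "continuous_on UNIV (\<lambda>x. \<eta> x * f' x)" by (rule continuous_on_mult[OF ec cont(2)])
  have "(LINT x|lebesgue. f x * (grad \<eta> x \<bullet> b) + \<eta> x * f' x) = 0"
  proof (rule integral_directional_derivative_zero[OF der\<eta>])
    show "continuous_on UNIV (\<lambda>x. f x * \<eta> x)" by (rule continuous_on_mult[OF cont(1) ec])
    show "continuous_on UNIV (\<lambda>x. f x * (grad \<eta> x \<bullet> b) + \<eta> x * f' x)"
      by (rule continuous_on_add[OF c1 c2])
  next
    fix x :: 'a assume x: "R < norm x"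
    show "f x * \<eta> x = 0" "f x * (grad \<eta> x \<bullet> b) + \<eta> x * f' x = 0" using R[OF x] g0[OF x] by simp_all
  qed
  moreover have "integrable lebesgue (\<lambda>x. f x * (grad \<eta> x \<bullet> b))"
    by (rule integrable_continuous_compact_support[OF c1, of R]) (simp add: g0)
  moreover have "integrable lebesgue (\<lambda>x. \<eta> x * f' x)"
    by (rule integrable_continuous_compact_support[OF c2, of R]) (simp add: R)
  ultimately show ?thesis by simp
qed

lemma continuous_imp_Linf_loc:
  fixes f :: "'a::euclidean_space \<Rightarrow> real"
  assumes "continuous_on UNIV f"
  shows "Linf_loc f"
  unfolding Linf_loc_def
proof (intro conjI allI impI)
  show "f \<in> borel_measurable lebesgue" using assms by (rule continuous_imp_measurable(2))
  fix K :: "'a set" assume K: "compact K"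
  have "bounded (f ` K)"
    by (intro compact_imp_bounded compact_continuous_image K continuous_on_subset[OF assms subset_UNIV])
  then obtain C where "\<forall>x\<in>K. \<bar>f x\<bar> \<le> C" unfolding bounded_iff by auto
  then show "\<exists>C. AE x in lebesgue. x \<in> K \<longrightarrow> \<bar>f x\<bar> \<le> C" by (intro exI[of _ C]) simp
qed

lemma nn_integral_even:
  fixes u :: "real \<Rightarrow> ennreal"
  assumes u[measurable]: "u \<in> borel_measurable borel" and even: "\<And>t. u (- t) = u t"
  shows "(\<integral>\<^sup>+t. u t \<partial>lborel) \<le> 2 * (\<integral>\<^sup>+t. u t * indicator {0..} t \<partial>lborel)"
proof -
  have "(\<integral>\<^sup>+t. u t * indicator {..0} t \<partial>lborel) = (\<integral>\<^sup>+t. u (0 + (-1) * t) * indicator {..0} (0 + (-1) * t) \<partial>lborel)"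
    by (subst nn_integral_real_affine[where c="-1" and t=0]) auto
  also have "\<dots> = (\<integral>\<^sup>+t. u t * indicator {0..} t \<partial>lborel)"
    by (rule nn_integral_cong) (simp add: even indicator_def)
  finally have neg: "(\<integral>\<^sup>+t. u t * indicator {..0} t \<partial>lborel) = (\<integral>\<^sup>+t. u t * indicator {0..} t \<partial>lborel)" .
  have "(\<integral>\<^sup>+t. u t \<partial>lborel) \<le> (\<integral>\<^sup>+t. u t * indicator {..0} t + u t * indicator {0..} t \<partial>lborel)"
    by (rule nn_integral_mono) (auto simp: indicator_def)
  also have "\<dots> = 2 * (\<integral>\<^sup>+t. u t * indicator {0..} t \<partial>lborel)"
    by (subst nn_integral_add) (simp_all add: neg mult_2)
  finally show ?thesis .
qed

text \<open>
  The data for the counterexample: \<open>d\<close> extends \<open>\<Psi>'\<close> to a positive even function on the line, constant on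
  \<open>[-1, 1]\<close>; its reciprocal has the bounded antiderivative \<open>S\<close>; and the integral of \<open>d\<close> over
  \<open>[-R, R]\<close> is at most \<open>K * \<Psi> R\<close>, since on \<open>[1, \<infinity>)\<close> an antiderivative of \<open>d\<close> differs from \<open>\<Psi>\<close> by a
  constant and \<open>\<Psi>\<close> is bounded below by \<open>\<Psi> 1\<close> there.
\<close>

lemma one_dimensional_profile:
  assumes deriv: "\<And>R. R \<ge> 1 \<Longrightarrow> (\<Psi> has_real_derivative \<Psi>' R) (at R within {1..})"
    and cont: "continuous_on {1..} \<Psi>'"
    and pos: "\<And>R. R \<ge> 1 \<Longrightarrow> \<Psi> R > 0" "\<And>R. R \<ge> 1 \<Longrightarrow> \<Psi>' R > 0"
    and fin: "(\<integral>\<^sup>+ R\<in>{1..}. ennreal (1 / \<Psi>' R) \<partial>lborel) < \<infinity>"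
  obtains d S :: "real \<Rightarrow> real" and M K :: real where
    "continuous_on UNIV d" "\<And>t. 0 < d t" "(\<integral>\<^sup>+t. ennreal (inverse (d t)) \<partial>lborel) < \<infinity>"
    "\<And>t. (S has_real_derivative inverse (d t)) (at t)" "\<And>t. \<bar>S t\<bar> \<le> M" "0 \<le> K"
    "\<And>R. 1 \<le> R \<Longrightarrow> (\<integral>\<^sup>+t. ennreal (d t) * indicator {-R..R} t \<partial>lborel) \<le> ennreal (K * \<Psi> R)"
proof -
  define d where "d t = \<Psi>' (max 1 \<bar>t\<bar>)" for t
  define g where "g t = inverse (d t)" for t
  have dc: "continuous_on UNIV d"
    unfolding d_def by (intro continuous_on_compose2[OF cont] continuous_intros) auto
  have dpos: "0 < d t" for t using pos(2)[of "max 1 \<bar>t\<bar>"] by (simp add: d_def)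
  have gc: "continuous_on UNIV g"
    unfolding g_def using dc dpos by (intro continuous_intros) (auto simp: less_imp_neq[symmetric])
  have [measurable]: "d \<in> borel_measurable borel" "g \<in> borel_measurable borel"
    using dc gc by (auto intro: borel_measurable_continuous_onI)
  have even: "d (- t) = d t" "g (- t) = g t" for t by (simp_all add: d_def g_def)
  have "(\<lambda>t. ennreal (1 / \<Psi>' t) * indicator {1..} t) = (\<lambda>t. ennreal (g t) * indicator {1..} t)"
    by (auto simp: fun_eq_iff indicator_def g_def d_def inverse_eq_divide max_absorb2)
  then have tm: "(\<lambda>t. ennreal (1 / \<Psi>' t) * indicator {1..} t) \<in> borel_measurable lborel" by simp
  have "(\<integral>\<^sup>+t. ennreal (g t) * indicator {0..} t \<partial>lborel) \<le>
      (\<integral>\<^sup>+t. ennreal (inverse (\<Psi>' 1)) * indicator {0..1} t + ennreal (1 / \<Psi>' t) * indicator {1..} t \<partial>lborel)"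
    by (rule nn_integral_mono) (auto simp: indicator_def g_def d_def inverse_eq_divide)
  also have "\<dots> = (\<integral>\<^sup>+t. ennreal (inverse (\<Psi>' 1)) * indicator {0..1::real} t \<partial>lborel) +
      (\<integral>\<^sup>+ R\<in>{1..}. ennreal (1 / \<Psi>' R) \<partial>lborel)"
    by (rule nn_integral_add[OF _ tm]) simp
  also have "\<dots> < \<infinity>" using fin by (subst nn_integral_cmult) (simp_all add: ennreal_mult_less_top)
  finally have half: "(\<integral>\<^sup>+t. ennreal (g t) * indicator {0..} t \<partial>lborel) < \<infinity>" .
  have gfin: "(\<integral>\<^sup>+t. ennreal (g t) \<partial>lborel) < \<infinity>"
    using nn_integral_even[of "\<lambda>t. ennreal (g t)"] half
    by (auto simp: even ennreal_mult_less_top intro: le_less_trans)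
  define M where "M = enn2real (\<integral>\<^sup>+t. ennreal (g t) \<partial>lborel)"
  have M: "(\<integral>\<^sup>+t. ennreal (g t) \<partial>lborel) = ennreal M" unfolding M_def using gfin by simp
  obtain S where S: "\<And>t. (S has_real_derivative g t) (at t)" "S 0 = 0"
    using global_antiderivative[OF gc] by blast
  have Sd: "S t - S s \<le> M" if "s \<le> t" for s t
  proof -
    have "ennreal (S t - S s) = (\<integral>\<^sup>+r. ennreal (g r) * indicator {s..t} r \<partial>lborel)"
      by (rule nn_integral_FTC_Icc[symmetric]) (use S(1) dpos that in \<open>auto simp: g_def less_imp_le\<close>)
    also have "\<dots> \<le> (\<integral>\<^sup>+r. ennreal (g r) \<partial>lborel)"
      by (rule nn_integral_mono) (auto simp: indicator_def)
    finally show ?thesis unfolding M by (subst (asm) ennreal_le_iff) (simp_all add: M_def)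
  qed
  have "strict_mono S" by (rule antiderivative_strict_mono[OF S(1)]) (simp add: g_def dpos)
  then have Smono: "S s \<le> S t" if "s \<le> t" for s t using that by (simp add: strict_mono_less_eq)
  have Sb: "\<bar>S t\<bar> \<le> M" for t
    using Sd[of 0 t] Sd[of t 0] Smono[of 0 t] Smono[of t 0] S(2) by (cases "0 \<le> t") auto
  obtain D where D: "\<And>t. (D has_real_derivative d t) (at t)" "D 0 = 0"
    using global_antiderivative[OF dc] by blast
  have "strict_mono D" by (rule antiderivative_strict_mono[OF D(1) dpos])
  then have Dmono: "D s \<le> D t" if "s \<le> t" for s t using that by (simp add: strict_mono_less_eq)
  have D1: "0 \<le> D 1" using Dmono[of 0 1] D(2) by simp
  note \<Psi>der = deriv_at_interior[OF deriv]
  have \<Psi>c: "continuous_on {1..R} \<Psi>" for R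
    by (rule continuous_on_subset[of "{1..}"])
       (auto intro!: DERIV_continuous_on[OF deriv])
  have DR: "D R - \<Psi> R = D 1 - \<Psi> 1" if "1 \<le> R" for R
  proof (cases "R = 1")
    case False
    show ?thesis
    proof (rule DERIV_isconst_end[of 1 R "\<lambda>r. D r - \<Psi> r"])
      show "1 < R" using that False by simp
      show "continuous_on {1..R} (\<lambda>r. D r - \<Psi> r)"
        using D(1) by (intro continuous_on_diff \<Psi>c) (meson DERIV_isCont continuous_at_imp_continuous_on)
      fix x assume x: "1 < x" "x < R"
      then have "((\<lambda>r. D r - \<Psi> r) has_real_derivative d x - \<Psi>' x) (at x)"
        by (intro DERIV_diff D(1) \<Psi>der)
      then show "((\<lambda>r. D r - \<Psi> r) has_real_derivative 0) (at x)" using x by (simp add: d_def)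
    qed
  qed simp
  have \<Psi>mono: "\<Psi> 1 \<le> \<Psi> R" if "1 \<le> R" for R using Dmono[OF that] DR[OF that] by simp
  define K where "K = 2 * (1 + D 1 / \<Psi> 1)"
  have K: "0 \<le> K" using D1 pos(1)[of 1] by (simp add: K_def)
  have mass: "(\<integral>\<^sup>+t. ennreal (d t) * indicator {-R..R} t \<partial>lborel) \<le> ennreal (K * \<Psi> R)" if R: "1 \<le> R" for R
  proof -
    have "(\<integral>\<^sup>+t. ennreal (d t) * indicator {-R..R} t \<partial>lborel) \<le>
        2 * (\<integral>\<^sup>+t. ennreal (d t) * indicator {-R..R} t * indicator {0..} t \<partial>lborel)"
      by (rule nn_integral_even) (auto simp: even indicator_def)
    also have "(\<integral>\<^sup>+t. ennreal (d t) * indicator {-R..R} t * indicator {0..} t \<partial>lborel) =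
        (\<integral>\<^sup>+t. ennreal (d t) * indicator {0..R} t \<partial>lborel)"
      by (rule nn_integral_cong) (auto simp: indicator_def)
    also have "\<dots> = ennreal (D R - D 0)"
      by (rule nn_integral_FTC_Icc) (use D(1) dpos R in \<open>auto simp: less_imp_le\<close>)
    also have "2 * ennreal (D R - D 0) \<le> ennreal (K * \<Psi> R)"
    proof -
      have "D 1 * \<Psi> 1 \<le> D 1 * \<Psi> R" using D1 \<Psi>mono[OF R] by (intro mult_left_mono)
      then have "D 1 \<le> D 1 / \<Psi> 1 * \<Psi> R" using pos(1)[of 1] by (simp add: field_simps)
      then have "D R \<le> (1 + D 1 / \<Psi> 1) * \<Psi> R" using DR[OF R] pos(1)[of 1] by (simp add: algebra_simps)
      then have "2 * D R \<le> 2 * ((1 + D 1 / \<Psi> 1) * \<Psi> R)" by simp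
      then have "2 * D R \<le> K * \<Psi> R" by (simp only: K_def mult.assoc)
      then have "ennreal (2 * D R) \<le> ennreal (K * \<Psi> R)" by (rule ennreal_leI)
      then show ?thesis by (simp add: D(2) ennreal_mult')
    qed
    finally show ?thesis by (simp add: mult_left_mono)
  qed
  show ?thesis
    by (rule that[of d S M K]) (use dc dpos gfin S Sb K mass in \<open>simp_all add: g_def\<close>)
qed

text \<open>
  The function \<open>\<sigma> x = S (x \<bullet> e)\<close> has gradient \<open>e / d (x \<bullet> e)\<close>. Choosing \<open>\<phi>\<^sup>2 = \<epsilon> d (x \<bullet> e) a\<close>, where \<open>a\<close>
  does not depend on the coordinate \<open>x \<bullet> e\<close>, makes the flux \<open>\<phi>\<^sup>2 G = \<epsilon> a e\<close> constant in its own direction,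
  hence divergence free. For the growth bound \<open>a\<close> has to be integrable in the other coordinates; the
  function \<open>1 / d\<close> is positive, continuous and integrable, so a product of copies of it serves. Enlarging
  the ball of radius \<open>R\<close> to the slab \<open>|x \<bullet> e| \<le> R\<close> then factorises the integral over the coordinates, and
  \<open>\<epsilon>\<close> absorbs all constants.
\<close>

lemma property_P'_fails:
  assumes deriv: "\<And>R. R \<ge> 1 \<Longrightarrow> (\<Psi> has_real_derivative \<Psi>' R) (at R within {1..})"
    and cont: "continuous_on {1..} \<Psi>'"
    and pos: "\<And>R. R \<ge> 1 \<Longrightarrow> \<Psi> R > 0" "\<And>R. R \<ge> 1 \<Longrightarrow> \<Psi>' R > 0"
    and fin: "(\<integral>\<^sup>+ R\<in>{1..}. ennreal (1 / \<Psi>' R) \<partial>lborel) < \<infinity>"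
  shows "\<not> property_P' TYPE('a::euclidean_space) \<Psi>"
proof (rule one_dimensional_profile[OF deriv cont pos fin])
  fix d S :: "real \<Rightarrow> real" and M K :: real
  assume dc: "continuous_on UNIV d" and dpos: "\<And>t. 0 < d t"
    and fin1: "(\<integral>\<^sup>+t. ennreal (inverse (d t)) \<partial>lborel) < \<infinity>"
    and S: "\<And>t. (S has_real_derivative inverse (d t)) (at t)" and SM: "\<And>t. \<bar>S t\<bar> \<le> M" and K: "0 \<le> K"
    and mass: "\<And>R. 1 \<le> R \<Longrightarrow> (\<integral>\<^sup>+t. ennreal (d t) * indicator {-R..R} t \<partial>lborel) \<le> ennreal (K * \<Psi> R)"
  obtain e :: 'a where e: "e \<in> Basis" using nonempty_Basis by blast
  define g where "g t = inverse (d t)" for t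
  have gpos: "0 < g t" for t using dpos by (simp add: g_def)
  have gc: "continuous_on UNIV g"
    unfolding g_def using dc dpos by (intro continuous_intros) (auto simp: less_imp_neq[symmetric])
  have [measurable]: "d \<in> borel_measurable borel" "g \<in> borel_measurable borel"
    using dc gc by (auto intro: borel_measurable_continuous_onI)
  have Sc: "continuous_on UNIV S" using S by (meson DERIV_isCont continuous_at_imp_continuous_on)
  define I where "I = enn2real (\<integral>\<^sup>+t. ennreal (g t) \<partial>lborel)"
  have I: "(\<integral>\<^sup>+t. ennreal (g t) \<partial>lborel) = ennreal I" "0 \<le> I" unfolding I_def g_def using fin1 by simp_all
  define a where "a x = (\<Prod>b\<in>Basis - {e}. g (x \<bullet> b))" for x :: 'a
  have apos: "0 < a x" for x unfolding a_def by (rule prod_pos) (rule gpos)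
  have comp: "continuous_on UNIV (\<lambda>x::'a. u (x \<bullet> b))" if "continuous_on UNIV u" for u :: "real \<Rightarrow> real" and b
    by (rule continuous_on_compose2[OF that]) (auto intro!: continuous_intros)
  have ac: "continuous_on UNIV a" unfolding a_def[abs_def] by (intro continuous_on_prod comp gc)
  define J where "J = M\<^sup>2 * (K * I ^ card (Basis - {e}))"
  have J: "0 \<le> J" unfolding J_def using K I(2) by simp
  define \<epsilon> where "\<epsilon> = inverse (J + 1)"
  have \<epsilon>: "0 < \<epsilon>" "\<epsilon> * J \<le> 1" using J by (simp_all add: \<epsilon>_def field_simps)
  define \<phi> where "\<phi> x = sqrt (\<epsilon> * d (x \<bullet> e) * a x)" for x
  define \<sigma> where "\<sigma> x = S (x \<bullet> e)" for x
  define G where "G x = g (x \<bullet> e) *\<^sub>R e" for x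
  have \<phi>2: "(\<phi> x)\<^sup>2 = \<epsilon> * d (x \<bullet> e) * a x" for x
    unfolding \<phi>_def using \<epsilon>(1) dpos apos by (simp add: less_imp_le)
  have \<phi>c: "continuous_on UNIV \<phi>" unfolding \<phi>_def[abs_def] by (intro continuous_intros comp dc ac)
  have \<phi>pos: "0 < \<phi> x" for x unfolding \<phi>_def using \<epsilon>(1) dpos apos by simp
  have \<sigma>c: "continuous_on UNIV \<sigma>" unfolding \<sigma>_def[abs_def] by (rule comp[OF Sc])
  have Gc: "continuous_on UNIV G" unfolding G_def[abs_def] by (intro continuous_intros comp gc)
  have weak: "has_L2_weak_gradient \<sigma> G"
    unfolding has_L2_weak_gradient_def
  proof (intro conjI allI impI)
    show "L2_loc G" by (rule continuous_imp_L2_loc[OF Gc])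
    fix \<eta> :: "'a \<Rightarrow> real" assume \<eta>: "test_function \<eta>"
    obtain R where Ck: "\<And>k. Ck k \<eta>" and R: "\<And>x. R < norm x \<Longrightarrow> \<eta> x = 0"
      using \<eta> unfolding test_function_iff by blast
    have g0: "grad \<eta> x = 0" if "R < norm x" for x using grad_eq_0_outside[OF R that] .
    have i1: "integrable lebesgue (\<lambda>x. \<sigma> x *\<^sub>R grad \<eta> x)"
      by (rule integrable_continuous_compact_support[OF continuous_on_scaleR[OF \<sigma>c continuous_on_grad[OF Ck]], of R])
         (simp add: g0)
    have i2: "integrable lebesgue (\<lambda>x. \<eta> x *\<^sub>R G x)"
      by (rule integrable_continuous_compact_support[OF continuous_on_scaleR[OF Ck_imp_continuous[OF Ck] Gc], of R])
         (simp add: R)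
    show "(LINT x|lebesgue. \<sigma> x *\<^sub>R grad \<eta> x) = - (LINT x|lebesgue. \<eta> x *\<^sub>R G x)"
    proof (rule euclidean_eqI)
      fix b :: 'a assume b: "b \<in> Basis"
      have "((\<lambda>t. \<sigma> (x + t *\<^sub>R b)) has_real_derivative G x \<bullet> b) (at 0)" for x
      proof -
        have "((\<lambda>t. x \<bullet> e + t * (b \<bullet> e)) has_real_derivative b \<bullet> e) (at 0)"
          by (auto intro!: derivative_eq_intros)
        moreover have "(S has_real_derivative g (x \<bullet> e)) (at (x \<bullet> e + 0 * (b \<bullet> e)))"
          using S[of "x \<bullet> e"] by (simp add: g_def)
        ultimately have "((\<lambda>t. S (x \<bullet> e + t * (b \<bullet> e))) has_real_derivative g (x \<bullet> e) * (b \<bullet> e)) (at 0)"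
          by (rule DERIV_chain2[rotated])
        moreover have "\<sigma> (x + t *\<^sub>R b) = S (x \<bullet> e + t * (b \<bullet> e))" for t
          by (simp add: \<sigma>_def inner_add_left)
        moreover have "G x \<bullet> b = g (x \<bullet> e) * (b \<bullet> e)" by (simp add: G_def inner_commute[of e b])
        ultimately show ?thesis by simp
      qed
      then have "(LINT x|lebesgue. \<sigma> x * (grad \<eta> x \<bullet> b)) = - (LINT x|lebesgue. \<eta> x * (G x \<bullet> b))"
        by (rule integration_by_parts_test[OF _ \<sigma>c _ \<eta>]) (intro continuous_intros Gc)
      then show "(LINT x|lebesgue. \<sigma> x *\<^sub>R grad \<eta> x) \<bullet> b = (- (LINT x|lebesgue. \<eta> x *\<^sub>R G x)) \<bullet> b"
        using i1 i2 by (simp flip: integral_inner_left)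
    qed
  qed
  have div: "div_zero \<phi> G"
    unfolding div_zero_def
  proof (intro allI impI)
    fix \<eta> :: "'a \<Rightarrow> real" assume \<eta>: "test_function \<eta>"
    have "(\<lambda>t. a (x + t *\<^sub>R e)) = (\<lambda>t. a x)" for x
    proof
      fix t
      have "(x + t *\<^sub>R e) \<bullet> b = x \<bullet> b" if "b \<in> Basis - {e}" for b
        using that e by (auto simp: inner_add_left inner_Basis)
      then show "a (x + t *\<^sub>R e) = a x" unfolding a_def by (intro prod.cong) simp_all
    qed
    then have "((\<lambda>t. a (x + t *\<^sub>R e)) has_real_derivative 0) (at 0)" for x by simp
    then have "(LINT x|lebesgue. a x * (grad \<eta> x \<bullet> e)) = - (LINT x|lebesgue. \<eta> x * 0)"
      by (rule integration_by_parts_test[OF _ ac _ \<eta>]) simp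
    moreover have "(\<phi> x)\<^sup>2 * (G x \<bullet> grad \<eta> x) = \<epsilon> * (a x * (grad \<eta> x \<bullet> e))" for x
      using dpos[of "x \<bullet> e"] by (simp add: \<phi>2 G_def g_def inner_commute field_simps)
    ultimately show "(LINT x|lebesgue. (\<phi> x)\<^sup>2 * (G x \<bullet> grad \<eta> x)) = 0" by simp
  qed
  have growth: "growth_bound \<Psi> \<phi> \<sigma>"
    unfolding growth_bound_def
  proof (intro allI impI)
    fix R :: real assume R: "1 \<le> R"
    define f where "f b t = (if b = e then ennreal (d t) * indicator {-R..R} t else ennreal (g t))" for b :: 'a and t
    have fm: "f b \<in> borel_measurable borel" for b unfolding f_def[abs_def] by (cases "b = e") simp_all
    have "(\<integral>\<^sup>+x. ennreal (indicator (ball 0 R) x * (\<phi> x * \<sigma> x)\<^sup>2) \<partial>lebesgue) \<le>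
        (\<integral>\<^sup>+x. ennreal (\<epsilon> * M\<^sup>2) * (\<Prod>b\<in>Basis. f b (x \<bullet> b)) \<partial>lebesgue)"
    proof (rule nn_integral_mono)
      fix x :: 'a
      show "ennreal (indicator (ball 0 R) x * (\<phi> x * \<sigma> x)\<^sup>2) \<le> ennreal (\<epsilon> * M\<^sup>2) * (\<Prod>b\<in>Basis. f b (x \<bullet> b))"
      proof (cases "x \<in> ball 0 R")
        case True
        then have xe: "x \<bullet> e \<in> {-R..R}" using Basis_le_norm[OF e, of x] by auto
        have "(\<Prod>b\<in>Basis. f b (x \<bullet> b)) = f e (x \<bullet> e) * (\<Prod>b\<in>Basis - {e}. f b (x \<bullet> b))"
          by (rule prod.remove) (use e in auto)
        also have "(\<Prod>b\<in>Basis - {e}. f b (x \<bullet> b)) = (\<Prod>b\<in>Basis - {e}. ennreal (g (x \<bullet> b)))"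
          by (rule prod.cong) (auto simp: f_def)
        also have "\<dots> = ennreal (a x)" unfolding a_def by (rule prod_ennreal) (simp add: gpos less_imp_le)
        also have "f e (x \<bullet> e) = ennreal (d (x \<bullet> e))" using xe by (simp add: f_def)
        finally have prod: "(\<Prod>b\<in>Basis. f b (x \<bullet> b)) = ennreal (d (x \<bullet> e) * a x)"
          using dpos[of "x \<bullet> e"] apos[of x] by (simp add: ennreal_mult)
        have "(S (x \<bullet> e))\<^sup>2 \<le> M\<^sup>2"
          using SM[of "x \<bullet> e"] power_mono[of "\<bar>S (x \<bullet> e)\<bar>" M 2] by simp
        then have "(\<epsilon> * d (x \<bullet> e) * a x) * (S (x \<bullet> e))\<^sup>2 \<le> (\<epsilon> * d (x \<bullet> e) * a x) * M\<^sup>2"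
          using \<epsilon>(1) dpos[of "x \<bullet> e"] apos[of x] by (intro mult_left_mono) auto
        then have "(\<phi> x * \<sigma> x)\<^sup>2 \<le> \<epsilon> * M\<^sup>2 * (d (x \<bullet> e) * a x)"
          by (simp only: power_mult_distrib \<phi>2 \<sigma>_def mult_ac)
        then have "ennreal ((\<phi> x * \<sigma> x)\<^sup>2) \<le> ennreal (\<epsilon> * M\<^sup>2 * (d (x \<bullet> e) * a x))" by (rule ennreal_leI)
        also have "\<dots> = ennreal (\<epsilon> * M\<^sup>2) * ennreal (d (x \<bullet> e) * a x)"
          by (rule ennreal_mult) (use \<epsilon>(1) dpos[of "x \<bullet> e"] apos[of x] in auto)
        finally show ?thesis using True by (simp only: prod indicator_simps mult_1)
      qed simp
    qed
    also have "\<dots> = (\<integral>\<^sup>+x. ennreal (\<epsilon> * M\<^sup>2) * (\<Prod>b\<in>Basis. f b (x \<bullet> b)) \<partial>(lborel :: 'a measure))"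
      by (rule nn_integral_completion)
    also have "\<dots> = ennreal (\<epsilon> * M\<^sup>2) * (\<integral>\<^sup>+x. (\<Prod>b\<in>Basis. f b (x \<bullet> b)) \<partial>(lborel :: 'a measure))"
    proof (rule nn_integral_cmult)
      show "(\<lambda>x::'a. \<Prod>b\<in>Basis. f b (x \<bullet> b)) \<in> borel_measurable lborel"
        by (intro borel_measurable_prod_ennreal measurable_compose[OF _ fm]) simp
    qed
    also have "(\<integral>\<^sup>+x. (\<Prod>b\<in>Basis. f b (x \<bullet> b)) \<partial>(lborel :: 'a measure)) = (\<Prod>b\<in>Basis. \<integral>\<^sup>+t. f b t \<partial>lborel)"
      by (rule nn_integral_lborel_prod) (simp_all add: fm)
    also have "\<dots> = (\<integral>\<^sup>+t. f e t \<partial>lborel) * (\<Prod>b\<in>Basis - {e}. \<integral>\<^sup>+t. f b t \<partial>lborel)"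
      by (rule prod.remove) (use e in auto)
    also have "(\<Prod>b\<in>Basis - {e}. \<integral>\<^sup>+t. f b t \<partial>lborel) = (\<Prod>b\<in>Basis - {e}. ennreal I)"
      by (rule prod.cong) (auto simp: f_def I(1))
    also have "\<dots> = ennreal (I ^ card (Basis - {e}))" using I(2) by (simp add: ennreal_power)
    also have "ennreal (\<epsilon> * M\<^sup>2) * ((\<integral>\<^sup>+t. f e t \<partial>lborel) * ennreal (I ^ card (Basis - {e}))) \<le>
        ennreal (\<epsilon> * M\<^sup>2) * (ennreal (K * \<Psi> R) * ennreal (I ^ card (Basis - {e})))"
      using mass[OF R] by (intro mult_left_mono mult_right_mono) (simp_all add: f_def)
    also have "\<dots> = ennreal (\<epsilon> * M\<^sup>2 * (K * \<Psi> R * I ^ card (Basis - {e})))"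
      using \<epsilon>(1) K pos(1)[OF R] I(2) by (simp add: ennreal_mult)
    also have "\<dots> \<le> ennreal (\<Psi> R)"
    proof (rule ennreal_leI)
      have "\<epsilon> * J * \<Psi> R \<le> 1 * \<Psi> R" using \<epsilon>(2) pos(1)[OF R] by (intro mult_right_mono) auto
      then show "\<epsilon> * M\<^sup>2 * (K * \<Psi> R * I ^ card (Basis - {e})) \<le> \<Psi> R" by (simp add: J_def mult_ac)
    qed
    finally have le: "(\<integral>\<^sup>+x. ennreal (indicator (ball 0 R) x * (\<phi> x * \<sigma> x)\<^sup>2) \<partial>lebesgue) \<le> ennreal (\<Psi> R)" .
    have m: "(\<lambda>x. indicator (ball 0 R) x * (\<phi> x * \<sigma> x)\<^sup>2) \<in> borel_measurable lebesgue"
    proof (rule borel_measurable_times)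
      show "(\<lambda>x. (\<phi> x * \<sigma> x)\<^sup>2) \<in> borel_measurable lebesgue"
        by (intro continuous_imp_measurable(2) continuous_intros \<phi>c \<sigma>c)
    qed (rule borel_measurable_indicator, simp)
    have "(LINT x|lebesgue. indicator (ball 0 R) x * (\<phi> x * \<sigma> x)\<^sup>2) =
        enn2real (\<integral>\<^sup>+x. ennreal (indicator (ball 0 R) x * (\<phi> x * \<sigma> x)\<^sup>2) \<partial>lebesgue)"
      by (rule integral_eq_nn_integral[OF m]) simp
    also have "\<dots> \<le> \<Psi> R" using le pos(1)[OF R] by (intro enn2real_leI) auto
    finally show "(LINT x:ball 0 R|lebesgue. (\<phi> x * \<sigma> x)\<^sup>2) \<le> \<Psi> R"
      by (simp add: set_lebesgue_integral_def)
  qed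
  have nonconst: "\<not> ae_constant \<sigma>"
  proof
    assume "ae_constant \<sigma>"
    then obtain c where "AE x in lebesgue. \<sigma> x = c" unfolding ae_constant_def by blast
    moreover have "open {x. \<sigma> x \<noteq> c}" by (rule open_Collect_neq[OF \<sigma>c continuous_on_const])
    ultimately have all: "\<sigma> x = c" for x by (rule AE_lebesgue_open)
    have "strict_mono S" by (rule antiderivative_strict_mono[OF S]) (simp add: dpos)
    then have "S 0 < S 1" by (rule strict_monoD) simp
    moreover have "S 0 = c" "S 1 = c" using all[of 0] all[of e] e by (simp_all add: \<sigma>_def)
    ultimately show False by simp
  qed
  have "H1_loc \<sigma>" unfolding H1_loc_def using continuous_imp_L2_loc[OF \<sigma>c] weak by blast
  then have "Linf_loc \<phi> \<and> (AE x in lebesgue. 0 < \<phi> x) \<and> H1_loc \<sigma> \<and> has_L2_weak_gradient \<sigma> G \<and>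
      div_zero \<phi> G \<and> growth_bound \<Psi> \<phi> \<sigma>"
    using continuous_imp_Linf_loc[OF \<phi>c] \<phi>pos weak div growth by simp
  then show ?thesis using nonconst unfolding property_P'_def by blast
qed

section \<open>The equivalence\<close>

theorem theorem1p3:
  fixes \<Psi> \<Psi>' :: "real \<Rightarrow> real" and R\<^sub>0 :: real
  assumes deriv: "\<And>R. R \<ge> 1 \<Longrightarrow> (\<Psi> has_real_derivative \<Psi>' R) (at R within {1..})"
    and cont: "continuous_on {1..} \<Psi>'"
    and pos: "\<And>R. R \<ge> 1 \<Longrightarrow> \<Psi> R > 0"
    and deriv_pos: "\<And>R. R \<ge> 1 \<Longrightarrow> \<Psi>' R > 0"
    and R0: "R\<^sub>0 > 1"
    and conv: "convex_on {R\<^sub>0..} \<Psi>"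
  shows "(property_P TYPE(real ^ 'n) \<Psi> \<longleftrightarrow> property_P' TYPE(real ^ 'n) \<Psi>) \<and>
         (property_P' TYPE(real ^ 'n) \<Psi> \<longleftrightarrow>
            (\<integral>\<^sup>+ R\<in>{1..}. ennreal (1 / \<Psi>' R) \<partial>lborel) = \<infinity>)"
proof -
  let ?div = "(\<integral>\<^sup>+ R\<in>{1..}. ennreal (1 / \<Psi>' R) \<partial>lborel) = \<infinity>"
  have 1: "property_P' TYPE(real ^ 'n) \<Psi>" if "property_P TYPE(real ^ 'n) \<Psi>"
    using that div_zero_imp_sigma_div_nonneg
    unfolding property_P_def property_P'_def H1_loc_def by blast
  have 2: ?div if "property_P' TYPE(real ^ 'n) \<Psi>"
  proof (rule ccontr)
    assume "\<not> ?div"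
    then have "(\<integral>\<^sup>+ R\<in>{1..}. ennreal (1 / \<Psi>' R) \<partial>lborel) < \<infinity>" by (simp add: less_top)
    from property_P'_fails[OF deriv cont pos deriv_pos this] that show False by blast
  qed
  have 3: "property_P TYPE(real ^ 'n) \<Psi>" if ?div
    unfolding property_P_def
  proof (intro conjI allI impI)
    show "continuous_on {1..} \<Psi>" using DERIV_continuous_on[OF deriv] by simp
    show "0 < \<Psi> R" if "1 \<le> R" for R using pos[OF that] .
  next
    fix \<phi> \<sigma> :: "real ^ 'n \<Rightarrow> real" and G
    assume "Linf_loc \<phi> \<and> (AE x in lebesgue. 0 < \<phi> x) \<and> H1_loc \<sigma> \<and>
      has_L2_weak_gradient \<sigma> G \<and> sigma_div_nonneg \<phi> \<sigma> G \<and> growth_bound \<Psi> \<phi> \<sigma>"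
    then show "ae_constant \<sigma>"
      using subsolution_ae_constant[OF deriv cont pos deriv_pos R0 conv that]
      unfolding H1_loc_def by blast
  qed
  from 1 2 3 show ?thesis by blast
qed

end
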